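(* Let $A,B$ be $n\times n$ matrices with nonnegative real entries and $C=AB$. For any $0<\varepsilon<1$ and any integer $k\ge 1$ there exists a deterministic one-pass approximation algorithm returning a matrix $\widehat{C}$ such that for every positive integer $p$, $$\|C-\widehat{C}\|_{Ep}\le (1+\varepsilon)^{1/p}\,(\varepsilon/k)^{1-1/p}\,\|C\|_{E^k1}.$$ The algorithm runs in time $O(n\,\mathrm{Sort}(n)+nk/\varepsilon)$ and uses space $O(n+k/\varepsilon)$.
   Context: For a matrix $M\in\mathbb{R}^{n\times n}$ and positive integer $p$, the entrywise $p$-norm is $\|M\|_{Ep}=(\sum_{i,j}|M_{ij}|^p)^{1/p}$. The $k$-residual entrywise $1$-norm $\|M\|_{E^k1}$ is the entrywise $1$-norm of the matrix obtained from $M$ by replacing its $k$ entries of largest absolute value (ties broken arbitrarily) by $0$. $\mathrm{Sort}(n)$ denotes the running time of a deterministic linear-space algorithm sorting $n$ real numbers. $A$ is stored in column-major order and $B$ in row-major order; one pass means one sequential scan over them. *)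

theory Defs
  imports Complex_Main "Jordan_Normal_Form.Matrix"
begin

section \<open>Entrywise norms\<close>

definition entrywise_norm :: "nat \<Rightarrow> real mat \<Rightarrow> real" where
  "entrywise_norm p M =
     (\<Sum>i<dim_row M. \<Sum>j<dim_col M. \<bar>M $$ (i, j)\<bar> ^ p) powr (1 / real p)"

definition positions :: "real mat \<Rightarrow> (nat \<times> nat) set" where
  "positions M = {..<dim_row M} \<times> {..<dim_col M}"

text \<open>A matrix with fewer than k entries has all of them among its k largest ones.\<close>

definition largest_entries :: "nat \<Rightarrow> real mat \<Rightarrow> (nat \<times> nat) set \<Rightarrow> bool" where
  "largest_entries k M S \<longleftrightarrow>
     S \<subseteq> positions M \<and> card S = min k (card (positions M)) \<and>
     (\<forall>x\<in>S. \<forall>y\<in>positions M - S. \<bar>M $$ y\<bar> \<le> \<bar>M $$ x\<bar>)"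

definition zero_out :: "(nat \<times> nat) set \<Rightarrow> real mat \<Rightarrow> real mat" where
  "zero_out S M = mat (dim_row M) (dim_col M) (\<lambda>x. if x \<in> S then 0 else M $$ x)"

text \<open>The choice operator breaks the ties; by \<open>residual_norm_eq\<close> below
  the value does not depend on how it does so.\<close>

definition residual_norm :: "nat \<Rightarrow> real mat \<Rightarrow> real" where
  "residual_norm k M = entrywise_norm 1 (zero_out (SOME S. largest_entries k M S) M)"

lemma finite_positions [simp]: "finite (positions M)"
  by (simp add: positions_def)

lemma largest_entries_exists: "\<exists>S. largest_entries k M S"
proof (induction k)
  case 0
  have "largest_entries 0 M {}" by (simp add: largest_entries_def)
  then show ?case ..
next
  case (Suc k)
  then obtain S where S: "largest_entries k M S" ..
  have finS: "finite S"
    using S finite_subset[OF _ finite_positions] by (auto simp: largest_entries_def)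
  show ?case
  proof (cases "positions M - S = {}")
    case True
    then have "S = positions M" using S by (auto simp: largest_entries_def)
    then have "largest_entries (Suc k) M S"
      using S by (auto simp: largest_entries_def)
    then show ?thesis ..
  next
    case False
    let ?D = "positions M - S" and ?f = "\<lambda>x. \<bar>M $$ x\<bar>"
    have "Max (?f ` ?D) \<in> ?f ` ?D" using False by (intro Max_in) auto
    then obtain x where x: "x \<in> ?D" "?f x = Max (?f ` ?D)" by fastforce
    have mx: "?f y \<le> ?f x" if "y \<in> ?D" for y
      using that by (simp add: x(2))
    have "card S < card (positions M)"
      using S False by (intro psubset_card_mono) (auto simp: largest_entries_def)
    then have "largest_entries (Suc k) M (insert x S)"
      using S x(1) mx finS by (auto simp: largest_entries_def)
    then show ?thesis ..
  qed
qed

lemma entrywise_norm_zero_out: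
  "entrywise_norm 1 (zero_out S M) = (\<Sum>x\<in>positions M - S. \<bar>M $$ x\<bar>)"
proof -
  have nn: "(\<Sum>x\<in>positions M. \<bar>if x \<in> S then 0 else M $$ x\<bar>) \<ge> 0"
    by (intro sum_nonneg) auto
  have "(\<Sum>i<dim_row M. \<Sum>j<dim_col M. \<bar>zero_out S M $$ (i, j)\<bar>)
      = (\<Sum>i<dim_row M. \<Sum>j<dim_col M. \<bar>if (i, j) \<in> S then 0 else M $$ (i, j)\<bar>)"
    by (intro sum.cong refl) (simp add: zero_out_def)
  also have "\<dots> = (\<Sum>x\<in>positions M. \<bar>if x \<in> S then 0 else M $$ x\<bar>)"
    unfolding positions_def by (subst sum.cartesian_product) (intro sum.cong, auto)
  finally have "entrywise_norm 1 (zero_out S M)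
      = (\<Sum>x\<in>positions M. \<bar>if x \<in> S then 0 else M $$ x\<bar>)"
    using nn by (simp add: entrywise_norm_def zero_out_def)
  also have "\<dots> = (\<Sum>x\<in>positions M - S. \<bar>M $$ x\<bar>)"
    by (rule sum.mono_neutral_cong_right) auto
  finally show ?thesis .
qed

lemma residual_norm_eq:
  assumes "largest_entries k M S"
  shows "residual_norm k M = entrywise_norm 1 (zero_out S M)"
proof -
  define R where "R = (SOME S. largest_entries k M S)"
  have R: "largest_entries k M R"
    unfolding R_def by (rule someI_ex) (rule largest_entries_exists)
  let ?f = "\<lambda>x. \<bar>M $$ x\<bar>" and ?P = "positions M"
  have fin: "finite R" "finite S"
    using R assms finite_subset[OF _ finite_positions] by (auto simp: largest_entries_def)
  have sub: "R \<subseteq> ?P" "S \<subseteq> ?P" and card: "card R = card S"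
    using R assms by (auto simp: largest_entries_def)
  have cd: "card (R - S) = card (S - R)"
    using card fin by (metis Int_commute card_Diff_subset_Int finite_Int)
  have eq: "?f x = ?f y" if "x \<in> R - S" "y \<in> S - R" for x y
  proof (rule antisym)
    show "?f x \<le> ?f y" using assms that sub by (auto simp: largest_entries_def)
    show "?f y \<le> ?f x" using R that sub by (auto simp: largest_entries_def)
  qed
  have "sum ?f (R - S) = sum ?f (S - R)"
  proof (cases "S - R = {}")
    case True
    then have "card (R - S) = 0" using cd by (metis card.empty)
    then have "R - S = {}" using fin by simp
    then show ?thesis using True by simp
  next
    case False
    then obtain y where y: "y \<in> S - R" by auto
    then have "R - S \<noteq> {}"
      using cd fin by (metis card.empty card_gt_0_iff equals0D finite_Diff not_less_zero)
    then obtain x where x: "x \<in> R - S" by auto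
    have "sum ?f (R - S) = (\<Sum>z\<in>R - S. ?f y)" using eq y by (intro sum.cong) auto
    also have "\<dots> = (\<Sum>z\<in>S - R. ?f x)" using cd eq[OF x y] by simp
    also have "\<dots> = sum ?f (S - R)" using eq x by (intro sum.cong) auto
    finally show ?thesis .
  qed
  moreover have "sum ?f R = sum ?f (R - S) + sum ?f (R \<inter> S)"
    using fin by (subst sum.Int_Diff[of R _ S]) (auto simp: add.commute)
  moreover have "sum ?f S = sum ?f (S - R) + sum ?f (R \<inter> S)"
    using fin by (subst sum.Int_Diff[of S _ R]) (auto simp: add.commute Int_commute)
  ultimately have "sum ?f R = sum ?f S" by simp
  then show ?thesis
    unfolding residual_norm_def R_def[symmetric] entrywise_norm_zero_out
    using sub by (simp add: sum_diff)
qed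


section \<open>The machine model\<close>

text \<open>
  Algorithms are programs of a deterministic while language for a real RAM.  Memory consists
  of natural-number and real scalars and of natural-number and real arrays, all named by natural
  numbers.  A program mentions only finitely many names, and its nesting of expressions is bounded,
  so up to a constant factor depending on the program only, one time unit per command is unit cost.

  Naturals are machine words: an expression whose value or intermediate result exceeds the word
  bound is unsafe.  Reals are exact and admit only the field operations and comparisons; there is no
  rounding, no conversion to naturals, and there are no real constants besides the naturals.

  The input matrices are available only through two read-only tapes that are consumed from
  the front and cannot be rewound.
\<close>

datatype iexp =
    INum nat
  | IVar nat
  | IGet nat iexp
  | IAdd iexp iexp
  | ISub iexp iexp
  | IMul iexp iexp
  | IDiv iexp iexp

datatype rexp =
    RNat iexp
  | RVar nat
  | RGet nat iexp
  | RAdd rexp rexp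
  | RSub rexp rexp
  | RMul rexp rexp
  | RDiv rexp rexp

datatype bexp =
    BILess iexp iexp
  | BRLess rexp rexp
  | BNot bexp
  | BAnd bexp bexp

datatype com =
    Skip
  | ISetVar nat iexp
  | RSetVar nat rexp
  | ISet nat iexp iexp
  | RSet nat iexp rexp
  | INew nat iexp
  | RNew nat iexp
  | ReadA nat
  | ReadB nat
  | Seq com com
  | Cond bexp com com
  | While bexp com

record state =
  ivar :: "nat \<Rightarrow> nat"
  rvar :: "nat \<Rightarrow> real"
  iarr :: "nat \<Rightarrow> nat list"
  rarr :: "nat \<Rightarrow> real list"
  tapeA :: "real list"
  tapeB :: "real list"

primrec ival :: "iexp \<Rightarrow> state \<Rightarrow> nat" where
  "ival (INum c) s = c"
| "ival (IVar x) s = ivar s x"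
| "ival (IGet a e) s = iarr s a ! ival e s"
| "ival (IAdd e f) s = ival e s + ival f s"
| "ival (ISub e f) s = ival e s - ival f s"
| "ival (IMul e f) s = ival e s * ival f s"
| "ival (IDiv e f) s = ival e s div ival f s"

primrec rval :: "rexp \<Rightarrow> state \<Rightarrow> real" where
  "rval (RNat e) s = real (ival e s)"
| "rval (RVar x) s = rvar s x"
| "rval (RGet a e) s = rarr s a ! ival e s"
| "rval (RAdd e f) s = rval e s + rval f s"
| "rval (RSub e f) s = rval e s - rval f s"
| "rval (RMul e f) s = rval e s * rval f s"
| "rval (RDiv e f) s = rval e s / rval f s"

primrec bval :: "bexp \<Rightarrow> state \<Rightarrow> bool" where
  "bval (BILess e f) s \<longleftrightarrow> ival e s < ival f s"
| "bval (BRLess e f) s \<longleftrightarrow> rval e s < rval f s"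
| "bval (BNot b) s \<longleftrightarrow> \<not> bval b s"
| "bval (BAnd b c) s \<longleftrightarrow> bval b s \<and> bval c s"

text \<open>Safe evaluation: array accesses are within bounds, no division by zero, and all naturals
  stay below the word bound \<open>W\<close>.  Conjunction is evaluated lazily.\<close>

primrec isafe :: "nat \<Rightarrow> iexp \<Rightarrow> state \<Rightarrow> bool" where
  "isafe W (INum c) s \<longleftrightarrow> c \<le> W"
| "isafe W (IVar x) s \<longleftrightarrow> ivar s x \<le> W"
| "isafe W (IGet a e) s \<longleftrightarrow>
     isafe W e s \<and> ival e s < length (iarr s a) \<and> iarr s a ! ival e s \<le> W"
| "isafe W (IAdd e f) s \<longleftrightarrow> isafe W e s \<and> isafe W f s \<and> ival e s + ival f s \<le> W"
| "isafe W (ISub e f) s \<longleftrightarrow> isafe W e s \<and> isafe W f s"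
| "isafe W (IMul e f) s \<longleftrightarrow> isafe W e s \<and> isafe W f s \<and> ival e s * ival f s \<le> W"
| "isafe W (IDiv e f) s \<longleftrightarrow> isafe W e s \<and> isafe W f s \<and> ival f s \<noteq> 0"

primrec rsafe :: "nat \<Rightarrow> rexp \<Rightarrow> state \<Rightarrow> bool" where
  "rsafe W (RNat e) s \<longleftrightarrow> isafe W e s"
| "rsafe W (RVar x) s \<longleftrightarrow> True"
| "rsafe W (RGet a e) s \<longleftrightarrow> isafe W e s \<and> ival e s < length (rarr s a)"
| "rsafe W (RAdd e f) s \<longleftrightarrow> rsafe W e s \<and> rsafe W f s"
| "rsafe W (RSub e f) s \<longleftrightarrow> rsafe W e s \<and> rsafe W f s"
| "rsafe W (RMul e f) s \<longleftrightarrow> rsafe W e s \<and> rsafe W f s"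
| "rsafe W (RDiv e f) s \<longleftrightarrow> rsafe W e s \<and> rsafe W f s \<and> rval f s \<noteq> 0"

primrec bsafe :: "nat \<Rightarrow> bexp \<Rightarrow> state \<Rightarrow> bool" where
  "bsafe W (BILess e f) s \<longleftrightarrow> isafe W e s \<and> isafe W f s"
| "bsafe W (BRLess e f) s \<longleftrightarrow> rsafe W e s \<and> rsafe W f s"
| "bsafe W (BNot b) s \<longleftrightarrow> bsafe W b s"
| "bsafe W (BAnd b c) s \<longleftrightarrow> bsafe W b s \<and> (bval b s \<longrightarrow> bsafe W c s)"

text \<open>Number of allocated array cells.  Only finitely many arrays are nonempty in any state reachable
  from the initial states below; the constantly many scalars of a program are not counted.\<close>

definition cells :: "state \<Rightarrow> nat" where
  "cells s = (\<Sum>a | iarr s a \<noteq> []. length (iarr s a)) + (\<Sum>a | rarr s a \<noteq> []. length (rarr s a))"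

text \<open>\<open>exec W c s t m s'\<close>: with word bound \<open>W\<close>, started in \<open>s\<close>, the command \<open>c\<close> terminates in \<open>s'\<close>
  after \<open>t\<close> time units, with at most \<open>m\<close> array cells (exactly \<open>m\<close> at the peak) allocated
  at any time.  Allocation replaces the previous array of that name, initialises the new one with
  zeros, and is charged its length.  Unsafe steps, and reading from an exhausted tape, have no
  transition.\<close>

inductive exec :: "nat \<Rightarrow> com \<Rightarrow> state \<Rightarrow> nat \<Rightarrow> nat \<Rightarrow> state \<Rightarrow> bool" for W :: nat where
  Skip: "exec W Skip s 1 (cells s) s"
| ISetVar: "isafe W e s \<Longrightarrow>
    exec W (ISetVar x e) s 1 (cells s) (s\<lparr>ivar := (ivar s)(x := ival e s)\<rparr>)"
| RSetVar: "rsafe W e s \<Longrightarrow>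
    exec W (RSetVar x e) s 1 (cells s) (s\<lparr>rvar := (rvar s)(x := rval e s)\<rparr>)"
| ISet: "isafe W i s \<Longrightarrow> isafe W e s \<Longrightarrow> ival i s < length (iarr s a) \<Longrightarrow>
    exec W (ISet a i e) s 1 (cells s)
      (s\<lparr>iarr := (iarr s)(a := (iarr s a)[ival i s := ival e s])\<rparr>)"
| RSet: "isafe W i s \<Longrightarrow> rsafe W e s \<Longrightarrow> ival i s < length (rarr s a) \<Longrightarrow>
    exec W (RSet a i e) s 1 (cells s)
      (s\<lparr>rarr := (rarr s)(a := (rarr s a)[ival i s := rval e s])\<rparr>)"
| INew: "isafe W e s \<Longrightarrow> s' = s\<lparr>iarr := (iarr s)(a := replicate (ival e s) 0)\<rparr> \<Longrightarrow>
    exec W (INew a e) s (1 + ival e s) (max (cells s) (cells s')) s'"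
| RNew: "isafe W e s \<Longrightarrow> s' = s\<lparr>rarr := (rarr s)(a := replicate (ival e s) 0)\<rparr> \<Longrightarrow>
    exec W (RNew a e) s (1 + ival e s) (max (cells s) (cells s')) s'"
| ReadA: "tapeA s = v # vs \<Longrightarrow>
    exec W (ReadA x) s 1 (cells s) (s\<lparr>rvar := (rvar s)(x := v), tapeA := vs\<rparr>)"
| ReadB: "tapeB s = v # vs \<Longrightarrow>
    exec W (ReadB x) s 1 (cells s) (s\<lparr>rvar := (rvar s)(x := v), tapeB := vs\<rparr>)"
| Seq: "exec W c\<^sub>1 s t\<^sub>1 m\<^sub>1 s\<^sub>1 \<Longrightarrow> exec W c\<^sub>2 s\<^sub>1 t\<^sub>2 m\<^sub>2 s\<^sub>2 \<Longrightarrow>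
    exec W (Seq c\<^sub>1 c\<^sub>2) s (t\<^sub>1 + t\<^sub>2) (max m\<^sub>1 m\<^sub>2) s\<^sub>2"
| CondTrue: "bsafe W b s \<Longrightarrow> bval b s \<Longrightarrow> exec W c\<^sub>1 s t m s' \<Longrightarrow>
    exec W (Cond b c\<^sub>1 c\<^sub>2) s (1 + t) m s'"
| CondFalse: "bsafe W b s \<Longrightarrow> \<not> bval b s \<Longrightarrow> exec W c\<^sub>2 s t m s' \<Longrightarrow>
    exec W (Cond b c\<^sub>1 c\<^sub>2) s (1 + t) m s'"
| WhileFalse: "bsafe W b s \<Longrightarrow> \<not> bval b s \<Longrightarrow> exec W (While b c) s 1 (cells s) s"
| WhileTrue: "bsafe W b s \<Longrightarrow> bval b s \<Longrightarrow> exec W c s t\<^sub>1 m\<^sub>1 s\<^sub>1 \<Longrightarrow>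
    exec W (While b c) s\<^sub>1 t\<^sub>2 m\<^sub>2 s\<^sub>2 \<Longrightarrow> exec W (While b c) s (1 + t\<^sub>1 + t\<^sub>2) (max m\<^sub>1 m\<^sub>2) s\<^sub>2"

inductive_cases exec_elims:
  "exec W Skip s t m s'" "exec W (ISetVar x e) s t m s'" "exec W (RSetVar x r) s t m s'"
  "exec W (ISet a i e) s t m s'" "exec W (RSet a i r) s t m s'"
  "exec W (INew a e) s t m s'" "exec W (RNew a e) s t m s'"
  "exec W (ReadA x) s t m s'" "exec W (ReadB x) s t m s'"

inductive_cases exec_SeqE: "exec W (Seq c\<^sub>1 c\<^sub>2) s t m s'"
inductive_cases exec_CondE: "exec W (Cond b c\<^sub>1 c\<^sub>2) s t m s'"
inductive_cases exec_WhileE: "exec W (While b c) s t m s'"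

lemma exec_deterministic:
  "exec W c s t m s' \<Longrightarrow> exec W c s u l s'' \<Longrightarrow> u = t \<and> l = m \<and> s'' = s'"
proof (induction arbitrary: u l s'' rule: exec.induct)
  case (Seq c\<^sub>1 s t\<^sub>1 m\<^sub>1 s\<^sub>1 c\<^sub>2 t\<^sub>2 m\<^sub>2 s\<^sub>2)
  from Seq.prems obtain t\<^sub>1' m\<^sub>1' s\<^sub>1' t\<^sub>2' m\<^sub>2'
    where 1: "exec W c\<^sub>1 s t\<^sub>1' m\<^sub>1' s\<^sub>1'" and 2: "exec W c\<^sub>2 s\<^sub>1' t\<^sub>2' m\<^sub>2' s''"
      and eq: "u = t\<^sub>1' + t\<^sub>2'" "l = max m\<^sub>1' m\<^sub>2'"
    by (rule exec_SeqE)
  from Seq.IH(1)[OF 1] 2 have "exec W c\<^sub>2 s\<^sub>1 t\<^sub>2' m\<^sub>2' s''" by simp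
  from Seq.IH(2)[OF this] Seq.IH(1)[OF 1] eq show ?case by simp
next
  case (CondTrue b s c\<^sub>1 t m s' c\<^sub>2)
  from CondTrue.prems show ?case
  proof (cases rule: exec_CondE[consumes 1, case_names 1 2])
    case 1
    show ?thesis using CondTrue.IH[OF 1(4)] 1(1) by simp
  next
    case 2
    show ?thesis using 2(3) CondTrue.hyps(2) by (rule notE)
  qed
next
  case (CondFalse b s c\<^sub>2 t m s' c\<^sub>1)
  from CondFalse.prems show ?case
  proof (cases rule: exec_CondE[consumes 1, case_names 1 2])
    case 1
    show ?thesis using CondFalse.hyps(2) 1(3) by (rule notE)
  next
    case 2
    show ?thesis using CondFalse.IH[OF 2(4)] 2(1) by simp
  qed
next
  case (WhileFalse b s c)
  from WhileFalse.prems show ?case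
  proof (cases rule: exec_WhileE[consumes 1, case_names 1 2])
    case 1
    then show ?thesis by simp
  next
    case 2
    show ?thesis using WhileFalse.hyps(2) 2(4) by (rule notE)
  qed
next
  case (WhileTrue b s c t\<^sub>1 m\<^sub>1 s\<^sub>1 t\<^sub>2 m\<^sub>2 s\<^sub>2)
  from WhileTrue.prems show ?case
  proof (cases rule: exec_WhileE[consumes 1, case_names 1 2])
    case 1
    show ?thesis using 1(5) WhileTrue.hyps(2) by (rule notE)
  next
    case 2
    from WhileTrue.IH(1)[OF 2(5)]
    show ?thesis using WhileTrue.IH(2) 2(1,2,6) by auto
  qed
next
  case (INew e s s' a)
  from INew.prems INew.hyps(2) show ?case by (elim exec_elims) (simp only: simp_thms)
next
  case (RNew e s s' a)
  from RNew.prems RNew.hyps(2) show ?case by (elim exec_elims) (simp only: simp_thms)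
qed (elim exec_elims, force)+


section \<open>Sorting\<close>

definition blank_state :: state where
  "blank_state = \<lparr>ivar = \<lambda>_. 0, rvar = \<lambda>_. 0, iarr = \<lambda>_. [], rarr = \<lambda>_. [], tapeA = [], tapeB = []\<rparr>"

definition sort_input :: "real list \<Rightarrow> state" where
  "sort_input xs = blank_state\<lparr>ivar := (\<lambda>_. 0)(0 := length xs), rarr := (\<lambda>_. [])(0 := xs)\<rparr>"

text \<open>The program \<open>S\<close> sorts n real numbers in time \<open>T n\<close> and linear space.
  As usual for sorting records by a key, the original indices are moved along with the numbers:
  natural-number array 0 tells where each number came from.  The word bound
  means words of O(log n) bits.\<close>

definition linear_space_sorter :: "com \<Rightarrow> (nat \<Rightarrow> nat) \<Rightarrow> bool" where
  "linear_space_sorter S T \<longleftrightarrow>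
     (\<exists>d. \<forall>xs. \<exists>t m s.
        exec ((length xs + 2) ^ d) S (sort_input xs) t m s \<and>
        rarr s 0 = sort xs \<and>
        length (iarr s 0) = length xs \<and> set (iarr s 0) = {..<length xs} \<and>
        rarr s 0 = map (\<lambda>i. xs ! i) (iarr s 0) \<and>
        t \<le> T (length xs) \<and> m \<le> d * (length xs + 1))"


section \<open>Input and output of a matrix product algorithm\<close>

definition matrix_input :: "nat \<Rightarrow> nat \<Rightarrow> real \<Rightarrow> real mat \<Rightarrow> real mat \<Rightarrow> state" where
  "matrix_input n k \<epsilon> A B = blank_state\<lparr>
     ivar := (\<lambda>_. 0)(0 := n, 1 := k),
     rvar := (\<lambda>_. 0)(0 := \<epsilon>),
     tapeA := concat (map list_of_vec (cols A)),
     tapeB := concat (map list_of_vec (rows B))\<rparr>"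

text \<open>The returned matrix is kept in memory in sparse form, as row indices, column indices and
  values; entries not listed are zero.\<close>

definition returns_matrix :: "nat \<Rightarrow> state \<Rightarrow> real mat \<Rightarrow> bool" where
  "returns_matrix n s M \<longleftrightarrow>
     (let ps = zip (iarr s 0) (iarr s 1) in
        length (iarr s 1) = length (iarr s 0) \<and> length (rarr s 0) = length (iarr s 0) \<and>
        distinct ps \<and> set ps \<subseteq> {..<n} \<times> {..<n} \<and>
        M = mat n n (\<lambda>x. case map_of (zip ps (rarr s 0)) x of None \<Rightarrow> 0 | Some v \<Rightarrow> v))"

end

theory Submission
  imports Defs
begin

text \<open>
  The algorithm maintains a summary of \<open>C\<close> in the style of Misra and Gries.  Subtracting a threshold
  \<open>\<delta>\<close> from all entries, and dropping those that become nonpositive, costs at most \<open>\<delta>\<close> per entry, and if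
  at least \<open>b\<close> entries are at least \<open>\<delta>\<close>, then the total mass drops by at least \<open>b * \<delta>\<close>.  So if \<open>D\<close> is the
  sum of all thresholds, every entry has error at most \<open>D\<close> and the total error is at least \<open>b * D\<close>.
  The total error is also at most \<open>k * D + R\<close>, where \<open>R\<close> is the residual norm.
  With \<open>b \<ge> k + k / \<epsilon>\<close> this gives \<open>D \<le> \<epsilon> / k * R\<close> and total error at most \<open>(1 + \<epsilon>) * R\<close>, and
  the bounds for all \<open>p\<close> follow by interpolation.

  There are two reductions per outer product of a column \<open>x\<close> of \<open>A\<close> and a row \<open>y\<close> of \<open>B\<close>, and it is
  enough that their thresholds have the right rank up to a constant factor.
  For the outer product itself, sort \<open>x\<close> and \<open>y\<close>: the products of elements whose ranks are powers of two,
  weighted by the product of these ranks, determine all ranks up to a factor 4, and there are only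
  \<open>O(log\<^sup>2 n)\<close> of them.  The entries above the threshold are then enumerated row by row and merged
  into the summary, which is kept in row order.
  The threshold for the merged summary is found in linear time by merge sort in which every second
  element is discarded after every other level: the lengths of the levels and the rank errors are both
  geometric series.

  Sorting \<open>n\<close> numbers takes time at least \<open>n\<close>, since the sorter has to allocate its output.
\<close>

section \<open>Approximate order statistics by merging and thinning\<close>

text \<open>With capacity \<open>N\<close> the budget factor is \<open>b = N / 16\<close>, and both
  factors of 4 have a reason. The threshold of an outer product is the least candidate of weight at
  most \<open>N div 4\<close>. At most that many entries exceed it, but weights are ranks only up to
  a factor 4, so merely more than \<open>N / 16\<close> entries are known to reach it. The old
  summary holds at most \<open>3 * N / 4\<close> entries, so the merged one fits into
  \<open>N\<close> cells; the second reduction brings it back to \<open>3 * N / 4\<close> while at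
  least \<open>N / 4\<close> entries pay. These quarters are exactly the guarantee of the
  approximate selection.

  Sorting the summary would cost a factor \<open>log N\<close>, hence the linear-time selection. The
  threshold search can afford to be exhaustive: each of the \<open>O(log^2 n)\<close> corners is
  weighed against all others in \<open>O(log^4 n)\<close> time altogether, which is
  \<open>O(n)\<close> and thus covered by \<open>Sort n\<close>.

  The machine cannot round reals to naturals, so the capacity is found by repeated quadrupling; a
  power of 4 is also what the selection rounds need.\<close>

fun merge2 :: "'a::linorder list \<Rightarrow> 'a list \<Rightarrow> 'a list" where
  "merge2 [] ys = ys"
| "merge2 xs [] = xs"
| "merge2 (x # xs) (y # ys) = (if y < x then y # merge2 (x # xs) ys else x # merge2 xs (y # ys))"

lemma merge2_Nil2 [simp]: "merge2 xs [] = xs"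
  by (cases xs) auto

lemma mset_merge2: "mset (merge2 xs ys) = mset xs + mset ys"
  by (induction xs ys rule: merge2.induct) auto

lemma set_merge2: "set (merge2 xs ys) = set xs \<union> set ys"
  by (metis mset_merge2 set_mset_mset set_mset_union)

lemma length_merge2 [simp]: "length (merge2 xs ys) = length xs + length ys"
  by (metis mset_merge2 size_mset size_union)

lemma sorted_merge2: "sorted xs \<Longrightarrow> sorted ys \<Longrightarrow> sorted (merge2 xs ys)"
  by (induction xs ys rule: merge2.induct) (auto simp: set_merge2 intro: order.strict_implies_order order_trans)

function merge_runs :: "nat \<Rightarrow> 'a::linorder list \<Rightarrow> 'a list" where
  "merge_runs r xs = (if r = 0 \<or> xs = [] then xs
     else merge2 (take r xs) (take r (drop r xs)) @ merge_runs r (drop (2 * r) xs))"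
  by auto
termination by (relation "measure (length \<circ> snd)") auto

declare merge_runs.simps [simp del]

lemma mset_merge_runs: "mset (merge_runs r xs) = mset xs"
proof (induction r xs rule: merge_runs.induct)
  case (1 r xs)
  have split: "xs = take r xs @ take r (drop r xs) @ drop (2 * r) xs"
    by (metis append_take_drop_id drop_drop mult_2)
  show ?case
  proof (cases "r = 0 \<or> xs = []")
    case False
    then have "mset (merge_runs r xs) = mset (take r xs) + mset (take r (drop r xs)) + mset (drop (2 * r) xs)"
      using 1 by (simp add: merge_runs.simps[of r xs] mset_merge2)
    also have "\<dots> = mset xs" by (subst (4) split) (simp add: add.assoc)
    finally show ?thesis .
  qed (auto simp: merge_runs.simps)
qed

lemma length_merge_runs [simp]: "length (merge_runs r xs) = length xs"
  by (metis mset_merge_runs size_mset)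

text \<open>Keeping the second element of each pair makes the rounding go down: of a prefix of
  \<open>c\<close> elements exactly \<open>c div 2\<close> survive.\<close>

fun odds :: "'a list \<Rightarrow> 'a list" where
  "odds (x # y # zs) = y # odds zs"
| "odds _ = []"

lemma length_odds [simp]: "length (odds xs) = length xs div 2"
  by (induction xs rule: odds.induct) auto

lemma nth_odds: "i < length xs div 2 \<Longrightarrow> odds xs ! i = xs ! (2 * i + 1)"
proof (induction xs arbitrary: i rule: odds.induct)
  case (1 x y zs)
  then show ?case by (cases i) auto
qed auto

lemma set_odds: "set (odds xs) \<subseteq> set xs"
  by (induction xs rule: odds.induct) auto

lemma odds_append: "even (length xs) \<Longrightarrow> odds (xs @ ys) = odds xs @ odds ys"
  by (induction xs rule: odds.induct) auto

lemma sorted_odds: "sorted xs \<Longrightarrow> sorted (odds xs)"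
  by (induction xs rule: odds.induct) (use set_odds in fastforce)+

text \<open>All runs have exactly \<open>r\<close> elements, so the length of \<open>xs\<close> is
  fixed to \<open>r * m\<close>.\<close>

fun runs :: "nat \<Rightarrow> nat \<Rightarrow> 'a::linorder list \<Rightarrow> bool" where
  "runs r 0 xs \<longleftrightarrow> xs = []"
| "runs r (Suc m) xs \<longleftrightarrow> r \<le> length xs \<and> sorted (take r xs) \<and> runs r m (drop r xs)"

lemma runs_1: "runs r 1 xs \<longleftrightarrow> length xs = r \<and> sorted xs"
  by auto

lemma runs_singletons: "runs 1 (length xs) xs"
  by (induction xs) (auto simp: take_Suc)

lemma runs_merge_runs:
  assumes "runs r (2 * m) xs" "0 < r"
  shows "runs (2 * r) m (merge_runs r xs)"
  using assms(1)
proof (induction m arbitrary: xs)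
  case 0
  then show ?case by (simp add: merge_runs.simps)
next
  case (Suc m)
  then have s: "sorted (take r xs)" "sorted (take r (drop r xs))"
    and l: "r \<le> length xs" "r \<le> length xs - r" and rest: "runs r (2 * m) (drop (2 * r) xs)"
    by (simp_all add: mult_2)
  have eq: "merge_runs r xs = merge2 (take r xs) (take r (drop r xs)) @ merge_runs r (drop (2 * r) xs)"
    using l assms(2) by (subst merge_runs.simps) auto
  have len: "length (merge2 (take r xs) (take r (drop r xs))) = 2 * r" using l by simp
  show ?case
    using Suc.IH[OF rest] sorted_merge2[OF s] l by (simp add: eq len)
qed

text \<open>Ranks are expressed as counts of down-closed predicates. This treats
  \<open>x < v\<close> and \<open>x \<le> v\<close> for all \<open>v\<close> at once, and ties need
  no care.\<close>

definition down :: "('a::linorder \<Rightarrow> bool) \<Rightarrow> bool" where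
  "down P \<longleftrightarrow> (\<forall>x y. x \<le> y \<longrightarrow> P y \<longrightarrow> P x)"

abbreviation count_list_if :: "('a \<Rightarrow> bool) \<Rightarrow> 'a list \<Rightarrow> nat" where
  "count_list_if P xs \<equiv> length (filter P xs)"

lemma count_odds:
  assumes "down P" "sorted xs"
  shows "count_list_if P (odds xs) = count_list_if P xs div 2 \<or> odd (length xs)"
  using assms(2)
proof (induction xs rule: odds.induct)
  case (1 x y zs)
  show ?case
  proof (cases "P y")
    case True
    then have "P x" using 1(2) assms(1) by (auto simp: down_def)
    then show ?thesis using True 1 by auto
  next
    case False
    then have "\<forall>z\<in>set zs. \<not> P z" using 1(2) assms(1) by (auto simp: down_def)
    then have "filter P zs = []" "filter P (odds zs) = []"
      using set_odds[of zs] by (auto simp: filter_empty_conv)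
    then show ?thesis using False by auto
  qed
qed auto

lemma runs_odds:
  assumes "runs (2 * r) m xs"
  shows "runs r m (odds xs)"
  using assms
proof (induction m arbitrary: xs)
  case (Suc m)
  define ys zs where "ys = take (2 * r) xs" and "zs = drop (2 * r) xs"
  have h: "length ys = 2 * r" "sorted ys" "runs (2 * r) m zs" "xs = ys @ zs"
    using Suc.prems by (simp_all add: ys_def zs_def)
  then show ?case
    using Suc.IH[OF h(3)] sorted_odds[OF h(2)] by (simp add: odds_append)
qed auto

text \<open>Runs of even length are thinned independently, and each loses at most one by
  rounding.\<close>

lemma count_runs_odds:
  assumes "down P" "runs (2 * r) m xs"
  shows "2 * count_list_if P (odds xs) \<le> count_list_if P xs \<and>
    count_list_if P xs \<le> 2 * count_list_if P (odds xs) + m"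
  using assms(2)
proof (induction m arbitrary: xs)
  case (Suc m)
  define ys zs where "ys = take (2 * r) xs" and "zs = drop (2 * r) xs"
  have h: "length ys = 2 * r" "sorted ys" "runs (2 * r) m zs" "xs = ys @ zs"
    using Suc.prems by (simp_all add: ys_def zs_def)
  then show ?case
    using Suc.IH[OF h(3)] count_odds[OF assms(1) h(2)] by (simp add: odds_append) linarith
qed auto

text \<open>Halving after every merge level would lose the same weighted amount in each round, a
  logarithmic factor in total. With two levels per round the number of runs falls by 4 while the
  weight only doubles, so the loss halves from round to round.\<close>

definition thin :: "nat \<Rightarrow> 'a::linorder list \<Rightarrow> 'a list" where
  "thin r xs = odds (merge_runs (2 * r) (merge_runs r xs))"

lemma thin:
  assumes "runs r (4 * m) xs" "0 < r"
  shows "runs (2 * r) m (thin r xs)"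
    and "down P \<Longrightarrow> 2 * count_list_if P (thin r xs) \<le> count_list_if P xs"
    and "down P \<Longrightarrow> count_list_if P xs \<le> 2 * count_list_if P (thin r xs) + m"
proof -
  have "runs (2 * r) (2 * m) (merge_runs r xs)"
    using runs_merge_runs[of r "2 * m" xs] assms by simp
  then have r: "runs (2 * (2 * r)) m (merge_runs (2 * r) (merge_runs r xs))"
    using runs_merge_runs[of "2 * r" m] assms by simp
  have c: "count_list_if P (merge_runs (2 * r) (merge_runs r xs)) = count_list_if P xs"
    by (metis mset_filter mset_merge_runs size_mset)
  show "runs (2 * r) m (thin r xs)"
    unfolding thin_def by (rule runs_odds[OF r])
  assume "down P"
  from count_runs_odds[OF this r]
  show "2 * count_list_if P (thin r xs) \<le> count_list_if P xs"
    "count_list_if P xs \<le> 2 * count_list_if P (thin r xs) + m"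
    by (simp_all add: thin_def c)
qed

text \<open>State of the selection after \<open>l\<close> rounds.  A round with \<open>4 * m\<close> runs loses at most \<open>m\<close> in every
  count, and the losses, weighted by \<open>2 ^ l\<close>, form a geometric series.\<close>

definition sketch :: "nat \<Rightarrow> nat \<Rightarrow> 'a::linorder list \<Rightarrow> 'a list \<Rightarrow> bool" where
  "sketch a l xs ys \<longleftrightarrow> runs (2 ^ l) (4 ^ (a - l)) ys \<and>
     (\<forall>P. down P \<longrightarrow> 2 ^ l * count_list_if P ys \<le> count_list_if P xs \<and>
        2 * count_list_if P xs + 2 ^ (2 * a - l) \<le> 2 * 2 ^ l * count_list_if P ys + 4 ^ a)"

lemma sketch_0: "length xs = 4 ^ a \<Longrightarrow> sketch a 0 xs xs"
  using runs_singletons[of xs] by (simp add: sketch_def power_mult)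

text \<open>The term \<open>2 ^ (2 * a - l)\<close> is the part of the error budget
  \<open>4 ^ a\<close> still unspent. The round loses at most \<open>4 ^ (a - Suc l)\<close>, which
  after weighting by \<open>2 * 2 ^ l\<close> is exactly half of that remainder.\<close>

lemma sketch_Suc:
  assumes "sketch a l xs ys" "l < a"
  shows "sketch a (Suc l) xs (thin (2 ^ l) ys)"
proof -
  let ?m = "4 ^ (a - Suc l) :: nat"
  have "(4::nat) ^ (a - l) = 4 * ?m" using assms(2) by (metis Suc_diff_Suc power_Suc)
  then have r: "runs (2 ^ l) (4 * ?m) ys" using assms(1) by (simp add: sketch_def)
  have e: "2 * a - Suc l = l + 2 * (a - Suc l) + 1" "2 * a - l = Suc (2 * a - Suc l)"
    using assms(2) by simp_all
  have m: "(2::nat) ^ (2 * a - Suc l) = 2 * (2 ^ l * ?m)"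
    unfolding e(1) by (simp add: power_add power_mult)
  have "2 ^ Suc l * count_list_if P (thin (2 ^ l) ys) \<le> count_list_if P xs \<and>
      2 * count_list_if P xs + 2 ^ (2 * a - Suc l)
        \<le> 2 * 2 ^ Suc l * count_list_if P (thin (2 ^ l) ys) + 4 ^ a" if P: "down P" for P
  proof -
    let ?c = "count_list_if P ys" and ?t = "count_list_if P (thin (2 ^ l) ys)"
    have 1: "2 ^ l * ?c \<le> count_list_if P xs"
      "2 * count_list_if P xs + 2 * 2 ^ (2 * a - Suc l) \<le> 2 * 2 ^ l * ?c + 4 ^ a"
      using assms(1) P by (auto simp: sketch_def e(2))
    have 2: "2 * (2 ^ l * ?t) \<le> 2 ^ l * ?c" "2 ^ l * ?c \<le> 2 * (2 ^ l * ?t) + 2 ^ l * ?m"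
      using mult_le_mono2[OF thin(2)[OF r _ P], of "2 ^ l"] mult_le_mono2[OF thin(3)[OF r _ P], of "2 ^ l"]
      by (simp_all add: algebra_simps)
    have 3: "2 ^ Suc l * ?t = 2 * (2 ^ l * ?t)" "2 * 2 ^ l * ?c = 2 * (2 ^ l * ?c)"
      "2 * 2 ^ Suc l * ?t = 4 * (2 ^ l * ?t)" by simp_all
    show ?thesis using 1 2 m unfolding 3 by linarith
  qed
  then show ?thesis
    using thin(1)[OF r] by (simp add: sketch_def)
qed

lemma sorted_count_less: "sorted xs \<Longrightarrow> i < length xs \<Longrightarrow> count_list_if (\<lambda>x. x < xs ! i) xs \<le> i"
proof -
  assume s: "sorted xs" and i: "i < length xs"
  have "j < i" if "j < length xs" "xs ! j < xs ! i" for j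
    using s i that sorted_nth_mono[OF s, of i j] by (meson leD not_le)
  then have "{j. j < length xs \<and> xs ! j < xs ! i} \<subseteq> {..<i}" by auto
  from card_mono[OF _ this] show ?thesis
    unfolding length_filter_conv_card by simp
qed

lemma sorted_count_le: "sorted xs \<Longrightarrow> i < length xs \<Longrightarrow> Suc i \<le> count_list_if (\<lambda>x. x \<le> xs ! i) xs"
proof -
  assume s: "sorted xs" and i: "i < length xs"
  have "{..i} \<subseteq> {j. j < length xs \<and> xs ! j \<le> xs ! i}"
    using i sorted_nth_mono[OF s] by auto
  from card_mono[OF _ this] show ?thesis
    unfolding length_filter_conv_card by simp
qed

text \<open>After \<open>a\<close> rounds one sorted run of \<open>2 ^ a\<close> elements is left,
  each standing for \<open>2 ^ a\<close> originals, and counts are underestimated by at most half of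
  \<open>4 ^ a\<close>. So the element at the first quarter has its true rank between one and three
  quarters. With \<open>2 \<le> a\<close> the quarter is exact.\<close>

lemma sketch_quantile:
  assumes "sketch a a xs ys" "2 \<le> a" "length xs = 4 ^ a"
  defines "\<delta> \<equiv> ys ! (2 ^ a div 4)"
  shows "4 * count_list_if (\<lambda>x. \<delta> < x) xs \<le> 3 * 4 ^ a" "4 ^ a \<le> 4 * count_list_if (\<lambda>x. \<delta> \<le> x) xs"
proof -
  let ?q = "2 ^ a div 4 :: nat"
  obtain b where b: "a = 2 + b" using assms(2) le_Suc_ex by blast
  have q: "4 * ?q = 2 ^ a" unfolding b power_add by simp
  have "runs (2 ^ a) 1 ys"
    using assms(1) unfolding sketch_def diff_self_eq_0 power_0 by (rule conjunct1)
  then have ys: "sorted ys" "length ys = 2 ^ a" unfolding runs_1 by simp_all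
  have cnt: "2 ^ a * count_list_if P ys \<le> count_list_if P xs"
    "2 * count_list_if P xs \<le> 2 * 2 ^ a * count_list_if P ys + 4 ^ a" if "down P" for P
    using assms(1) that add_leD1 unfolding sketch_def by fast+
  have lt: "?q < length ys" using ys(2) by simp
  have "down (\<lambda>x. x \<le> \<delta>)" "down (\<lambda>x. x < \<delta>)"
    unfolding down_def by auto
  then have "2 ^ a * count_list_if (\<lambda>x. x \<le> \<delta>) ys \<le> count_list_if (\<lambda>x. x \<le> \<delta>) xs"
    "2 * count_list_if (\<lambda>x. x < \<delta>) xs \<le> 2 * 2 ^ a * count_list_if (\<lambda>x. x < \<delta>) ys + 4 ^ a"
    using cnt by blast+
  moreover have "2 ^ a * ?q \<le> 2 ^ a * count_list_if (\<lambda>x. x \<le> \<delta>) ys"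
    "2 * 2 ^ a * count_list_if (\<lambda>x. x < \<delta>) ys \<le> 2 * 2 ^ a * ?q"
    using sorted_count_less[OF ys(1) lt] sorted_count_le[OF ys(1) lt] by (simp_all add: \<delta>_def)
  moreover have "4 * (2 ^ a * ?q) = 4 ^ a"
    unfolding mult.left_commute[of 4] q by (simp add: power_mult_distrib[symmetric])
  moreover have "count_list_if (\<lambda>x. x \<le> \<delta>) xs + count_list_if (\<lambda>x. \<delta> < x) xs = 4 ^ a"
    "count_list_if (\<lambda>x. x < \<delta>) xs + count_list_if (\<lambda>x. \<delta> \<le> x) xs = 4 ^ a"
    using sum_length_filter_compl[of "\<lambda>x. x \<le> \<delta>" xs] sum_length_filter_compl[of "\<lambda>x. x < \<delta>" xs]
      assms(3) by (simp_all add: not_le not_less)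
  ultimately show "4 * count_list_if (\<lambda>x. \<delta> < x) xs \<le> 3 * 4 ^ a" "4 ^ a \<le> 4 * count_list_if (\<lambda>x. \<delta> \<le> x) xs"
    by linarith+
qed

section \<open>A threshold for an outer product\<close>

lemma sum_if_pairs:
  "(\<Sum>p\<le>l. \<Sum>q\<le>l. if P p q then f p q else (0::nat)) = sum (\<lambda>(p, q). f p q) {(p, q). p \<le> l \<and> q \<le> (l::nat) \<and> P p q}"
proof -
  have eq: "{(p, q). p \<le> l \<and> q \<le> l \<and> P p q} = {z \<in> {..l} \<times> {..l}. P (fst z) (snd z)}" by auto
  show ?thesis
    unfolding eq sum.cartesian_product
    by (subst sum.inter_filter) (auto intro!: sum.cong split: prod.splits)
qed

text \<open>\<open>x i\<close> and \<open>y j\<close> are the \<open>i\<close>-th and \<open>j\<close>-th largest elements of two lists.  The dyadic cell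
  with corner \<open>(2 ^ p, 2 ^ q)\<close> has weight \<open>2 ^ p * 2 ^ q\<close>, its size up to a factor 4
  both below and above the corner.\<close>

locale sorted_product =
  fixes x y :: "nat \<Rightarrow> real" and n l :: nat
  assumes x_anti: "\<And>i j. 1 \<le> i \<Longrightarrow> i \<le> j \<Longrightarrow> j \<le> n \<Longrightarrow> x j \<le> x i"
    and y_anti: "\<And>i j. 1 \<le> i \<Longrightarrow> i \<le> j \<Longrightarrow> j \<le> n \<Longrightarrow> y j \<le> y i"
    and x_nonneg: "\<And>i. 1 \<le> i \<Longrightarrow> i \<le> n \<Longrightarrow> 0 \<le> x i"
    and y_nonneg: "\<And>i. 1 \<le> i \<Longrightarrow> i \<le> n \<Longrightarrow> 0 \<le> y i"
    and l: "2 ^ l \<le> n" "n < 2 ^ Suc l"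
begin

definition corner :: "nat \<Rightarrow> nat \<Rightarrow> real" where
  "corner p q = x (2 ^ p) * y (2 ^ q)"

definition weight :: "real \<Rightarrow> nat" where
  "weight \<delta> = (\<Sum>p\<le>l. \<Sum>q\<le>l. if \<delta> < corner p q then 2 ^ p * 2 ^ q else 0)"

definition weight_ge :: "real \<Rightarrow> nat" where
  "weight_ge \<delta> = (\<Sum>p\<le>l. \<Sum>q\<le>l. if \<delta> \<le> corner p q then 2 ^ p * 2 ^ q else 0)"

lemma pow_le_n: "p \<le> l \<Longrightarrow> 2 ^ p \<le> n"
  using l(1) by (meson le_trans one_le_numeral power_increasing)

lemma product_mono:
  assumes "1 \<le> i" "i \<le> i'" "i' \<le> n" "1 \<le> j" "j \<le> j'" "j' \<le> n"
  shows "x i' * y j' \<le> x i * y j"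
  using assms x_anti[of i i'] y_anti[of j j'] x_nonneg[of i] y_nonneg[of j'] by (intro mult_mono) auto

lemma corner_nonneg: "p \<le> l \<Longrightarrow> q \<le> l \<Longrightarrow> 0 \<le> corner p q"
  unfolding corner_def using x_nonneg y_nonneg pow_le_n by simp

lemma dyadic: "1 \<le> i \<Longrightarrow> i \<le> n \<Longrightarrow> \<exists>p\<le>l. 2 ^ p \<le> i \<and> i < 2 ^ Suc p"
proof -
  assume i: "1 \<le> i" "i \<le> n"
  obtain p where p: "2 ^ p \<le> i" "i < 2 ^ (p + 1)" using ex_power_ivl1[of 2 i] i by auto
  then have "(2::nat) ^ p < 2 ^ Suc l" using i l by linarith
  then have "p < Suc l" by (rule power_less_imp_less_exp[rotated]) simp
  then have "p \<le> l" by simp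
  then show ?thesis using p by auto
qed

text \<open>The cells here extend upward from their corner, so the corner carries the largest
  product of its cell, and a cell has exactly \<open>2 ^ p * 2 ^ q\<close> pairs.\<close>

lemma card_gt_le_weight:
  "card {(i, j). i \<in> {1..n} \<and> j \<in> {1..n} \<and> \<delta> < x i * y j} \<le> weight \<delta>"
proof -
  let ?I = "{(p, q). p \<le> l \<and> q \<le> l \<and> \<delta> < corner p q}"
  let ?C = "\<lambda>(p, q). {2 ^ p..<2 ^ Suc p} \<times> {2 ^ q..<2 ^ Suc q} :: (nat \<times> nat) set"
  have fin: "finite ?I" by (rule finite_subset[of _ "{..l} \<times> {..l}"]) auto
  have "{(i, j). i \<in> {1..n} \<and> j \<in> {1..n} \<and> \<delta> < x i * y j} \<subseteq> (\<Union>z\<in>?I. ?C z)"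
  proof clarify
    fix i j assume ij: "i \<in> {1..n}" "j \<in> {1..n}" "\<delta> < x i * y j"
    obtain p where p: "p \<le> l" "2 ^ p \<le> i" "i < 2 ^ Suc p" using dyadic[of i] ij by auto
    obtain q where q: "q \<le> l" "2 ^ q \<le> j" "j < 2 ^ Suc q" using dyadic[of j] ij by auto
    have "x i * y j \<le> corner p q"
      unfolding corner_def using p q ij by (intro product_mono) auto
    then have "(p, q) \<in> ?I" using ij p q by auto
    moreover have "(i, j) \<in> ?C (p, q)" using p q by auto
    ultimately show "(i, j) \<in> (\<Union>z\<in>?I. ?C z)" by blast
  qed
  moreover have "finite (\<Union>z\<in>?I. ?C z)" using fin by (intro finite_UN_I) auto
  ultimately have "card {(i, j). i \<in> {1..n} \<and> j \<in> {1..n} \<and> \<delta> < x i * y j} \<le> card (\<Union>z\<in>?I. ?C z)"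
    by (intro card_mono)
  also have "\<dots> \<le> (\<Sum>z\<in>?I. card (?C z))" by (rule card_UN_le[OF fin])
  also have "\<dots> = (\<Sum>(p, q)\<in>?I. 2 ^ p * 2 ^ q)"
    by (intro sum.cong) auto
  also have "\<dots> = weight \<delta>" unfolding weight_def sum_if_pairs ..
  finally show ?thesis .
qed

text \<open>For \<open>p = 0\<close> the interval is \<open>{1}\<close>, because
  \<open>1 div 2\<close> rounds down to 0; every other one starts where its predecessor
  ends.\<close>

lemma disjoint_lower_cells:
  fixes i p q :: nat
  assumes "2 ^ p div 2 < i" "i \<le> 2 ^ p" "2 ^ q div 2 < i" "i \<le> 2 ^ q"
  shows "p = q"
proof -
  have "\<not> p < q" if "2 ^ q div 2 < i" "i \<le> 2 ^ p" for p q :: nat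
  proof
    assume "p < q"
    then obtain r where r: "q = Suc r" "p \<le> r" by (metis less_Suc_eq_le Suc_le_D Suc_le_eq)
    have "(2::nat) ^ p \<le> 2 ^ r" using r(2) by (rule power_increasing) simp
    moreover have "2 ^ r < i" using that(1) by (simp add: r(1))
    ultimately show False using that(2) by linarith
  qed
  then show ?thesis using assms by (meson linorder_neqE_nat)
qed

text \<open>The cells now extend downward from their corner, so the corner carries the smallest
  product. They are disjoint and stay within \<open>{1..n}\<close>; each side has at least half of
  its power of two, whence the factor 4.\<close>

lemma weight_ge_le_card:
  "weight_ge \<delta> \<le> 4 * card {(i, j). i \<in> {1..n} \<and> j \<in> {1..n} \<and> \<delta> \<le> x i * y j}"
proof -
  let ?I = "{(p, q). p \<le> l \<and> q \<le> l \<and> \<delta> \<le> corner p q}"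
  let ?C = "\<lambda>(p, q). {2 ^ p div 2<..2 ^ p} \<times> {2 ^ q div 2<..2 ^ q} :: (nat \<times> nat) set"
  have fin: "finite ?I" by (rule finite_subset[of _ "{..l} \<times> {..l}"]) auto
  have half: "(2::nat) ^ p \<le> 2 * (2 ^ p - 2 ^ p div 2)" for p by simp
  have "weight_ge \<delta> = (\<Sum>(p, q)\<in>?I. 2 ^ p * 2 ^ q)" unfolding weight_ge_def sum_if_pairs ..
  also have "\<dots> \<le> (\<Sum>z\<in>?I. 4 * card (?C z))"
  proof (rule sum_mono, clarify)
    fix p q
    have "2 ^ p * 2 ^ q \<le> (2 * (2 ^ p - 2 ^ p div 2)) * (2 * (2 ^ q - 2 ^ q div 2) :: nat)"
      using half by (intro mult_le_mono)
    then show "2 ^ p * 2 ^ q \<le> 4 * card ({2 ^ p div 2<..2 ^ p} \<times> {2 ^ q div 2<..2 ^ q} :: (nat \<times> nat) set)"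
      by (simp add: card_cartesian_product mult.assoc mult.left_commute)
  qed
  also have "\<dots> = 4 * card (\<Union>z\<in>?I. ?C z)"
  proof -
    have "?C z \<inter> ?C z' = {}" if "z \<noteq> z'" for z z'
      using that by (auto dest: disjoint_lower_cells)
    then have "(\<Sum>z\<in>?I. card (?C z)) = card (\<Union>z\<in>?I. ?C z)"
      by (intro card_UN_disjoint[symmetric] fin) auto
    then show ?thesis by (simp only: sum_distrib_left[symmetric])
  qed
  also have "card (\<Union>z\<in>?I. ?C z) \<le> card {(i, j). i \<in> {1..n} \<and> j \<in> {1..n} \<and> \<delta> \<le> x i * y j}"
  proof (rule card_mono)
    show "finite {(i, j). i \<in> {1..n} \<and> j \<in> {1..n} \<and> \<delta> \<le> x i * y j}"
      by (rule finite_subset[of _ "{1..n} \<times> {1..n}"]) auto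
    show "(\<Union>z\<in>?I. ?C z) \<subseteq> {(i, j). i \<in> {1..n} \<and> j \<in> {1..n} \<and> \<delta> \<le> x i * y j}"
    proof clarify
      fix p q i j :: nat
      assume h: "p \<le> l" "q \<le> l" "\<delta> \<le> corner p q" "i \<in> {2 ^ p div 2<..2 ^ p}" "j \<in> {2 ^ q div 2<..2 ^ q}"
      then have b: "1 \<le> i" "i \<le> 2 ^ p" "1 \<le> j" "j \<le> 2 ^ q" by auto
      have "corner p q \<le> x i * y j"
        unfolding corner_def using b h(1,2) pow_le_n by (intro product_mono) auto
      then show "i \<in> {1..n} \<and> j \<in> {1..n} \<and> \<delta> \<le> x i * y j"
        using b h pow_le_n[of p] pow_le_n[of q] by auto
    qed
  qed
  finally show ?thesis by simp
qed

text \<open>The least feasible candidate is nearly tight, since the next smaller candidate is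
  infeasible and weights change only at corners.\<close>

lemma threshold:
  assumes "weight \<delta> \<le> M" "\<delta> = 0 \<or> (\<exists>p\<le>l. \<exists>q\<le>l. \<delta> = corner p q)"
    and least: "weight 0 \<le> M \<Longrightarrow> \<delta> \<le> 0" "\<And>p q. p \<le> l \<Longrightarrow> q \<le> l \<Longrightarrow> weight (corner p q) \<le> M \<Longrightarrow> \<delta> \<le> corner p q"
  shows "0 \<le> \<delta>" "card {(i, j). i \<in> {1..n} \<and> j \<in> {1..n} \<and> \<delta> < x i * y j} \<le> M"
    "\<delta> = 0 \<or> M < 4 * card {(i, j). i \<in> {1..n} \<and> j \<in> {1..n} \<and> \<delta> \<le> x i * y j}"
proof -
  show nonneg: "0 \<le> \<delta>" using assms(2) corner_nonneg by auto
  show "card {(i, j). i \<in> {1..n} \<and> j \<in> {1..n} \<and> \<delta> < x i * y j} \<le> M"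
    using card_gt_le_weight[of \<delta>] assms(1) by linarith
  show "\<delta> = 0 \<or> M < 4 * card {(i, j). i \<in> {1..n} \<and> j \<in> {1..n} \<and> \<delta> \<le> x i * y j}"
  proof (cases "\<delta> = 0")
    case False
    \<comment> \<open>\<open>K\<close> contains the candidates below \<open>\<delta>\<close>, among
      them 0. No candidate lies strictly between its maximum \<open>c\<close> and
      \<open>\<delta>\<close>, so every corner above \<open>c\<close> reaches
      \<open>\<delta>\<close>.\<close>
    define K where "K = {c \<in> insert 0 ((\<lambda>(p, q). corner p q) ` ({..l} \<times> {..l})). c < \<delta>}"
    have K: "finite K" "0 \<in> K" using nonneg False by (auto simp: K_def)
    define c where "c = Max K"
    have "c \<in> K" unfolding c_def using K by (intro Max_in) auto
    then have "M < weight c"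
      using least by (fastforce simp: K_def)
    also have "weight c \<le> weight_ge \<delta>"
      unfolding weight_def weight_ge_def
    proof (intro sum_mono)
      fix p q assume pq: "p \<in> {..l}" "q \<in> {..l}"
      have "\<delta> \<le> corner p q" if "c < corner p q"
      proof (rule ccontr)
        assume "\<not> \<delta> \<le> corner p q"
        then have "corner p q \<in> K" using pq by (auto simp: K_def)
        then have "corner p q \<le> c" unfolding c_def using K(1) by (intro Max_ge)
        then show False using that by simp
      qed
      then show "(if c < corner p q then 2 ^ p * 2 ^ q else 0) \<le> (if \<delta> \<le> corner p q then 2 ^ p * 2 ^ q else (0::nat))"
        by auto
    qed
    also have "\<dots> \<le> 4 * card {(i, j). i \<in> {1..n} \<and> j \<in> {1..n} \<and> \<delta> \<le> x i * y j}"
      by (rule weight_ge_le_card)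
    finally show ?thesis ..
  qed simp
qed

text \<open>Keeps the accumulator of the weighing program within the word bound.\<close>

lemma weight_le: "weight \<delta> \<le> 4 * n * n"
proof -
  have "weight \<delta> \<le> (\<Sum>p\<le>l. \<Sum>q\<le>l. 2 ^ p * 2 ^ q)"
    unfolding weight_def by (intro sum_mono) auto
  also have "\<dots> = (\<Sum>p\<le>l. 2 ^ p) * (\<Sum>q\<le>l. 2 ^ q)" by (simp add: sum_product)
  also have "\<dots> \<le> (2 * n) * (2 * n)"
  proof -
    have "(\<Sum>p\<le>l. 2 ^ p) = (2::nat) ^ Suc l - 1"
      using sum_power2[of "Suc l"] by (simp add: lessThan_Suc_atMost atLeast0LessThan)
    then have "(\<Sum>p\<le>l. 2 ^ p) \<le> 2 * n" using l by simp
    then show ?thesis by (rule mult_le_mono)  fact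
  qed
  finally show ?thesis by simp
qed

end

section \<open>From the error budget to the residual norm\<close>

lemma entrywise_norm_eq_positions:
  "entrywise_norm p M = (\<Sum>x\<in>positions M. \<bar>M $$ x\<bar> ^ p) powr (1 / real p)"
  unfolding entrywise_norm_def positions_def by (simp add: sum.cartesian_product)

text \<open>Interpolation between the maximum norm and the 1-norm: all but one of the
  \<open>p\<close> factors of each term are bounded by \<open>r * R\<close>.\<close>

lemma entrywise_norm_bound:
  assumes p: "1 \<le> p" and E: "\<And>x. x \<in> positions E \<Longrightarrow> \<bar>E $$ x\<bar> \<le> r * R"
    and sum: "(\<Sum>x\<in>positions E. \<bar>E $$ x\<bar>) \<le> c * R" and nonneg: "0 < r" "0 \<le> c" "0 \<le> R"
  shows "entrywise_norm p E \<le> c powr (1 / real p) * r powr (1 - 1 / real p) * R"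
proof -
  obtain q where q: "p = Suc q" using p by (cases p) auto
  have "(\<Sum>x\<in>positions E. \<bar>E $$ x\<bar> ^ p) \<le> (\<Sum>x\<in>positions E. (r * R) ^ q * \<bar>E $$ x\<bar>)"
    unfolding q power_Suc2 using E by (intro sum_mono mult_right_mono power_mono) auto
  also have "\<dots> \<le> (r * R) ^ q * (c * R)"
    unfolding sum_distrib_left[symmetric] using sum nonneg by (intro mult_left_mono) auto
  finally have le: "(\<Sum>x\<in>positions E. \<bar>E $$ x\<bar> ^ p) \<le> r ^ q * c * R ^ p"
    by (simp add: q power_mult_distrib mult_ac)
  have "entrywise_norm p E \<le> (r ^ q * c * R ^ p) powr (1 / real p)"
    unfolding entrywise_norm_eq_positions by (intro powr_mono2 le sum_nonneg) auto
  also have "\<dots> = (r ^ q) powr (1 / real p) * c powr (1 / real p) * (R ^ p) powr (1 / real p)"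
    using nonneg by (simp add: powr_mult)
  also have "(R ^ p) powr (1 / real p) = R"
    using nonneg p by (cases "R = 0") (simp_all add: powr_realpow[symmetric] powr_powr)
  also have "(r ^ q) powr (1 / real p) \<le> r powr (1 - 1 / real p)"
  proof -
    have "real q * (1 / real p) = 1 - 1 / real p" by (simp add: q field_simps)
    then show ?thesis
      using nonneg by (simp add: powr_realpow[symmetric] powr_powr)
  qed
  finally show ?thesis using nonneg by (simp add: mult_ac mult_left_mono mult_right_mono)
qed

text \<open>The error is split along a set of \<open>k\<close> largest entries: there each error is
  at most \<open>D\<close>, elsewhere it is at most the entry, and these entries sum to the residual
  norm.\<close>

lemma residual_error:
  assumes C: "\<And>x. x \<in> positions C \<Longrightarrow> 0 \<le> C $$ x"
    and e: "\<And>x. x \<in> positions C \<Longrightarrow> 0 \<le> e x \<and> e x \<le> C $$ x \<and> e x \<le> D"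
    and budget: "b * D \<le> (\<Sum>x\<in>positions C. e x)"
    and b: "real k + real k / \<epsilon> \<le> b" and k: "1 \<le> k" and eps: "0 < \<epsilon>" and D: "0 \<le> D"
  shows "D \<le> \<epsilon> / real k * residual_norm k C"
    "(\<Sum>x\<in>positions C. e x) \<le> (1 + \<epsilon>) * residual_norm k C"
proof -
  obtain S where S: "largest_entries k C S" using largest_entries_exists by blast
  let ?R = "residual_norm k C"
  have R: "?R = (\<Sum>x\<in>positions C - S. C $$ x)"
    unfolding residual_norm_eq[OF S] entrywise_norm_zero_out using C by (intro sum.cong) auto
  have sub: "S \<subseteq> positions C" "card S \<le> k" using S by (auto simp: largest_entries_def)
  have "(\<Sum>x\<in>positions C. e x) = (\<Sum>x\<in>S. e x) + (\<Sum>x\<in>positions C - S. e x)"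
    using sum.subset_diff[OF sub(1), of e] by simp
  also have "(\<Sum>x\<in>S. e x) \<le> (\<Sum>x\<in>S. D)" using e sub by (intro sum_mono) auto
  also have "(\<Sum>x\<in>S. D) \<le> real k * D" using sub(2) D by (simp add: mult_right_mono)
  also have "(\<Sum>x\<in>positions C - S. e x) \<le> ?R" unfolding R using e by (intro sum_mono) auto
  finally have le: "(\<Sum>x\<in>positions C. e x) \<le> real k * D + ?R" by simp
  have "(real k + real k / \<epsilon>) * D \<le> b * D" using b D by (rule mult_right_mono)
  then have "real k / \<epsilon> * D \<le> ?R" using le budget by (simp add: algebra_simps)
  then have kD: "real k * D \<le> \<epsilon> * ?R" using eps by (simp add: field_simps)
  then show "D \<le> \<epsilon> / real k * ?R" using k by (simp add: field_simps)
  show "(\<Sum>x\<in>positions C. e x) \<le> (1 + \<epsilon>) * ?R" using le kD by (simp add: algebra_simps)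
qed

text \<open>Makes the threshold search linear in \<open>n\<close>, as \<open>2 ^ l \<le> n\<close>.
  The quotient of the two powers peaks at \<open>l = 5\<close> with the value 40.5.\<close>

lemma log_power_le: "(Suc l) ^ 4 \<le> 48 * 2 ^ l"
proof (cases "l < 6")
  case True
  then have "l = 0 \<or> l = 1 \<or> l = 2 \<or> l = 3 \<or> l = 4 \<or> l = 5" by auto
  then show ?thesis by (elim disjE) (simp_all add: power_numeral_reduce)
next
  case False
  then have "6 \<le> l" by simp
  then show ?thesis
  proof (induction l rule: dec_induct)
    case base
    show ?case by (simp add: power_numeral_reduce)
  next
    case (step l)
    \<comment> \<open>From \<open>l = 6\<close> on the fourth power grows by at most
      \<open>(8 / 7) ^ 4 < 2\<close> per step.\<close>
    have "7 * Suc (Suc l) \<le> 8 * Suc l" using step(1) by simp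
    then have "(7 * Suc (Suc l)) ^ 4 \<le> (8 * Suc l) ^ 4" by (rule power_mono) simp
    then have "2401 * Suc (Suc l) ^ 4 \<le> 4096 * Suc l ^ 4"
      unfolding power_mult_distrib by simp
    then show ?case using step.IH unfolding power_Suc[of 2 l] by linarith
  qed
qed

section \<open>A calculus for the while language\<close>

text \<open>Contents and lengths are separate targets because writing a cell keeps the length. So
  array lengths survive every loop without allocations as frame facts.\<close>

datatype target =
    IScalar nat
  | RScalar nat
  | IArray nat
  | RArray nat
  | ILength nat
  | RLength nat
  | TapeA
  | TapeB

primrec targets :: "com \<Rightarrow> target set" where
  "targets Skip = {}"
| "targets (ISetVar x e) = {IScalar x}"
| "targets (RSetVar x e) = {RScalar x}"
| "targets (ISet a i e) = {IArray a}"
| "targets (RSet a i e) = {RArray a}"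
| "targets (INew a e) = {IArray a, ILength a}"
| "targets (RNew a e) = {RArray a, RLength a}"
| "targets (ReadA x) = {RScalar x, TapeA}"
| "targets (ReadB x) = {RScalar x, TapeB}"
| "targets (Seq c d) = targets c \<union> targets d"
| "targets (Cond b c d) = targets c \<union> targets d"
| "targets (While b c) = targets c"

lemma finite_targets: "finite (targets c)"
  by (induction c) auto

definition unchanged :: "com \<Rightarrow> state \<Rightarrow> state \<Rightarrow> bool" where
  "unchanged c s s' \<longleftrightarrow>
     (\<forall>x. IScalar x \<notin> targets c \<longrightarrow> ivar s' x = ivar s x) \<and>
     (\<forall>x. RScalar x \<notin> targets c \<longrightarrow> rvar s' x = rvar s x) \<and>
     (\<forall>x. IArray x \<notin> targets c \<longrightarrow> iarr s' x = iarr s x) \<and>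
     (\<forall>x. RArray x \<notin> targets c \<longrightarrow> rarr s' x = rarr s x) \<and>
     (\<forall>x. ILength x \<notin> targets c \<longrightarrow> length (iarr s' x) = length (iarr s x)) \<and>
     (\<forall>x. RLength x \<notin> targets c \<longrightarrow> length (rarr s' x) = length (rarr s x)) \<and>
     (TapeA \<notin> targets c \<longrightarrow> tapeA s' = tapeA s) \<and>
     (TapeB \<notin> targets c \<longrightarrow> tapeB s' = tapeB s)"

lemma unchanged_refl: "unchanged c s s"
  by (simp add: unchanged_def)

lemma unchanged_mono: "unchanged c s s' \<Longrightarrow> targets c \<subseteq> targets d \<Longrightarrow> unchanged d s s'"
  unfolding unchanged_def by blast

lemma unchanged_trans: "unchanged c s s' \<Longrightarrow> unchanged c s' s'' \<Longrightarrow> unchanged c s s''"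
  unfolding unchanged_def by simp

lemma exec_unchanged: "exec W c s t m s' \<Longrightarrow> unchanged c s s'"
proof (induction rule: exec.induct)
  case (Seq c\<^sub>1 s t\<^sub>1 m\<^sub>1 s\<^sub>1 c\<^sub>2 t\<^sub>2 m\<^sub>2 s\<^sub>2)
  show ?case
    by (rule unchanged_trans[of _ _ s\<^sub>1]; rule unchanged_mono[OF Seq.IH(1)]
        unchanged_mono[OF Seq.IH(2)]; simp)
next
  case (CondTrue b s c\<^sub>1 t m s' c\<^sub>2)
  show ?case by (rule unchanged_mono[OF CondTrue.IH]) simp
next
  case (CondFalse b s c\<^sub>2 t m s' c\<^sub>1)
  show ?case by (rule unchanged_mono[OF CondFalse.IH]) simp
next
  case (WhileTrue b s c t\<^sub>1 m\<^sub>1 s\<^sub>1 t\<^sub>2 m\<^sub>2 s\<^sub>2)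
  show ?case
    by (rule unchanged_trans[OF unchanged_mono[OF WhileTrue.IH(1)] WhileTrue.IH(2)]) simp
qed (auto simp: unchanged_def)

text \<open>Blankness from \<open>K\<close> on serves twice: it makes the sums in
  \<open>cells\<close> finite, and it covers the names beyond those that are erased before the
  sorter is called.\<close>

definition wf_state :: "nat \<Rightarrow> nat \<Rightarrow> state \<Rightarrow> bool" where
  "wf_state K L s \<longleftrightarrow>
     (\<forall>a. length (iarr s a) \<le> L \<and> length (rarr s a) \<le> L) \<and>
     (\<forall>x\<ge>K. ivar s x = 0 \<and> rvar s x = 0 \<and> iarr s x = [] \<and> rarr s x = [])"

lemma wf_state_names:
  assumes "wf_state K L s"
  shows "{a. iarr s a \<noteq> []} \<subseteq> {..<K}" "{a. rarr s a \<noteq> []} \<subseteq> {..<K}"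
  using assms by (auto simp: wf_state_def not_less[symmetric])

lemma cells_le:
  assumes "wf_state K L s"
  shows "cells s \<le> 2 * K * L"
proof -
  have "(\<Sum>a | iarr s a \<noteq> []. length (iarr s a)) \<le> (\<Sum>a | iarr s a \<noteq> []. L)"
    "(\<Sum>a | rarr s a \<noteq> []. length (rarr s a)) \<le> (\<Sum>a | rarr s a \<noteq> []. L)"
    using assms by (auto simp: wf_state_def simp del: sum_constant intro!: sum_mono)
  moreover have "(\<Sum>a | iarr s a \<noteq> []. L) \<le> K * L" "(\<Sum>a | rarr s a \<noteq> []. L) \<le> K * L"
    using wf_state_names[OF assms] card_mono[of "{..<K}"] by (auto intro: mult_le_mono1)
  ultimately show ?thesis unfolding cells_def by linarith
qed

text \<open>Recovers array lengths from the peak space of a run, which is all that is known about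
  allocations inside the sorter. Finiteness matters, since a sum over an infinite set would be
  0.\<close>

lemma le_cells:
  assumes "wf_state K L s"
  shows "length (iarr s a) \<le> cells s" "length (rarr s a) \<le> cells s"
proof -
  have fin: "finite {a. iarr s a \<noteq> []}" "finite {a. rarr s a \<noteq> []}"
    using wf_state_names[OF assms] finite_subset by blast+
  have "length (iarr s a) \<le> (\<Sum>a | iarr s a \<noteq> []. length (iarr s a))"
    using fin member_le_sum[of a "{a. iarr s a \<noteq> []}" "\<lambda>a. length (iarr s a)"]
    by (cases "iarr s a = []") auto
  then show "length (iarr s a) \<le> cells s" by (simp add: cells_def)
  have "length (rarr s a) \<le> (\<Sum>a | rarr s a \<noteq> []. length (rarr s a))"
    using fin member_le_sum[of a "{a. rarr s a \<noteq> []}" "\<lambda>a. length (rarr s a)"]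
    by (cases "rarr s a = []") auto
  then show "length (rarr s a) \<le> cells s" by (simp add: cells_def)
qed

text \<open>Since every allocated array has length at most \<open>L\<close> and a name below \<open>K\<close>, the space bound
  holds by construction, and only the time has to be tracked in postconditions.\<close>

locale machine =
  fixes W K L :: nat
begin

definition wp :: "com \<Rightarrow> (nat \<Rightarrow> state \<Rightarrow> bool) \<Rightarrow> state \<Rightarrow> bool" where
  "wp c Q s \<longleftrightarrow> (wf_state K L s \<longrightarrow>
     (\<exists>t m s'. exec W c s t m s' \<and> m \<le> 2 * K * L \<and> wf_state K L s' \<and> Q t s'))"

text \<open>The rule of consequence also supplies the frame, so postconditions only have to mention
  what a command changes.\<close>

lemma wp_cut:
  assumes "wp c R s" "\<And>t s'. unchanged c s s' \<Longrightarrow> R t s' \<Longrightarrow> Q t s'"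
  shows "wp c Q s"
  using assms exec_unchanged unfolding wp_def by meson

lemma wp_Skip: "Q 1 s \<Longrightarrow> wp Skip Q s"
  unfolding wp_def using exec.Skip cells_le by blast

lemma wp_ISetVar:
  "x < K \<Longrightarrow> isafe W e s \<Longrightarrow> Q 1 (s\<lparr>ivar := (ivar s)(x := ival e s)\<rparr>) \<Longrightarrow> wp (ISetVar x e) Q s"
  unfolding wp_def
  by (intro impI exI conjI, rule exec.ISetVar) (auto simp: cells_le wf_state_def)

lemma wp_RSetVar:
  "x < K \<Longrightarrow> rsafe W e s \<Longrightarrow> Q 1 (s\<lparr>rvar := (rvar s)(x := rval e s)\<rparr>) \<Longrightarrow> wp (RSetVar x e) Q s"
  unfolding wp_def
  by (intro impI exI conjI, rule exec.RSetVar) (auto simp: cells_le wf_state_def)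

lemma wp_ISet:
  "isafe W i s \<Longrightarrow> isafe W e s \<Longrightarrow> ival i s < length (iarr s a) \<Longrightarrow>
   Q 1 (s\<lparr>iarr := (iarr s)(a := (iarr s a)[ival i s := ival e s])\<rparr>) \<Longrightarrow> wp (ISet a i e) Q s"
  unfolding wp_def
  by (intro impI exI conjI, rule exec.ISet) (auto simp: cells_le wf_state_def)

lemma wp_RSet:
  "isafe W i s \<Longrightarrow> rsafe W e s \<Longrightarrow> ival i s < length (rarr s a) \<Longrightarrow>
   Q 1 (s\<lparr>rarr := (rarr s)(a := (rarr s a)[ival i s := rval e s])\<rparr>) \<Longrightarrow> wp (RSet a i e) Q s"
  unfolding wp_def
  by (intro impI exI conjI, rule exec.RSet) (auto simp: cells_le wf_state_def)

lemma wp_INew: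
  assumes "a < K" "isafe W e s" "ival e s \<le> L"
    "Q (1 + ival e s) (s\<lparr>iarr := (iarr s)(a := replicate (ival e s) 0)\<rparr>)"
  shows "wp (INew a e) Q s"
  unfolding wp_def
proof
  let ?s = "s\<lparr>iarr := (iarr s)(a := replicate (ival e s) 0)\<rparr>"
  assume wf: "wf_state K L s"
  then have "wf_state K L ?s" using assms by (auto simp: wf_state_def)
  with wf show "\<exists>t m s'. exec W (INew a e) s t m s' \<and> m \<le> 2 * K * L \<and> wf_state K L s' \<and> Q t s'"
    using exec.INew[OF assms(2) refl, of a] assms(4) cells_le[OF wf] cells_le[of K L ?s]
    by (intro exI[of _ "1 + ival e s"] exI[of _ "max (cells s) (cells ?s)"] exI[of _ ?s]) simp
qed

lemma wp_RNew:
  assumes "a < K" "isafe W e s" "ival e s \<le> L"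
    "Q (1 + ival e s) (s\<lparr>rarr := (rarr s)(a := replicate (ival e s) 0)\<rparr>)"
  shows "wp (RNew a e) Q s"
  unfolding wp_def
proof
  let ?s = "s\<lparr>rarr := (rarr s)(a := replicate (ival e s) 0)\<rparr>"
  assume wf: "wf_state K L s"
  then have "wf_state K L ?s" using assms by (auto simp: wf_state_def)
  with wf show "\<exists>t m s'. exec W (RNew a e) s t m s' \<and> m \<le> 2 * K * L \<and> wf_state K L s' \<and> Q t s'"
    using exec.RNew[OF assms(2) refl, of a] assms(4) cells_le[OF wf] cells_le[of K L ?s]
    by (intro exI[of _ "1 + ival e s"] exI[of _ "max (cells s) (cells ?s)"] exI[of _ ?s]) simp
qed

lemma wp_ReadA:
  "x < K \<Longrightarrow> tapeA s = v # vs \<Longrightarrow> Q 1 (s\<lparr>rvar := (rvar s)(x := v), tapeA := vs\<rparr>) \<Longrightarrow>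
   wp (ReadA x) Q s"
  unfolding wp_def
  by (intro impI exI conjI, rule exec.ReadA) (auto simp: cells_le wf_state_def)

lemma wp_ReadB:
  "x < K \<Longrightarrow> tapeB s = v # vs \<Longrightarrow> Q 1 (s\<lparr>rvar := (rvar s)(x := v), tapeB := vs\<rparr>) \<Longrightarrow>
   wp (ReadB x) Q s"
  unfolding wp_def
  by (intro impI exI conjI, rule exec.ReadB) (auto simp: cells_le wf_state_def)

lemma wp_Seq:
  assumes "wp c (\<lambda>t s'. wp d (\<lambda>u. Q (t + u)) s') s"
  shows "wp (Seq c d) Q s"
  unfolding wp_def
proof
  assume "wf_state K L s"
  with assms obtain t m s1 u l s2 where
    "exec W c s t m s1" "m \<le> 2 * K * L" "exec W d s1 u l s2" "l \<le> 2 * K * L"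
    "wf_state K L s2" "Q (t + u) s2"
    unfolding wp_def by blast
  then show "\<exists>t m s'. exec W (Seq c d) s t m s' \<and> m \<le> 2 * K * L \<and> wf_state K L s' \<and> Q t s'"
    by (intro exI[of _ "t + u"] exI[of _ "max m l"] exI[of _ s2]) (auto intro: exec.Seq)
qed

lemma wp_Seq_cut:
  assumes "wp c R s" "\<And>t s'. unchanged c s s' \<Longrightarrow> R t s' \<Longrightarrow> wp d (\<lambda>u. Q (t + u)) s'"
  shows "wp (Seq c d) Q s"
  by (rule wp_Seq, rule wp_cut[OF assms(1)]) (rule assms(2))

lemma wp_Cond:
  assumes "bsafe W b s" "bval b s \<Longrightarrow> wp c (\<lambda>t. Q (Suc t)) s"
    "\<not> bval b s \<Longrightarrow> wp d (\<lambda>t. Q (Suc t)) s"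
  shows "wp (Cond b c d) Q s"
proof (cases "bval b s")
  case True
  then show ?thesis using assms(2) exec.CondTrue[OF assms(1) True] unfolding wp_def
    by (metis plus_1_eq_Suc)
next
  case False
  then show ?thesis using assms(3) exec.CondFalse[OF assms(1) False] unfolding wp_def
    by (metis plus_1_eq_Suc)
qed

lemma wp_While_step:
  assumes "bsafe W b s" "bval b s \<Longrightarrow> wp c (\<lambda>t s'. wp (While b c) (\<lambda>u. Q (1 + t + u)) s') s"
    "\<not> bval b s \<Longrightarrow> Q 1 s"
  shows "wp (While b c) Q s"
proof (cases "bval b s")
  case True
  show ?thesis unfolding wp_def
  proof
    assume "wf_state K L s"
    with assms(2)[OF True] obtain t m s1 u l s2 where
      "exec W c s t m s1" "m \<le> 2 * K * L" "exec W (While b c) s1 u l s2" "l \<le> 2 * K * L"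
      "wf_state K L s2" "Q (1 + t + u) s2"
      unfolding wp_def by blast
    then show "\<exists>t m s'. exec W (While b c) s t m s' \<and> m \<le> 2 * K * L \<and> wf_state K L s' \<and> Q t s'"
      using exec.WhileTrue[OF assms(1) True] by (metis max.boundedI)
  qed
next
  case False
  then show ?thesis
    using exec.WhileFalse[OF assms(1) False, of c] assms(3)[OF False] cells_le unfolding wp_def
    by (intro impI exI[of _ 1] exI[of _ "cells s"] exI[of _ s]) simp
qed

lemma wp_While_index_aux:
  assumes "\<And>i s. i \<le> M \<Longrightarrow> J i s \<Longrightarrow> unchanged c s0 s \<Longrightarrow> bsafe W b s \<and> (bval b s \<longleftrightarrow> i < M)"
    and "\<And>i s. i < M \<Longrightarrow> J i s \<Longrightarrow> unchanged c s0 s \<Longrightarrow> wp c (\<lambda>t s'. J (Suc i) s' \<and> t \<le> \<tau> i) s"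
  shows "i \<le> M \<Longrightarrow> J i s \<Longrightarrow> unchanged c s0 s \<Longrightarrow>
    wp (While b c) (\<lambda>t s'. J M s' \<and> t \<le> 1 + (\<Sum>j=i..<M. \<tau> j + 1)) s"
proof (induction "M - i" arbitrary: i s)
  case 0
  then have "i = M" by linarith
  then show ?case using assms(1)[OF 0(2,3,4)] 0(3) by (intro wp_While_step) simp_all
next
  case (Suc d)
  have lt: "i < M" and d: "d = M - Suc i" using Suc.hyps(2) by linarith+
  show ?case
  proof (rule wp_While_step)
    show "bsafe W b s" using assms(1) Suc.prems by blast
    show "wp c (\<lambda>t s'. wp (While b c)
       (\<lambda>u s'. J M s' \<and> 1 + t + u \<le> 1 + (\<Sum>j=i..<M. \<tau> j + 1)) s') s"
    proof (rule wp_cut[OF assms(2)[OF lt Suc.prems(2,3)]])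
      fix t s' assume u: "unchanged c s s'" and h: "J (Suc i) s' \<and> t \<le> \<tau> i"
      have "wp (While b c) (\<lambda>t s'. J M s' \<and> t \<le> 1 + (\<Sum>j=Suc i..<M. \<tau> j + 1)) s'"
        using Suc.hyps(1)[OF d] h lt unchanged_trans[OF Suc.prems(3) u] by simp
      then show "wp (While b c) (\<lambda>u s'. J M s' \<and> 1 + t + u \<le> 1 + (\<Sum>j=i..<M. \<tau> j + 1)) s'"
        by (rule wp_cut) (use h lt in \<open>auto simp: sum.atLeast_Suc_lessThan\<close>)
    qed
  qed (use lt assms(1) Suc.prems in blast)
qed

text \<open>The number \<open>M\<close> of iterations is fixed in advance and the test has to agree
  with \<open>i < M\<close>. This replaces a variant and yields the time as a sum over the
  iterations.\<close>

lemma wp_While_index: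
  assumes "J 0 s"
    and "\<And>i s'. i \<le> M \<Longrightarrow> J i s' \<Longrightarrow> unchanged c s s' \<Longrightarrow> bsafe W b s' \<and> (bval b s' \<longleftrightarrow> i < M)"
    and "\<And>i s'. i < M \<Longrightarrow> J i s' \<Longrightarrow> unchanged c s s' \<Longrightarrow>
      wp c (\<lambda>t s''. J (Suc i) s'' \<and> t \<le> \<tau> i) s'"
    and "\<And>t s'. J M s' \<Longrightarrow> unchanged c s s' \<Longrightarrow> t \<le> 1 + (\<Sum>j<M. \<tau> j + 1) \<Longrightarrow> Q t s'"
  shows "wp (While b c) Q s"
proof (rule wp_cut)
  show "wp (While b c) (\<lambda>t s'. J M s' \<and> t \<le> 1 + (\<Sum>j=0..<M. \<tau> j + 1)) s"
    by (rule wp_While_index_aux[where ?s0.0 = s]) (use assms(1-3) unchanged_refl in auto)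
next
  fix t s'
  assume "unchanged (While b c) s s'" "J M s' \<and> t \<le> 1 + (\<Sum>j=0..<M. \<tau> j + 1)"
  then show "Q t s'" using assms(4) unchanged_mono[of "While b c" s s' c]
    by (simp add: atLeast0LessThan)
qed

end

section \<open>Calling the sorting program\<close>

primrec shift_i :: "nat \<Rightarrow> iexp \<Rightarrow> iexp" where
  "shift_i h (INum c) = INum c"
| "shift_i h (IVar x) = IVar (x + h)"
| "shift_i h (IGet a e) = IGet (a + h) (shift_i h e)"
| "shift_i h (IAdd e f) = IAdd (shift_i h e) (shift_i h f)"
| "shift_i h (ISub e f) = ISub (shift_i h e) (shift_i h f)"
| "shift_i h (IMul e f) = IMul (shift_i h e) (shift_i h f)"
| "shift_i h (IDiv e f) = IDiv (shift_i h e) (shift_i h f)"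

primrec shift_r :: "nat \<Rightarrow> rexp \<Rightarrow> rexp" where
  "shift_r h (RNat e) = RNat (shift_i h e)"
| "shift_r h (RVar x) = RVar (x + h)"
| "shift_r h (RGet a e) = RGet (a + h) (shift_i h e)"
| "shift_r h (RAdd e f) = RAdd (shift_r h e) (shift_r h f)"
| "shift_r h (RSub e f) = RSub (shift_r h e) (shift_r h f)"
| "shift_r h (RMul e f) = RMul (shift_r h e) (shift_r h f)"
| "shift_r h (RDiv e f) = RDiv (shift_r h e) (shift_r h f)"

primrec shift_b :: "nat \<Rightarrow> bexp \<Rightarrow> bexp" where
  "shift_b h (BILess e f) = BILess (shift_i h e) (shift_i h f)"
| "shift_b h (BRLess e f) = BRLess (shift_r h e) (shift_r h f)"
| "shift_b h (BNot b) = BNot (shift_b h b)"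
| "shift_b h (BAnd b c) = BAnd (shift_b h b) (shift_b h c)"

text \<open>Moves the memory of the sorter to the names from \<open>h\<close> on, away from that of
  the caller.\<close>

primrec shift :: "nat \<Rightarrow> com \<Rightarrow> com" where
  "shift h Skip = Skip"
| "shift h (ISetVar x e) = ISetVar (x + h) (shift_i h e)"
| "shift h (RSetVar x e) = RSetVar (x + h) (shift_r h e)"
| "shift h (ISet a i e) = ISet (a + h) (shift_i h i) (shift_i h e)"
| "shift h (RSet a i e) = RSet (a + h) (shift_i h i) (shift_r h e)"
| "shift h (INew a e) = INew (a + h) (shift_i h e)"
| "shift h (RNew a e) = RNew (a + h) (shift_i h e)"
| "shift h (ReadA x) = ReadA (x + h)"
| "shift h (ReadB x) = ReadB (x + h)"
| "shift h (Seq c d) = Seq (shift h c) (shift h d)"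
| "shift h (Cond b c d) = Cond (shift_b h b) (shift h c) (shift h d)"
| "shift h (While b c) = While (shift_b h b) (shift h c)"

text \<open>The sorting program works on empty tapes, where reading has no transition.  So it never reads,
  and the tapes of the caller can be hidden from it.\<close>

definition view :: "nat \<Rightarrow> state \<Rightarrow> state" where
  "view h s = \<lparr>ivar = \<lambda>x. ivar s (x + h), rvar = \<lambda>x. rvar s (x + h),
     iarr = \<lambda>x. iarr s (x + h), rarr = \<lambda>x. rarr s (x + h), tapeA = [], tapeB = []\<rparr>"

lemma view_simps [simp]:
  "ivar (view h s) x = ivar s (x + h)" "rvar (view h s) x = rvar s (x + h)"
  "iarr (view h s) x = iarr s (x + h)" "rarr (view h s) x = rarr s (x + h)"
  "tapeA (view h s) = []" "tapeB (view h s) = []"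
  by (simp_all add: view_def)

lemma view_upd:
  "view h (s\<lparr>ivar := (ivar s)(x + h := v)\<rparr>) = (view h s)\<lparr>ivar := (ivar (view h s))(x := v)\<rparr>"
  "view h (s\<lparr>rvar := (rvar s)(x + h := r)\<rparr>) = (view h s)\<lparr>rvar := (rvar (view h s))(x := r)\<rparr>"
  "view h (s\<lparr>iarr := (iarr s)(x + h := vs)\<rparr>) = (view h s)\<lparr>iarr := (iarr (view h s))(x := vs)\<rparr>"
  "view h (s\<lparr>rarr := (rarr s)(x + h := rs)\<rparr>) = (view h s)\<lparr>rarr := (rarr (view h s))(x := rs)\<rparr>"
  by (auto simp: view_def fun_eq_iff)

lemma wf_state_view: "wf_state K L s \<Longrightarrow> wf_state K L (view h s)"
  by (simp add: wf_state_def)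

lemma ival_shift [simp]: "ival (shift_i h e) s = ival e (view h s)"
  by (induction e) auto

lemma rval_shift [simp]: "rval (shift_r h e) s = rval e (view h s)"
  by (induction e) auto

lemma bval_shift [simp]: "bval (shift_b h b) s = bval b (view h s)"
  by (induction b) auto

lemma isafe_shift: "isafe V e (view h s) \<Longrightarrow> V \<le> W \<Longrightarrow> isafe W (shift_i h e) s"
  by (induction e) auto

lemma rsafe_shift: "rsafe V e (view h s) \<Longrightarrow> V \<le> W \<Longrightarrow> rsafe W (shift_r h e) s"
  by (induction e) (auto simp: isafe_shift)

lemma bsafe_shift: "bsafe V b (view h s) \<Longrightarrow> V \<le> W \<Longrightarrow> bsafe W (shift_b h b) s"
  by (induction b) (auto simp: isafe_shift rsafe_shift)

lemma targets_shift:
  "targets (shift h c) \<subseteq> IScalar ` {h..} \<union> RScalar ` {h..} \<union> IArray ` {h..} \<union> RArray ` {h..}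
     \<union> ILength ` {h..} \<union> RLength ` {h..} \<union> {TapeA, TapeB}"
  by (induction c) auto

primrec target_names :: "target \<Rightarrow> nat" where
  "target_names (IScalar x) = x"
| "target_names (RScalar x) = x"
| "target_names (IArray x) = x"
| "target_names (RArray x) = x"
| "target_names (ILength x) = x"
| "target_names (RLength x) = x"
| "target_names TapeA = 0"
| "target_names TapeB = 0"

text \<open>The body of \<open>linear_space_sorter\<close> with its constant \<open>d\<close>
  exposed, as this constant enters the word bound and the space bound of the whole program.\<close>

definition sorts :: "com \<Rightarrow> (nat \<Rightarrow> nat) \<Rightarrow> nat \<Rightarrow> bool" where
  "sorts S Sort d \<longleftrightarrow> (\<forall>xs. \<exists>t m s.
     exec ((length xs + 2) ^ d) S (sort_input xs) t m s \<and>
     rarr s 0 = sort xs \<and>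
     length (iarr s 0) = length xs \<and> set (iarr s 0) = {..<length xs} \<and>
     rarr s 0 = map (\<lambda>i. xs ! i) (iarr s 0) \<and>
     t \<le> Sort (length xs) \<and> m \<le> d * (length xs + 1))"

lemma linear_space_sorter_sorts: "linear_space_sorter S Sort \<longleftrightarrow> (\<exists>d. sorts S Sort d)"
  by (simp only: linear_space_sorter_def sorts_def)

text \<open>Only allocation can lengthen an array, and it is charged the new length.\<close>

lemma exec_length_iarr:
  "exec W c s t m s' \<Longrightarrow> length (iarr s' a) \<le> length (iarr s a) + t"
  by (induction rule: exec.induct) auto

lemma sorter_time:
  assumes "sorts S Sort d"
  shows "n \<le> Sort n"
proof -
  from spec[OF assms[unfolded sorts_def], of "replicate n 0"] obtain t m s where
    ex: "exec ((n + 2) ^ d) S (sort_input (replicate n 0)) t m s"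
    and len: "length (iarr s 0) = n" and t: "t \<le> Sort n"
    unfolding length_replicate by (elim exE conjE)
  from exec_length_iarr[OF ex, of 0] len t show ?thesis
    by (simp add: sort_input_def blank_state_def)
qed

context machine
begin

text \<open>A simulation: safety is monotone in the word bound, and the known peak
  \<open>m \<le> L\<close> of the original run limits every allocation of the renamed one.\<close>

lemma exec_shift:
  assumes "exec V c s0 t m s1" "V \<le> W" "m \<le> L" "\<forall>x\<in>targets c. target_names x + h < K"
    "s0 = view h s" "wf_state K L s"
  shows "\<exists>l s'. exec W (shift h c) s t l s' \<and> l \<le> 2 * K * L \<and> wf_state K L s' \<and> s1 = view h s' \<and>
    tapeA s' = tapeA s \<and> tapeB s' = tapeB s"
  using assms
proof (induction arbitrary: s rule: exec.induct)
  case (Skip s0)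
  then show ?case using exec.Skip cells_le by fastforce
next
  case (ISetVar e s0 x)
  let ?s = "s\<lparr>ivar := (ivar s)(x + h := ival e (view h s))\<rparr>"
  have "exec W (shift h (ISetVar x e)) s 1 (cells s) ?s"
    using exec.ISetVar[OF isafe_shift[of V e h s W], of "x + h"] ISetVar by simp
  moreover have "wf_state K L ?s" using ISetVar by (auto simp: wf_state_def)
  ultimately show ?case using ISetVar by (intro exI[of _ "cells s"] exI[of _ ?s]) (simp add: cells_le view_upd)
next
  case (RSetVar e s0 x)
  let ?s = "s\<lparr>rvar := (rvar s)(x + h := rval e (view h s))\<rparr>"
  have "exec W (shift h (RSetVar x e)) s 1 (cells s) ?s"
    using exec.RSetVar[OF rsafe_shift[of V e h s W], of "x + h"] RSetVar by simp
  moreover have "wf_state K L ?s" using RSetVar by (auto simp: wf_state_def)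
  ultimately show ?case using RSetVar by (intro exI[of _ "cells s"] exI[of _ ?s]) (simp add: cells_le view_upd)
next
  case (ISet i s0 e a)
  let ?s = "s\<lparr>iarr := (iarr s)(a + h := (iarr s (a + h))[ival i (view h s) := ival e (view h s)])\<rparr>"
  have "exec W (shift h (ISet a i e)) s 1 (cells s) ?s"
    using exec.ISet[OF isafe_shift[of V i h s W] isafe_shift[of V e h s W], of "a + h"] ISet
    by simp
  moreover have "wf_state K L ?s" using ISet by (auto simp: wf_state_def)
  ultimately show ?case using ISet by (intro exI[of _ "cells s"] exI[of _ ?s]) (simp add: cells_le view_upd)
next
  case (RSet i s0 e a)
  let ?s = "s\<lparr>rarr := (rarr s)(a + h := (rarr s (a + h))[ival i (view h s) := rval e (view h s)])\<rparr>"
  have "exec W (shift h (RSet a i e)) s 1 (cells s) ?s"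
    using exec.RSet[OF isafe_shift[of V i h s W] rsafe_shift[of V e h s W], of "a + h"] RSet
    by simp
  moreover have "wf_state K L ?s" using RSet by (auto simp: wf_state_def)
  ultimately show ?case using RSet by (intro exI[of _ "cells s"] exI[of _ ?s]) (simp add: cells_le view_upd)
next
  case (INew e s0 s1 a)
  let ?s = "s\<lparr>iarr := (iarr s)(a + h := replicate (ival e (view h s)) 0)\<rparr>"
  have ex: "exec W (shift h (INew a e)) s (1 + ival e s0) (max (cells s) (cells ?s)) ?s"
    using exec.INew[OF isafe_shift[of V e h s W] refl, of "a + h"] INew by simp
  have s1: "s1 = view h ?s" using INew view_upd(3) by simp
  \<comment> \<open>That the new array has length at most \<open>L\<close> is yet to be shown.
    Inflated bounds make \<open>le_cells\<close> applicable, and the peak space then gives the true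
    one.\<close>
  have "wf_state (K + a + h + 1) (L + ival e s0) ?s"
    using INew.prems by (auto simp: wf_state_def intro: trans_le_add1)
  then have "wf_state (K + a + h + 1) (L + ival e s0) (view h ?s)"
    by (rule wf_state_view)
  from le_cells(1)[OF this, of a] have "ival e s0 \<le> cells s1"
    using INew.prems by (simp add: s1)
  then have "ival e s0 \<le> L" using INew.prems by simp
  then have wf: "wf_state K L ?s" using INew by (auto simp: wf_state_def)
  show ?case
    using ex wf s1 cells_le[OF wf] cells_le[OF INew.prems(5)]
    by (intro exI[of _ "max (cells s) (cells ?s)"] exI[of _ ?s]) simp
next
  case (RNew e s0 s1 a)
  let ?s = "s\<lparr>rarr := (rarr s)(a + h := replicate (ival e (view h s)) 0)\<rparr>"
  have ex: "exec W (shift h (RNew a e)) s (1 + ival e s0) (max (cells s) (cells ?s)) ?s"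
    using exec.RNew[OF isafe_shift[of V e h s W] refl, of "a + h"] RNew by simp
  have s1: "s1 = view h ?s" using RNew view_upd(4) by simp
  have "wf_state (K + a + h + 1) (L + ival e s0) ?s"
    using RNew.prems by (auto simp: wf_state_def intro: trans_le_add1)
  then have "wf_state (K + a + h + 1) (L + ival e s0) (view h ?s)"
    by (rule wf_state_view)
  from le_cells(2)[OF this, of a] have "ival e s0 \<le> cells s1"
    using RNew.prems by (simp add: s1)
  then have "ival e s0 \<le> L" using RNew.prems by simp
  then have wf: "wf_state K L ?s" using RNew by (auto simp: wf_state_def)
  show ?case
    using ex wf s1 cells_le[OF wf] cells_le[OF RNew.prems(5)]
    by (intro exI[of _ "max (cells s) (cells ?s)"] exI[of _ ?s]) simp
next
  case (ReadA s0 v vs x)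
  then show ?case by simp
next
  case (ReadB s0 v vs x)
  then show ?case by simp
next
  case (Seq c\<^sub>1 s0 t\<^sub>1 m\<^sub>1 s\<^sub>1 c\<^sub>2 t\<^sub>2 m\<^sub>2 s\<^sub>2)
  from Seq.IH(1)[of s] Seq.prems obtain l s' where 1: "exec W (shift h c\<^sub>1) s t\<^sub>1 l s'"
    "l \<le> 2 * K * L" "wf_state K L s'" "s\<^sub>1 = view h s'"
    "tapeA s' = tapeA s" "tapeB s' = tapeB s" by auto
  from Seq.IH(2)[of s'] Seq.prems 1 obtain l' s'' where 2: "exec W (shift h c\<^sub>2) s' t\<^sub>2 l' s''"
    "l' \<le> 2 * K * L" "wf_state K L s''" "s\<^sub>2 = view h s''"
    "tapeA s'' = tapeA s" "tapeB s'' = tapeB s" by auto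
  show ?case using exec.Seq[OF 1(1) 2(1)] 1 2
    by (intro exI[of _ "max l l'"] exI[of _ s'']) simp
next
  case (CondTrue b s0 c\<^sub>1 t m s1 c\<^sub>2)
  from CondTrue.IH[of s] CondTrue.prems obtain l s' where 1: "exec W (shift h c\<^sub>1) s t l s'"
    "l \<le> 2 * K * L" "wf_state K L s'" "s1 = view h s'"
    "tapeA s' = tapeA s" "tapeB s' = tapeB s" by auto
  have "exec W (shift h (Cond b c\<^sub>1 c\<^sub>2)) s (1 + t) l s'"
    using exec.CondTrue[OF bsafe_shift[of V b h s W] _ 1(1)] CondTrue by simp
  then show ?case using 1 by blast
next
  case (CondFalse b s0 c\<^sub>2 t m s1 c\<^sub>1)
  from CondFalse.IH[of s] CondFalse.prems obtain l s' where 1: "exec W (shift h c\<^sub>2) s t l s'"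
    "l \<le> 2 * K * L" "wf_state K L s'" "s1 = view h s'"
    "tapeA s' = tapeA s" "tapeB s' = tapeB s" by auto
  have "exec W (shift h (Cond b c\<^sub>1 c\<^sub>2)) s (1 + t) l s'"
    using exec.CondFalse[OF bsafe_shift[of V b h s W] _ 1(1)] CondFalse by simp
  then show ?case using 1 by blast
next
  case (WhileFalse b s0 c)
  have "exec W (shift h (While b c)) s 1 (cells s) s"
    using exec.WhileFalse[OF bsafe_shift[of V b h s W]] WhileFalse by simp
  then show ?case using WhileFalse.prems cells_le by blast
next
  case (WhileTrue b s0 c t\<^sub>1 m\<^sub>1 s\<^sub>1 t\<^sub>2 m\<^sub>2 s\<^sub>2)
  from WhileTrue.IH(1)[of s] WhileTrue.prems obtain l s' where 1: "exec W (shift h c) s t\<^sub>1 l s'"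
    "l \<le> 2 * K * L" "wf_state K L s'" "s\<^sub>1 = view h s'"
    "tapeA s' = tapeA s" "tapeB s' = tapeB s" by auto
  from WhileTrue.IH(2)[of s'] WhileTrue.prems 1 obtain l' s'' where
    2: "exec W (shift h (While b c)) s' t\<^sub>2 l' s''"
    "l' \<le> 2 * K * L" "wf_state K L s''" "s\<^sub>2 = view h s''"
    "tapeA s'' = tapeA s" "tapeB s'' = tapeB s" by auto
  have "exec W (shift h (While b c)) s (1 + t\<^sub>1 + t\<^sub>2) (max l l') s''"
    using exec.WhileTrue[OF bsafe_shift[of V b h s W] _ 1(1)] 2(1) WhileTrue by simp
  then show ?case using 1 2 by (intro exI[of _ "max l l'"] exI[of _ s'']) simp
qed

end

text \<open>The sorting program starts from a blank state, so its part of the state is erased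
  before every call.\<close>

primrec erase :: "nat \<Rightarrow> nat \<Rightarrow> com" where
  "erase h 0 = Skip"
| "erase h (Suc x) = Seq (erase h x) (Seq (ISetVar (x + h) (INum 0)) (Seq (RSetVar (x + h) (RNat (INum 0)))
     (Seq (INew (x + h) (INum 0)) (RNew (x + h) (INum 0)))))"

lemma targets_erase:
  "targets (erase h x) \<subseteq> IScalar ` {h..} \<union> RScalar ` {h..} \<union> IArray ` {h..} \<union> RArray ` {h..}
     \<union> ILength ` {h..} \<union> RLength ` {h..}"
  by (induction x) auto

lemma unchanged_erase:
  assumes "unchanged (erase h K) s s'" "x < h"
  shows "ivar s' x = ivar s x" "rvar s' x = rvar s x" "iarr s' x = iarr s x" "rarr s' x = rarr s x"
    "tapeA s' = tapeA s" "tapeB s' = tapeB s"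
proof -
  have "IScalar x \<notin> targets (erase h K)" "RScalar x \<notin> targets (erase h K)"
    "IArray x \<notin> targets (erase h K)" "RArray x \<notin> targets (erase h K)"
    "TapeA \<notin> targets (erase h K)" "TapeB \<notin> targets (erase h K)"
    using targets_erase[of h K] \<open>x < h\<close> by auto
  then show "ivar s' x = ivar s x" "rvar s' x = rvar s x" "iarr s' x = iarr s x" "rarr s' x = rarr s x"
    "tapeA s' = tapeA s" "tapeB s' = tapeB s"
    using assms(1) unfolding unchanged_def by blast+
qed

lemma unchanged_shift:
  assumes "unchanged (shift h c) s s'" "x < h"
  shows "ivar s' x = ivar s x" "rvar s' x = rvar s x" "iarr s' x = iarr s x" "rarr s' x = rarr s x"
proof -
  have "IScalar x \<notin> targets (shift h c)" "RScalar x \<notin> targets (shift h c)"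
    "IArray x \<notin> targets (shift h c)" "RArray x \<notin> targets (shift h c)"
    using targets_shift[of h c] \<open>x < h\<close> by auto
  then show "ivar s' x = ivar s x" "rvar s' x = rvar s x" "iarr s' x = iarr s x" "rarr s' x = rarr s x"
    using assms(1) unfolding unchanged_def by blast+
qed

context machine
begin

lemma wp_erase:
  assumes "x + h \<le> K"
  shows "wp (erase h x) (\<lambda>t s'. t = 1 + 4 * x \<and>
    (\<forall>y\<ge>h. y < x + h \<longrightarrow> ivar s' y = 0 \<and> rvar s' y = 0 \<and> iarr s' y = [] \<and> rarr s' y = [])) s"
  using assms
proof (induction x)
  case 0
  then show ?case by (auto intro: wp_Skip)
next
  case (Suc x)
  then have "wp (erase h x) (\<lambda>t s'. t = 1 + 4 * x \<and>
    (\<forall>y\<ge>h. y < x + h \<longrightarrow> ivar s' y = 0 \<and> rvar s' y = 0 \<and> iarr s' y = [] \<and> rarr s' y = [])) s"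
    by simp
  then show ?case unfolding erase.simps
  proof (rule wp_Seq_cut)
    fix t and s' :: state
    assume h: "t = 1 + 4 * x \<and>
      (\<forall>y\<ge>h. y < x + h \<longrightarrow> ivar s' y = 0 \<and> rvar s' y = 0 \<and> iarr s' y = [] \<and> rarr s' y = [])"
    have less: "y < Suc x + h \<longleftrightarrow> y = x + h \<or> y < x + h" for y by auto
    show "wp (Seq (ISetVar (x + h) (INum 0)) (Seq (RSetVar (x + h) (RNat (INum 0)))
       (Seq (INew (x + h) (INum 0)) (RNew (x + h) (INum 0)))))
       (\<lambda>u s'. t + u = 1 + 4 * Suc x \<and> (\<forall>y\<ge>h. y < Suc x + h \<longrightarrow>
          ivar s' y = 0 \<and> rvar s' y = 0 \<and> iarr s' y = [] \<and> rarr s' y = [])) s'"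
      unfolding less
      by (intro wp_Seq wp_ISetVar wp_RSetVar wp_INew wp_RNew) (use Suc.prems h in simp_all)
  qed
qed

end

section \<open>Counting loops\<close>

abbreviation seq :: "com \<Rightarrow> com \<Rightarrow> com" (infixr ";;" 60) where
  "c ;; d \<equiv> Seq c d"

definition for_upto :: "nat \<Rightarrow> iexp \<Rightarrow> com \<Rightarrow> com" where
  "for_upto x e c = ISetVar x (INum 0) ;;
     While (BILess (IVar x) e) (c ;; ISetVar x (IAdd (IVar x) (INum 1)))"

lemma targets_for_upto [simp]: "targets (for_upto x e c) = insert (IScalar x) (targets c)"
  by (auto simp: for_upto_def)

context machine
begin

text \<open>The invariant is demanded after the counter has been advanced. Test and increment
  account for the additional 2 time units per iteration.\<close>

lemma wp_for_upto:
  assumes x: "x < K" and M: "M < W"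
    and init: "\<And>s'. s' = s\<lparr>ivar := (ivar s)(x := 0)\<rparr> \<Longrightarrow> J 0 s'"
    and bound: "\<And>i s'. i \<le> M \<Longrightarrow> J i s' \<Longrightarrow> unchanged (for_upto x e c) s s' \<Longrightarrow> ivar s' x = i \<Longrightarrow>
      isafe W e s' \<and> ival e s' = M"
    and step: "\<And>i s'. i < M \<Longrightarrow> J i s' \<Longrightarrow> unchanged (for_upto x e c) s s' \<Longrightarrow> ivar s' x = i \<Longrightarrow>
      wp c (\<lambda>t s''. ivar s'' x = i \<and> J (Suc i) (s''\<lparr>ivar := (ivar s'')(x := Suc i)\<rparr>) \<and> t \<le> \<tau> i) s'"
    and post: "\<And>t s'. J M s' \<Longrightarrow> unchanged (for_upto x e c) s s' \<Longrightarrow> ivar s' x = M \<Longrightarrow>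
      t \<le> 2 + (\<Sum>i<M. \<tau> i + 2) \<Longrightarrow> Q t s'"
  shows "wp (for_upto x e c) Q s"
proof -
  let ?s = "s\<lparr>ivar := (ivar s)(x := 0)\<rparr>" and ?c = "c ;; ISetVar x (IAdd (IVar x) (INum 1))"
  have unch: "unchanged (for_upto x e c) s s'" if "unchanged ?c ?s s'" for s'
    using that by (auto simp: unchanged_def)
  show ?thesis unfolding for_upto_def
  proof (rule wp_Seq, rule wp_ISetVar)
    show "wp (While (BILess (IVar x) e) ?c) (\<lambda>u. Q (1 + u)) (s\<lparr>ivar := (ivar s)(x := ival (INum 0) s)\<rparr>)"
      unfolding ival.simps
    proof (rule wp_While_index[where J = "\<lambda>i s. J i s \<and> ivar s x = i" and M = M and \<tau> = "\<lambda>i. \<tau> i + 1"])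
      show "J 0 ?s \<and> ivar ?s x = 0" using init by simp
    next
      fix i s' assume "i \<le> M" "J i s' \<and> ivar s' x = i" "unchanged ?c ?s s'"
      then show "bsafe W (BILess (IVar x) e) s' \<and> bval (BILess (IVar x) e) s' = (i < M)"
        using bound unch M by auto
    next
      fix i s' assume i: "i < M" and J: "J i s' \<and> ivar s' x = i" and u: "unchanged ?c ?s s'"
      show "wp ?c (\<lambda>t s''. (J (Suc i) s'' \<and> ivar s'' x = Suc i) \<and> t \<le> \<tau> i + 1) s'"
      proof (rule wp_Seq, rule wp_cut[OF step])
        show "i < M" "J i s'" "ivar s' x = i" "unchanged (for_upto x e c) s s'"
          using i J unch[OF u] by auto
      next
        fix t s''
        assume "ivar s'' x = i \<and> J (Suc i) (s''\<lparr>ivar := (ivar s'')(x := Suc i)\<rparr>) \<and> t \<le> \<tau> i"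
        then show "wp (ISetVar x (IAdd (IVar x) (INum 1)))
           (\<lambda>u s''. (J (Suc i) s'' \<and> ivar s'' x = Suc i) \<and> t + u \<le> \<tau> i + 1) s''"
          using x i M by (intro wp_ISetVar) auto
      qed
    next
      fix t s' assume "J M s' \<and> ivar s' x = M" "unchanged ?c ?s s'" "t \<le> 1 + (\<Sum>j<M. \<tau> j + 1 + 1)"
      then show "Q (1 + t) s'" using post unch by simp
    qed
  qed (use x in auto)
qed

lemma wp_assume_wf: "(wf_state K L s \<Longrightarrow> wp c Q s) \<Longrightarrow> wp c Q s"
  unfolding wp_def by blast

lemmas wp_basic = wp_Seq wp_Skip wp_ISetVar wp_RSetVar wp_ISet wp_RSet wp_INew wp_RNew wp_Cond

end

section \<open>Loading and sorting one column or row\<close>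

definition read :: "bool \<Rightarrow> com" where
  "read a = (if a then ReadA 3 else ReadB 3)"

definition tape :: "bool \<Rightarrow> state \<Rightarrow> real list" where
  "tape a s = (if a then tapeA s else tapeB s)"

lemma tape_simps [simp]:
  "tape a (s\<lparr>ivar := f\<rparr>) = tape a s" "tape a (s\<lparr>rvar := g\<rparr>) = tape a s"
  "tape a (s\<lparr>iarr := f'\<rparr>) = tape a s" "tape a (s\<lparr>rarr := g'\<rparr>) = tape a s"
  by (simp_all add: tape_def)

lemma targets_read [simp]:
  "IScalar x \<notin> targets (read a)" "RScalar x \<in> targets (read a) \<longleftrightarrow> x = 3"
  "IArray x \<notin> targets (read a)" "RArray x \<notin> targets (read a)"
  "ILength x \<notin> targets (read a)" "RLength x \<notin> targets (read a)"
  "TapeA \<in> targets (read a) \<longleftrightarrow> a" "TapeB \<in> targets (read a) \<longleftrightarrow> \<not> a"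
  by (simp_all add: read_def)

text \<open>Layout of the memory: scalars 0 to 5 hold \<open>n\<close>, \<open>k\<close>, the capacity and the lengths of the
  old and the new summary; the old summary is in arrays 2, 3 (rows, columns) and real array 1, the new
  one in 4, 5 and 2; real array 3 is the current column of \<open>A\<close>, real arrays 4 and 5 are the sorted
  column and row, integer arrays 8 and 7 their sorting permutations, integer array 6 the marks, and
  real arrays 6 and 7 the work space of the selection.  Names from 50 on belong to the sorting program.\<close>

definition load_sorted :: "com \<Rightarrow> nat \<Rightarrow> bool \<Rightarrow> nat \<Rightarrow> nat \<Rightarrow> nat \<Rightarrow> com" where
  "load_sorted S K' a u d p =
     erase 50 K' ;; ISetVar 50 (IVar 0) ;; RNew 50 (IVar 0) ;; RNew u (IVar 0) ;;
     for_upto 6 (IVar 0) (read a ;; RSet 50 (IVar 6) (RVar 3) ;; RSet u (IVar 6) (RVar 3)) ;;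
     shift 50 S ;; RNew d (IVar 0) ;; INew p (IVar 0) ;;
     for_upto 6 (IVar 0) (RSet d (IVar 6) (RGet 50 (IVar 6)) ;; ISet p (IVar 6) (IGet 50 (IVar 6)))"

lemma fill_update:
  "i < length zs \<Longrightarrow> i < m \<Longrightarrow> (take i zs @ replicate (m - i) c)[i := zs ! i] =
     take (Suc i) zs @ replicate (m - Suc i) c"
  by (simp add: list_update_append take_Suc_conv_app_nth Suc_diff_Suc[symmetric])

lemma view_eq_sort_input:
  assumes "ivar s 50 = length xs" "\<forall>x>50. ivar s x = 0" "\<forall>x\<ge>50. rvar s x = 0"
    "\<forall>x\<ge>50. iarr s x = []" "rarr s 50 = xs" "\<forall>x>50. rarr s x = []"
  shows "view 50 s = sort_input xs"
  using assms by (auto simp: view_def sort_input_def blank_state_def fun_eq_iff)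

context machine
begin

lemma wp_read:
  assumes "tape a s = v # vs" "3 < K"
    and "\<And>s'. ivar s' = ivar s \<Longrightarrow> iarr s' = iarr s \<Longrightarrow> rarr s' = rarr s \<Longrightarrow>
      rvar s' = (rvar s)(3 := v) \<Longrightarrow> tape a s' = vs \<Longrightarrow> tape (\<not> a) s' = tape (\<not> a) s \<Longrightarrow> Q 1 s'"
  shows "wp (read a) Q s"
proof (cases a)
  case True
  then show ?thesis using assms unfolding read_def
    by (auto simp: tape_def intro!: wp_ReadA)
next
  case False
  then show ?thesis using assms unfolding read_def
    by (auto simp: tape_def intro!: wp_ReadB)
qed

lemma wp_sort:
  assumes S: "sorts S Sort d"
    and K: "\<forall>x\<in>targets S. target_names x + 50 < K"
    and W: "(length xs + 2) ^ d \<le> W" and L: "d * (length xs + 1) \<le> L"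
    and view: "view 50 s = sort_input xs"
  shows "wp (shift 50 S) (\<lambda>t s'. t \<le> Sort (length xs) \<and> rarr s' 50 = sort xs \<and>
        length (iarr s' 50) = length xs \<and> set (iarr s' 50) = {..<length xs} \<and>
        rarr s' 50 = map (\<lambda>i. xs ! i) (iarr s' 50) \<and> tapeA s' = tapeA s \<and> tapeB s' = tapeB s) s"
  unfolding wp_def
proof
  assume wf: "wf_state K L s"
  from spec[OF S[unfolded sorts_def], of xs] obtain t m s1 where
    ex: "exec ((length xs + 2) ^ d) S (sort_input xs) t m s1"
    and post: "rarr s1 0 = sort xs" "length (iarr s1 0) = length xs" "set (iarr s1 0) = {..<length xs}"
      "rarr s1 0 = map (\<lambda>i. xs ! i) (iarr s1 0)" "t \<le> Sort (length xs)" "m \<le> d * (length xs + 1)"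
    by (elim exE conjE)
  from exec_shift[OF ex W order_trans[OF post(6) L] K view[symmetric] wf]
  obtain l s' where "exec W (shift 50 S) s t l s'" "l \<le> 2 * K * L" "wf_state K L s'" "s1 = view 50 s'"
    "tapeA s' = tapeA s" "tapeB s' = tapeB s"
    by (elim exE conjE)
  with post show "\<exists>t m s'. exec W (shift 50 S) s t m s' \<and> m \<le> 2 * K * L \<and> wf_state K L s' \<and>
      t \<le> Sort (length xs) \<and> rarr s' 50 = sort xs \<and>
        length (iarr s' 50) = length xs \<and> set (iarr s' 50) = {..<length xs} \<and>
        rarr s' 50 = map (\<lambda>i. xs ! i) (iarr s' 50) \<and> tapeA s' = tapeA s \<and> tapeB s' = tapeB s"
    by (intro exI[of _ t] exI[of _ l] exI[of _ s']) simp
qed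

lemma wp_load_sorted:
  assumes S: "sorts S Sort e"
    and K: "\<forall>x\<in>targets S. target_names x + 50 < K" "K = K' + 50" "0 < K'"
    and W: "(length xs + 2) ^ e \<le> W" "length xs < W"
    and L: "e * (length xs + 1) \<le> L" "length xs \<le> L"
    and n: "ivar s 0 = length xs"
    and tape: "tape a s = xs @ ys"
    and names: "u < 50" "d < 50" "p < 50" "u \<noteq> d"
  shows "wp (load_sorted S K' a u d p) (\<lambda>t s'.
       t \<le> Sort (length xs) + 20 * (K' + length xs + 1) \<and>
       rarr s' u = xs \<and> rarr s' d = sort xs \<and>
       length (iarr s' p) = length xs \<and> set (iarr s' p) = {..<length xs} \<and>
       rarr s' d = map (\<lambda>i. xs ! i) (iarr s' p) \<and>
       tape a s' = ys \<and> tape (\<not> a) s' = tape (\<not> a) s) s"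
proof -
  let ?n = "length xs"
  let ?read = "for_upto 6 (IVar 0) (read a ;; RSet 50 (IVar 6) (RVar 3) ;; RSet u (IVar 6) (RVar 3))"
  let ?copy = "for_upto 6 (IVar 0) (RSet d (IVar 6) (RGet 50 (IVar 6)) ;; ISet p (IVar 6) (IGet 50 (IVar 6)))"
  have K3: "3 < K" and K6: "6 < K" and K50: "50 < K" using K by simp_all
  have read: "wp ?read (\<lambda>t s'. t \<le> 2 + 5 * ?n \<and> rarr s' 50 = xs \<and> rarr s' u = xs \<and>
      tape a s' = ys \<and> tape (\<not> a) s' = tape (\<not> a) s1) s1"
    if s1: "rarr s1 50 = replicate ?n 0" "rarr s1 u = replicate ?n 0"
      "tape a s1 = xs @ ys" "ivar s1 0 = ?n" for s1
  proof (rule wp_for_upto[where M = ?n and \<tau> = "\<lambda>_. 3" and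
        J = "\<lambda>i s'. rarr s' 50 = take i xs @ replicate (?n - i) 0 \<and>
          rarr s' u = take i xs @ replicate (?n - i) 0 \<and> tape a s' = drop i xs @ ys \<and>
          tape (\<not> a) s' = tape (\<not> a) s1"], goal_cases)
    case (3 s') then show ?case using s1 by simp
  next
    case (4 i s') then show ?case using s1 W by (auto simp: unchanged_def)
  next
    case (5 i s')
    then have "tape a s' = xs ! i # drop (Suc i) xs @ ys" by (simp add: Cons_nth_drop_Suc[symmetric])
    moreover have "i \<le> W" using 5(1) W by simp
    ultimately show ?case
      by (intro wp_Seq wp_read[where v = "xs ! i" and vs = "drop (Suc i) xs @ ys"] wp_RSet)
        (use 5 K3 names fill_update[of i xs ?n 0] in simp_all)
  next
    case (6 t s') then show ?case by simp
  qed (use K6 W in auto)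
  have copy: "wp ?copy (\<lambda>t s'. t \<le> 2 + 4 * ?n \<and> rarr s' d = rarr s1 50 \<and> iarr s' p = iarr s1 50) s1"
    if s1: "length (rarr s1 50) = ?n" "length (iarr s1 50) = ?n" "rarr s1 d = replicate ?n 0"
      "iarr s1 p = replicate ?n 0" "ivar s1 0 = ?n" "set (iarr s1 50) = {..<?n}" for s1
  proof (rule wp_for_upto[where M = ?n and \<tau> = "\<lambda>_. 2" and
        J = "\<lambda>i s'. rarr s' d = take i (rarr s1 50) @ replicate (?n - i) 0 \<and>
          iarr s' p = take i (iarr s1 50) @ replicate (?n - i) 0"], goal_cases)
    case (3 s') then show ?case using s1 by simp
  next
    case (4 i s') then show ?case using s1 W names by (auto simp: unchanged_def)
  next
    case (5 i s')
    have unch: "rarr s' 50 = rarr s1 50" "iarr s' 50 = iarr s1 50"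
      using 5 names by (auto simp: unchanged_def)
    have iW: "i \<le> W" "iarr s1 50 ! i \<le> W"
      using 5(1) W s1 nth_mem[of i "iarr s1 50"] by auto
    show ?case
      by (intro wp_basic) (use 5 iW names s1 unch fill_update[of i "rarr s1 50" ?n 0]
        fill_update[of i "iarr s1 50" ?n 0] in simp_all)
  next
    case (6 t s') then show ?case using s1 by simp
  qed (use K6 W in auto)
  show ?thesis unfolding load_sorted_def
  proof (rule wp_Seq_cut[OF wp_erase], goal_cases)
    case 1 then show ?case using K by simp
  next
    case (2 t0 s0)
    show ?case
    proof (rule wp_assume_wf)
      assume wf: "wf_state K L s0"
      have s0: "ivar s0 x = ivar s x" "tape b s0 = tape b s" if "x < 50" for x b
        using unchanged_erase[OF 2(1) that] by (simp_all add: tape_def)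
      \<comment> \<open>Names below \<open>K\<close> have just been erased; those from
        \<open>K\<close> on are blank by \<open>wf_state\<close>.\<close>
      have s0': "\<forall>x\<ge>50. ivar s0 x = 0 \<and> rvar s0 x = 0 \<and> iarr s0 x = [] \<and> rarr s0 x = []"
      proof (intro allI impI)
        fix x :: nat assume "50 \<le> x"
        show "ivar s0 x = 0 \<and> rvar s0 x = 0 \<and> iarr s0 x = [] \<and> rarr s0 x = []"
        proof (cases "x < K")
          case True then show ?thesis using 2(2) \<open>50 \<le> x\<close> K by simp
        next
          case False
          then show ?thesis using wf by (simp add: wf_state_def)
        qed
      qed
      show "wp (ISetVar 50 (IVar 0) ;; RNew 50 (IVar 0) ;; RNew u (IVar 0) ;; ?read ;; shift 50 S ;;
        RNew d (IVar 0) ;; INew p (IVar 0) ;; ?copy) (\<lambda>ua s'.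
         t0 + ua \<le> Sort (length xs) + 20 * (K' + length xs + 1) \<and>
         rarr s' u = xs \<and> rarr s' d = sort xs \<and>
         length (iarr s' p) = length xs \<and> set (iarr s' p) = {..<length xs} \<and>
         rarr s' d = map (\<lambda>i. xs ! i) (iarr s' p) \<and>
         tape a s' = ys \<and> tape (\<not> a) s' = tape (\<not> a) s) s0"
      proof (intro wp_Seq wp_ISetVar wp_RNew, goal_cases)
        case 9
        show ?case
        proof (rule wp_cut[OF read], goal_cases)
          case (5 t1 s1)
          have s1: "view 50 s1 = sort_input xs"
            by (rule view_eq_sort_input)
              (use 5 s0 s0' n names in \<open>simp_all add: unchanged_def\<close>)
          have s1': "ivar s1 0 = ?n" using 5 s0 n names by (simp add: unchanged_def)
          show ?case
          proof (rule wp_Seq_cut[OF wp_sort[OF S K(1) W(1) L(1) s1]], goal_cases)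
            case (1 t2 s2)
            have s2: "ivar s2 0 = ?n" "rarr s2 u = xs"
              using unchanged_shift[OF 1(1)] s1' 5(2) names by simp_all
            show ?case
            proof (intro wp_Seq wp_RNew wp_INew, goal_cases)
              case 7
              show ?case
              proof (rule wp_cut[OF copy], goal_cases)
                case (7 t3 s3)
                have "rarr s3 u = xs" "tape b s3 = tape b s2" for b
                  using 7(1) s2(2) names by (simp_all add: unchanged_def tape_def)
                moreover have "tape b s2 = tape b s1" for b
                  using 1(2) by (simp add: tape_def)
                moreover have "sort xs = map (\<lambda>i. xs ! i) (iarr s2 50)"
                  using 1(2) by metis
                ultimately show ?case
                  using 7(2) 1(2) 5(2) 2(2) s0 s2(1) n names K(3) by simp
              qed (use 1 s2 names in auto)
            qed (use s2 K50 names W L in auto)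
          qed
        qed (use s0 n names tape in simp_all)
      qed (use s0 n K50 W L names in auto)
    qed
  qed
qed

end

section \<open>The selection program\<close>

text \<open>The lazy conjunctions guard the array accesses, and ties are taken from the left run as
  in \<open>merge2\<close>.\<close>

definition merge_step :: "nat \<Rightarrow> nat \<Rightarrow> com" where
  "merge_step src dst =
     Cond (BAnd (BILess (IVar 11) (IVar 13))
        (BNot (BAnd (BILess (IVar 12) (IVar 14)) (BRLess (RGet src (IVar 12)) (RGet src (IVar 11))))))
       (RSet dst (IVar 10) (RGet src (IVar 11)) ;; ISetVar 11 (IAdd (IVar 11) (INum 1)))
       (RSet dst (IVar 10) (RGet src (IVar 12)) ;; ISetVar 12 (IAdd (IVar 12) (INum 1))) ;;
     ISetVar 10 (IAdd (IVar 10) (INum 1))"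

definition merge_pass :: "nat \<Rightarrow> nat \<Rightarrow> com" where
  "merge_pass src dst =
     ISetVar 10 (INum 0) ;;
     While (BILess (IVar 10) (IVar 9))
       (ISetVar 11 (IVar 10) ;; ISetVar 13 (IAdd (IVar 10) (IVar 15)) ;; ISetVar 12 (IVar 13) ;;
        ISetVar 14 (IAdd (IVar 13) (IVar 15)) ;;
        While (BILess (IVar 10) (IVar 14)) (merge_step src dst))"

definition halve :: "nat \<Rightarrow> com" where
  "halve a = ISetVar 9 (IDiv (IVar 9) (INum 2)) ;;
     for_upto 10 (IVar 9) (RSet a (IVar 10) (RGet a (IAdd (IMul (INum 2) (IVar 10)) (INum 1))))"

text \<open>Scalar 8 is the run length and scalar 9 the length of the list. A round doubles the one
  and halves the other, from 1 and \<open>4 ^ a\<close> until they meet at \<open>2 ^ a\<close>. Its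
  two passes bring the data back to array 6.\<close>

definition select :: com where
  "select = ISetVar 8 (INum 1) ;; ISetVar 9 (IVar 2) ;;
     While (BILess (IVar 8) (IVar 9))
       (ISetVar 15 (IVar 8) ;; merge_pass 6 7 ;; ISetVar 15 (IMul (INum 2) (IVar 8)) ;; merge_pass 7 6 ;;
        halve 6 ;; ISetVar 8 (IMul (INum 2) (IVar 8))) ;;
     RSetVar 2 (RGet 6 (IDiv (IVar 8) (INum 4)))"

lemma take_Suc_update:
  "i < length xs \<Longrightarrow> take (Suc i) (xs[i := v]) = take i xs @ [v]"
  by (simp add: take_Suc_conv_app_nth)

lemma drop_take_Cons:
  "i < j \<Longrightarrow> j \<le> length xs \<Longrightarrow> drop i (take j xs) = xs ! i # drop (Suc i) (take j xs)"
  using Cons_nth_drop_Suc[of i "take j xs"] by simp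

lemma targets_merge_step [simp]:
  "targets (merge_step src dst) = {RArray dst, IScalar 10, IScalar 11, IScalar 12}"
  by (auto simp: merge_step_def)

lemma targets_merge_pass [simp]:
  "targets (merge_pass src dst) =
     {RArray dst, IScalar 10, IScalar 11, IScalar 12, IScalar 13, IScalar 14}"
  by (auto simp: merge_pass_def)

lemma targets_halve [simp]: "targets (halve a) = {RArray a, IScalar 9, IScalar 10}"
  by (auto simp: halve_def)

lemma merge_runs_Nil [simp]: "merge_runs r [] = []"
  by (simp add: merge_runs.simps)

lemma sum_halving:
  "m \<le> M \<Longrightarrow> (\<Sum>l<m. 2 ^ (M - l)) + 2 * 2 ^ (M - m) = (2 * 2 ^ M :: nat)"
proof (induction m)
  case (Suc m)
  then have "(2::nat) ^ (M - m) = 2 * 2 ^ (M - Suc m)"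
    by (metis Suc_diff_Suc Suc_le_lessD power_Suc)
  then show ?case using Suc by simp
qed simp

lemma merge_runs_slice:
  assumes "0 < r" "b + 2 * r \<le> z" "z \<le> length xs"
  shows "merge_runs r (drop b (take z xs)) =
    merge2 (drop b (take (b + r) xs)) (drop (b + r) (take (b + 2 * r) xs)) @
    merge_runs r (drop (b + 2 * r) (take z xs))"
proof -
  have "b < z" using assms by linarith
  then have nonempty: "drop b (take z xs) \<noteq> []" using assms by simp
  have 1: "take r (drop b (take z xs)) = drop b (take (b + r) xs)"
    using assms by (simp add: take_drop add.commute min_def)
  have 2: "take r (drop r (drop b (take z xs))) = drop (b + r) (take (b + 2 * r) xs)"
    using assms by (simp add: take_drop mult_2 add.commute add.left_commute min_def)
  have 3: "drop (2 * r) (drop b (take z xs)) = drop (b + 2 * r) (take z xs)"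
    by (simp add: add.commute)
  show ?thesis
    using nonempty assms(1) by (subst merge_runs.simps) (simp only: 1 2 3 if_False simp_thms, simp)
qed

context machine
begin

text \<open>The invariant is that the output so far, followed by \<open>merge2\<close> of what
  remains of the two runs, does not change.\<close>

lemma wp_merge_loop:
  fixes src dst :: nat and s :: state
  defines "xs \<equiv> rarr s src" and "z \<equiv> rarr s dst"
  assumes K: "50 < K"
    and v: "ivar s 10 = b" "ivar s 11 = b" "ivar s 12 = b + r" "ivar s 13 = b + r" "ivar s 14 = b + 2 * r"
    and len: "b + 2 * r \<le> length xs" "b + 2 * r \<le> length z" and W: "b + 2 * r < W"
    and ne: "src \<noteq> dst"
  shows "wp (While (BILess (IVar 10) (IVar 14)) (merge_step src dst)) (\<lambda>t s'.
      t \<le> 1 + 10 * r \<and> ivar s' 10 = b + 2 * r \<and>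
      take (b + 2 * r) (rarr s' dst) =
        take b z @ merge2 (drop b (take (b + r) xs)) (drop (b + r) (take (b + 2 * r) xs))) s"
proof (rule wp_While_index[where M = "2 * r" and \<tau> = "\<lambda>_. 4" and
    J = "\<lambda>u s'. ivar s' 10 = b + u \<and> ivar s' 11 \<le> b + r \<and> ivar s' 12 \<le> b + 2 * r \<and>
      ivar s' 11 + ivar s' 12 = 2 * b + r + u \<and>
      take (b + u) (rarr s' dst) @ merge2 (drop (ivar s' 11) (take (b + r) xs))
          (drop (ivar s' 12) (take (b + 2 * r) xs)) =
        take b z @ merge2 (drop b (take (b + r) xs)) (drop (b + r) (take (b + 2 * r) xs))"],
    goal_cases)
  case 1
  then show ?case using v by (simp add: z_def)
next
  case (2 u s')
  then show ?case using v W by (simp add: unchanged_def)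
next
  case (3 u s')
  define i j where "i = ivar s' 11" and "j = ivar s' 12"
  let ?e = "b + r" and ?f = "b + 2 * r"
  have v': "ivar s' 13 = ?e" "ivar s' 14 = ?f" "rarr s' src = xs"
    "length (rarr s' dst) = length z"
    using 3(3) v ne by (simp_all add: unchanged_def xs_def z_def)
  have ij: "i \<le> ?e" "j \<le> ?f" "i + j = 2 * b + r + u" "ivar s' 10 = b + u"
    using 3(2) by (simp_all add: i_def j_def)
  have bu: "b + u < length z" "b + u < W" "b + u < ?f" using 3(1) len W by simp_all
  have inv: "take (b + u) (rarr s' dst) @ merge2 (drop i (take ?e xs)) (drop j (take ?f xs)) =
        take b z @ merge2 (drop b (take ?e xs)) (drop ?e (take ?f xs))"
    using 3(2) by (simp add: i_def j_def)
  have upd: "take (Suc (b + u)) ((rarr s' dst)[b + u := c]) = take (b + u) (rarr s' dst) @ [c]" for c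
    using bu v' by (intro take_Suc_update) simp
  have dropi: "drop i (take ?e xs) = xs ! i # drop (Suc i) (take ?e xs)" if "i < ?e"
    using that len by (intro drop_take_Cons) auto
  have dropj: "drop j (take ?f xs) = xs ! j # drop (Suc j) (take ?f xs)" if "j < ?f"
    using that len by (intro drop_take_Cons) auto
  show ?case
  proof (cases "i < ?e \<and> \<not> (j < ?f \<and> xs ! j < xs ! i)")
    case True
    have "merge2 (drop i (take ?e xs)) (drop j (take ?f xs)) =
        xs ! i # merge2 (drop (Suc i) (take ?e xs)) (drop j (take ?f xs))"
      using True dropi dropj by (cases "j < ?f") auto
    then have inv': "take (Suc (b + u)) ((rarr s' dst)[b + u := xs ! i]) @
        merge2 (drop (Suc i) (take ?e xs)) (drop j (take ?f xs)) =
        take b z @ merge2 (drop b (take ?e xs)) (drop ?e (take ?f xs))"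
      using inv by (simp add: upd)
    show ?thesis unfolding merge_step_def
      by (intro wp_Seq wp_Cond wp_RSet wp_ISetVar)
        (use True ij v' bu len W K inv' ne in \<open>simp_all add: i_def[symmetric] j_def[symmetric]\<close>)
  next
    case False
    then have j: "j < ?f" using ij bu(3) by auto
    have "merge2 (drop i (take ?e xs)) (drop j (take ?f xs)) =
        xs ! j # merge2 (drop i (take ?e xs)) (drop (Suc j) (take ?f xs))"
    proof (cases "i < ?e")
      case True
      then show ?thesis using False dropi dropj j by auto
    next
      case False
      then show ?thesis using dropj j by simp
    qed
    then have inv': "take (Suc (b + u)) ((rarr s' dst)[b + u := xs ! j]) @
        merge2 (drop i (take ?e xs)) (drop (Suc j) (take ?f xs)) =
        take b z @ merge2 (drop b (take ?e xs)) (drop ?e (take ?f xs))"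
      using inv by (simp add: upd)
    show ?thesis unfolding merge_step_def
      by (intro wp_Seq wp_Cond wp_RSet wp_ISetVar)
        (use False j ij v' bu len W K inv' ne in \<open>simp_all add: i_def[symmetric] j_def[symmetric]\<close>)
  qed
next
  case (4 t s')
  have ij: "ivar s' 11 = b + r" "ivar s' 12 = b + 2 * r" using 4(1) by (elim conjE; linarith)+
  from 4(1) have "take (b + 2 * r) (rarr s' dst) @ merge2 (drop (ivar s' 11) (take (b + r) xs))
          (drop (ivar s' 12) (take (b + 2 * r) xs)) =
        take b z @ merge2 (drop b (take (b + r) xs)) (drop (b + r) (take (b + 2 * r) xs))"
    by (elim conjE)
  then show ?case using 4 unfolding ij by simp
qed

lemma wp_merge_pass:
  fixes src dst :: nat and s :: state
  defines "xs \<equiv> rarr s src" and "z \<equiv> rarr s dst"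
  assumes K: "50 < K" and v: "ivar s 15 = r" "ivar s 9 = 2 * r * m" "0 < r"
    and len: "2 * r * m \<le> length xs" "2 * r * m \<le> length z" and W: "2 * r * m < W"
    and ne: "src \<noteq> dst"
  shows "wp (merge_pass src dst) (\<lambda>t s'. t \<le> 2 + 16 * (r * m) \<and>
      take (2 * r * m) (rarr s' dst) = merge_runs r (take (2 * r * m) xs)) s"
  unfolding merge_pass_def
proof (rule wp_Seq, rule wp_ISetVar, goal_cases)
  case 3
  show ?case
  proof (rule wp_While_index[where M = m and \<tau> = "\<lambda>_. 5 + 10 * r" and
    J = "\<lambda>q s'. ivar s' 10 = 2 * r * q \<and>
      take (2 * r * q) (rarr s' dst) @ merge_runs r (drop (2 * r * q) (take (2 * r * m) xs)) =
        merge_runs r (take (2 * r * m) xs)"], goal_cases)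
    case 1
    then show ?case by simp
  next
    case (2 q s')
    have "2 * r * q \<le> 2 * r * m" using 2(1) by simp
    then have "2 * r * q \<le> W" using W by linarith
    then show ?case using 2 v W by (simp add: unchanged_def)
  next
    case (3 q s')
    let ?b = "2 * r * q"
    have b: "?b + 2 * r \<le> 2 * r * m"
      using 3(1) mult_le_mono2[of "Suc q" m "2 * r"] by simp
    have v': "ivar s' 9 = 2 * r * m" "ivar s' 15 = r" "rarr s' src = xs" "length (rarr s' dst) = length z"
      using 3(3) v ne by (simp_all add: unchanged_def xs_def z_def)
    show ?case
    proof (intro wp_Seq wp_ISetVar, goal_cases)
      case 9
      show ?case
      proof (rule wp_cut[OF wp_merge_loop[where b = ?b and r = r]], goal_cases)
        case (11 t s'')
        have "merge_runs r (drop ?b (take (2 * r * m) xs)) =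
          merge2 (drop ?b (take (?b + r) xs)) (drop (?b + r) (take (?b + 2 * r) xs)) @
          merge_runs r (drop (2 * r * Suc q) (take (2 * r * m) xs))"
          using merge_runs_slice[OF v(3) b len(1)] by (simp add: add.commute)
        then show ?case using 11 3(2) v' by (simp add: add.commute)
      qed (use 3 v' b len W K ne in simp_all)
    qed (use 3 v' b W K in simp_all)
  next
    case (4 t s')
    have "1 * m \<le> r * m" using v(3) by (intro mult_le_mono1) simp
    moreover have "(\<Sum>j<m. 5 + 10 * r + 1) = 6 * m + 10 * (r * m)" by (simp add: algebra_simps)
    ultimately have "1 + t \<le> 2 + 16 * (r * m)" using 4(3) by linarith
    then show ?case using 4(1) len by simp
  qed
qed (use K in auto)

lemma wp_merge_pass':
  assumes "50 < K" "ivar s 15 = r" "ivar s 9 = Z" "Z = 2 * r * m" "0 < r"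
    and "Z \<le> length (rarr s src)" "Z \<le> length (rarr s dst)" "Z < W" "src \<noteq> dst"
  shows "wp (merge_pass src dst) (\<lambda>t s'. t \<le> 2 + 8 * Z \<and>
      take Z (rarr s' dst) = merge_runs r (take Z (rarr s src))) s"
  using wp_merge_pass[of s r m src dst] assms by simp

text \<open>Halving in place is safe: when slot \<open>i\<close> is written, slot
  \<open>2 * i + 1\<close> has not yet been overwritten.\<close>

lemma wp_halve:
  fixes s :: state and a :: nat
  defines "xs \<equiv> rarr s a"
  assumes K: "50 < K" and v: "ivar s 9 = 2 * z" and len: "2 * z \<le> length xs" and W: "2 * z + 2 < W"
  shows "wp (halve a) (\<lambda>t s'. t \<le> 3 + 3 * z \<and> ivar s' 9 = z \<and>
    take z (rarr s' a) = odds (take (2 * z) xs)) s"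
  unfolding halve_def
proof (rule wp_Seq, rule wp_ISetVar, goal_cases)
  case 3
  show ?case
  proof (rule wp_for_upto[where M = z and \<tau> = "\<lambda>_. 1" and
      J = "\<lambda>i s'. \<forall>j<length xs. rarr s' a ! j = (if j < i then xs ! (2 * j + 1) else xs ! j)"], goal_cases)
    case (3 s')
    then show ?case by (simp add: xs_def)
  next
    case (4 i s')
    then show ?case using v W by (simp add: unchanged_def)
  next
    case (5 i s')
    have "length (rarr s' a) = length xs" using 5(3) by (simp add: unchanged_def xs_def)
    then show ?case
      by (intro wp_RSet) (use 5 len W in \<open>auto simp: nth_list_update less_Suc_eq\<close>)
  next
    case (6 t s')
    have "length (rarr s' a) = length xs" "ivar s' 9 = z"
      using 6(2) v by (simp_all add: unchanged_def xs_def)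
    moreover have "take z (rarr s' a) = odds (take (2 * z) xs)"
      using 6(1) len calculation by (intro nth_equalityI) (simp_all add: nth_odds)
    ultimately show ?case using 6(4) by simp
  qed (use W K in auto)
qed (use K v W in auto)

lemma wp_select:
  fixes s :: state
  defines "xs \<equiv> rarr s 6"
  assumes K: "50 < K" and v: "ivar s 2 = 4 ^ a" "2 \<le> a"
    and len: "length xs = 4 ^ a" "length (rarr s 7) = 4 ^ a" and W: "2 * 4 ^ a + 2 < W"
  shows "wp select (\<lambda>t s'. t \<le> 100 * 4 ^ a \<and>
      4 * count_list_if (\<lambda>x. rvar s' 2 < x) xs \<le> 3 * 4 ^ a \<and>
      4 ^ a \<le> 4 * count_list_if (\<lambda>x. rvar s' 2 \<le> x) xs) s"
  unfolding select_def
proof (intro wp_Seq wp_ISetVar, goal_cases)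
  case 5
  show ?case
  proof (rule wp_While_index[where M = a and \<tau> = "\<lambda>l. 30 * 2 ^ (2 * a - l)" and
      J = "\<lambda>l s'. ivar s' 8 = 2 ^ l \<and> ivar s' 9 = 2 ^ (2 * a - l) \<and>
        sketch a l xs (take (2 ^ (2 * a - l)) (rarr s' 6))"], goal_cases)
    case 1
    then show ?case using v len sketch_0[of xs a] by (simp add: xs_def power_mult)
  next
    case (2 l s')
    have "(2::nat) ^ l < 2 ^ (2 * a - l) \<longleftrightarrow> l < a" using 2(1) by auto
    moreover have "(2::nat) ^ l \<le> 2 ^ (2 * a)" "(2::nat) ^ (2 * a - l) \<le> 2 ^ (2 * a)"
      using 2(1) by (simp_all add: power_increasing)
    ultimately show ?case using 2 W by (simp add: power_mult)
  next
    case (3 l s')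
    define r Z m :: nat where "r = 2 ^ l" and "Z = 2 ^ (2 * a - l)" and "m = 4 ^ (a - Suc l)"
    have e: "2 * a - l = l + 2 * (a - Suc l) + 2" "2 * a - Suc l = l + 2 * (a - Suc l) + 1"
      using 3(1) by simp_all
    have Z: "Z = 2 * r * (2 * m)" "Z = 2 * (2 * r) * m" "Z = 2 * (2 * r * m)"
      and Z': "2 ^ (2 * a - Suc l) = 2 * r * m"
      unfolding e r_def Z_def m_def by (simp_all add: power_add power_mult)
    have ZN: "Z \<le> 4 ^ a" "r \<le> 4 ^ a"
      using power_increasing[of "2 * a - l" "2 * a" "2::nat"] power_increasing[of l "2 * a" "2::nat"] 3(1)
      by (simp_all add: power_mult Z_def r_def)
    have pos: "0 < m" "0 < r" by (simp_all add: m_def r_def)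
    then have "1 * 1 \<le> r * m" by (intro mult_le_mono) simp_all
    then have Z4: "4 \<le> Z" using Z(1) by simp
    have v': "length (rarr s' 6) = 4 ^ a" "length (rarr s' 7) = 4 ^ a" "ivar s' 8 = r" "ivar s' 9 = Z"
      using 3(2,3) len by (simp_all add: unchanged_def xs_def r_def Z_def)
    have 1: "wp (merge_pass 6 7) (\<lambda>t s''. t \<le> 2 + 8 * Z \<and>
        take Z (rarr s'' 7) = merge_runs r (take Z (rarr s1 6))) s1"
      if "ivar s1 15 = r" "ivar s1 9 = Z" "length (rarr s1 6) = 4 ^ a" "length (rarr s1 7) = 4 ^ a" for s1
      by (rule wp_merge_pass'[OF _ _ _ Z(1)]) (use that ZN K W pos in simp_all)
    have 2: "wp (merge_pass 7 6) (\<lambda>t s''. t \<le> 2 + 8 * Z \<and>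
        take Z (rarr s'' 6) = merge_runs (2 * r) (take Z (rarr s1 7))) s1"
      if "ivar s1 15 = 2 * r" "ivar s1 9 = Z" "length (rarr s1 6) = 4 ^ a" "length (rarr s1 7) = 4 ^ a" for s1
      by (rule wp_merge_pass'[OF _ _ _ Z(2)]) (use that ZN K W pos in simp_all)
    have sketch_l: "sketch a l xs (take Z (rarr s' 6))" using 3(2) by (simp add: Z_def)
    show ?case
    proof (intro wp_Seq wp_ISetVar, goal_cases)
      case 3
      show ?case
      proof (rule wp_cut[OF 1], goal_cases)
        case (5 t1 s1)
        have s1: "ivar s1 8 = r" "ivar s1 9 = Z" "length (rarr s1 6) = 4 ^ a" "length (rarr s1 7) = 4 ^ a"
          using 5(1) v' by (simp_all add: unchanged_def)
        note post1 = 5(2)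
        show ?case
        proof (intro wp_Seq wp_ISetVar, goal_cases)
          case 3
          show ?case
          proof (rule wp_cut[OF 2], goal_cases)
            case (5 t2 s2)
            have s2: "ivar s2 8 = r" "ivar s2 9 = 2 * (2 * r * m)" "length (rarr s2 6) = 4 ^ a"
              using 5(1) s1 Z(3) by (simp_all add: unchanged_def)
            note post2 = 5(2)
            show ?case
            proof (rule wp_Seq, rule wp_cut[OF wp_halve[where z = "2 * r * m"]], goal_cases)
              case (5 t3 s3)
              have s3: "ivar s3 8 = r" using 5(1) s2 by (simp add: unchanged_def)
              have "take (2 * r * m) (rarr s3 6) = thin r (take Z (rarr s' 6))"
                using 5(2) post1 post2 Z(3) by (simp add: thin_def)
              then have sk: "sketch a (Suc l) xs (take (2 ^ (2 * a - Suc l)) (rarr s3 6))"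
                using sketch_Suc[OF sketch_l \<open>l < a\<close>] Z' by (simp add: r_def)
              have time: "1 + (t1 + (1 + (t2 + (t3 + 1)))) \<le> 30 * Z"
                using 5(2) post1 post2 Z4 Z(3) by (elim conjE) linarith
              show ?case
                by (intro wp_ISetVar)
                  (use 5(2) sk s3 time ZN W K Z' in \<open>simp_all add: r_def[symmetric] Z_def[symmetric]\<close>)
            qed (use s2 ZN Z(3)[symmetric] K W in simp_all)
          qed (use s1 in simp_all)
        qed (use s1 K ZN W in simp_all)
      qed (use v' in simp_all)
    qed (use v' K ZN W in simp_all)
  next
    case (4 t s')
    have len': "length (rarr s' 6) = 4 ^ a" using 4(2) len by (simp add: unchanged_def xs_def)
    have e: "2 * a - a = a" by simp
    have q: "(2::nat) ^ a div 4 < 2 ^ a" "(2::nat) ^ a \<le> 4 ^ a" by (simp_all add: power_mono)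
    have nth: "take (2 ^ a) (rarr s' 6) ! (2 ^ a div 4) = rarr s' 6 ! (2 ^ a div 4)"
      using q(1) by (rule nth_take)
    have "sketch a a xs (take (2 ^ a) (rarr s' 6))" using 4(1) by (simp add: e)
    note quant = sketch_quantile[OF this v(2) len(1), unfolded nth]
    \<comment> \<open>The lengths of the rounds sum to at most \<open>2 * 4 ^ a\<close>, and the
      \<open>a\<close> loop tests are absorbed by \<open>a < 4 ^ a\<close>.\<close>
    have sum: "(\<Sum>l<a. 30 * 2 ^ (2 * a - l) + 1) \<le> 90 * (4 ^ a :: nat)"
    proof -
      have "(\<Sum>l<a. 30 * 2 ^ (2 * a - l) + 1) = 30 * (\<Sum>l<a. 2 ^ (2 * a - l)) + (a :: nat)"
        by (simp only: sum.distrib sum_distrib_left[symmetric]) simp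
      moreover have "(\<Sum>l<a. 2 ^ (2 * a - l)) \<le> 2 * (4::nat) ^ a"
        using sum_halving[of a "2 * a"] by (simp add: power_mult)
      moreover have "a < 4 ^ a" by (rule less_le_trans[OF less_exp]) (simp add: power_mono)
      ultimately show ?thesis by linarith
    qed
    have big: "16 \<le> (4::nat) ^ a" using power_increasing[OF v(2), of "4::nat"] by simp
    then have idx: "4 \<le> W" "(2::nat) ^ a div 4 < 4 ^ a" "2 ^ a \<le> W" using W q by linarith+
    have time: "1 + (1 + (t + 1)) \<le> 100 * 4 ^ a" using 4(3) sum big by linarith
    show ?case
      by (intro wp_RSetVar) (use 4(1) K idx quant time len' in simp_all)
  qed
qed (use K v W in auto)

end

section \<open>The threshold program\<close>

definition doubling :: "nat \<Rightarrow> com \<Rightarrow> com" where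
  "doubling x c = ISetVar x (INum 1) ;;
     While (BNot (BILess (IVar 0) (IVar x))) (c ;; ISetVar x (IMul (INum 2) (IVar x)))"

lemma targets_doubling [simp]: "targets (doubling x c) = insert (IScalar x) (targets c)"
  by (auto simp: doubling_def)

context machine
begin

text \<open>The counter leaves the loop as \<open>2 ^ Suc l\<close>, which can reach
  \<open>2 * n\<close>; the word bound has to allow for it.\<close>

lemma wp_doubling:
  assumes x: "x < K" "x \<noteq> 0" and n: "2 ^ l \<le> n" "n < 2 ^ Suc l" "2 * n + 2 \<le> W"
    and init: "\<And>s'. s' = s\<lparr>ivar := (ivar s)(x := 1)\<rparr> \<Longrightarrow> J 0 s'"
    and bound: "ivar s 0 = n" "IScalar 0 \<notin> targets c"
    and step: "\<And>p s'. p \<le> l \<Longrightarrow> J p s' \<Longrightarrow> unchanged (doubling x c) s s' \<Longrightarrow> ivar s' x = 2 ^ p \<Longrightarrow>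
      wp c (\<lambda>t s''. ivar s'' x = 2 ^ p \<and> J (Suc p) (s''\<lparr>ivar := (ivar s'')(x := 2 ^ Suc p)\<rparr>) \<and> t \<le> \<tau>) s'"
    and post: "\<And>t s'. J (Suc l) s' \<Longrightarrow> unchanged (doubling x c) s s' \<Longrightarrow>
      t \<le> 2 + Suc l * (\<tau> + 2) \<Longrightarrow> Q t s'"
  shows "wp (doubling x c) Q s"
proof -
  let ?s = "s\<lparr>ivar := (ivar s)(x := 1)\<rparr>" and ?c = "c ;; ISetVar x (IMul (INum 2) (IVar x))"
  have unch: "unchanged (doubling x c) s s'" if "unchanged ?c ?s s'" for s'
    using that by (auto simp: unchanged_def)
  have pow: "2 ^ p \<le> n \<longleftrightarrow> p < Suc l" for p
  proof
    assume "2 ^ p \<le> n"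
    then have "(2::nat) ^ p < 2 ^ Suc l" using n by linarith
    then show "p < Suc l" by (rule power_less_imp_less_exp[rotated]) simp
  next
    assume "p < Suc l"
    then have "(2::nat) ^ p \<le> 2 ^ l" by (intro power_increasing) auto
    then show "2 ^ p \<le> n" using n by linarith
  qed
  have powW: "2 ^ p \<le> 2 * n" if "p \<le> Suc l" for p
  proof -
    have "(2::nat) ^ p \<le> 2 ^ Suc l" using that by (intro power_increasing) auto
    then show ?thesis using n(1) by simp
  qed
  show ?thesis unfolding doubling_def
  proof (rule wp_Seq, rule wp_ISetVar)
    show "wp (While (BNot (BILess (IVar 0) (IVar x))) ?c) (\<lambda>u. Q (1 + u)) (s\<lparr>ivar := (ivar s)(x := ival (INum 1) s)\<rparr>)"
      unfolding ival.simps
    proof (rule wp_While_index[where J = "\<lambda>p s. J p s \<and> ivar s x = 2 ^ p" and M = "Suc l" and \<tau> = "\<lambda>p. \<tau> + 1"])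
      show "J 0 ?s \<and> ivar ?s x = 2 ^ 0" using init by simp
    next
      fix p s' assume p: "p \<le> Suc l" "J p s' \<and> ivar s' x = 2 ^ p" "unchanged ?c ?s s'"
      then have "ivar s' 0 = n" using bound x by (simp add: unchanged_def)
      then show "bsafe W (BNot (BILess (IVar 0) (IVar x))) s' \<and> bval (BNot (BILess (IVar 0) (IVar x))) s' = (p < Suc l)"
        using p powW[of p] pow[of p] n by (simp add: not_less)
    next
      fix p s' assume p: "p < Suc l" and J: "J p s' \<and> ivar s' x = 2 ^ p" and u: "unchanged ?c ?s s'"
      show "wp ?c (\<lambda>t s''. (J (Suc p) s'' \<and> ivar s'' x = 2 ^ Suc p) \<and> t \<le> \<tau> + 1) s'"
      proof (rule wp_Seq, rule wp_cut[OF step])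
        show "p \<le> l" "J p s'" "ivar s' x = 2 ^ p" "unchanged (doubling x c) s s'"
          using p J unch[OF u] by auto
      next
        fix t s''
        assume "ivar s'' x = 2 ^ p \<and> J (Suc p) (s''\<lparr>ivar := (ivar s'')(x := 2 ^ Suc p)\<rparr>) \<and> t \<le> \<tau>"
        then show "wp (ISetVar x (IMul (INum 2) (IVar x)))
           (\<lambda>u s''. (J (Suc p) s'' \<and> ivar s'' x = 2 ^ Suc p) \<and> t + u \<le> \<tau> + 1) s''"
          using x p powW[of "Suc p"] n by (intro wp_ISetVar) simp_all
      qed
    next
      fix t s' assume "J (Suc l) s' \<and> ivar s' x = 2 ^ Suc l" "unchanged ?c ?s s'"
        "t \<le> 1 + (\<Sum>j<Suc l. \<tau> + 1 + 1)"
      then show "Q (1 + t) s'" using post unch by simp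
    qed
  qed (use x n in auto)
qed

end

definition weigh :: com where
  "weigh = ISetVar 10 (INum 0) ;;
     doubling 11 (doubling 12
       (Cond (BRLess (RVar 4) (RMul (RGet 4 (ISub (IVar 0) (IVar 11))) (RGet 5 (ISub (IVar 0) (IVar 12)))))
         (ISetVar 10 (IAdd (IVar 10) (IMul (IVar 11) (IVar 12)))) Skip))"

definition candidate :: com where
  "candidate = weigh ;;
     Cond (BAnd (BNot (BILess (IDiv (IVar 2) (INum 4)) (IVar 10))) (BRLess (RVar 4) (RVar 1)))
       (RSetVar 1 (RVar 4)) Skip"

text \<open>The search starts from the largest corner, whose weight is 0 and which is therefore
  always feasible. It then tries 0 and all corners and keeps the smallest feasible value, so no list
  of candidates is stored.\<close>

definition find_threshold :: com where
  "find_threshold =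
     RSetVar 1 (RMul (RGet 4 (ISub (IVar 0) (INum 1))) (RGet 5 (ISub (IVar 0) (INum 1)))) ;;
     RSetVar 4 (RNat (INum 0)) ;; candidate ;;
     doubling 13 (doubling 14
       (RSetVar 4 (RMul (RGet 4 (ISub (IVar 0) (IVar 13))) (RGet 5 (ISub (IVar 0) (IVar 14)))) ;; candidate))"

lemma targets_weigh [simp]: "targets weigh = {IScalar 10, IScalar 11, IScalar 12}"
  by (auto simp: weigh_def)

lemma targets_candidate [simp]: "targets candidate = {IScalar 10, IScalar 11, IScalar 12, RScalar 1}"
  by (auto simp: candidate_def)

lemma targets_find_threshold [simp]: "targets find_threshold =
    {IScalar 10, IScalar 11, IScalar 12, IScalar 13, IScalar 14, RScalar 1, RScalar 4}"
  by (auto simp: find_threshold_def)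

text \<open>The sorter returns ascending lists; \<open>X ! (n - i)\<close> is the
  \<open>i\<close>-th largest element, counted from 1 as in \<open>sorted_product\<close>.\<close>

locale machine_product = machine W K L + sorted_product "\<lambda>i. X ! (n - i)" "\<lambda>j. Y ! (n - j)" n l
  for W K L :: nat and X Y :: "real list" and n l :: nat +
  assumes K: "50 < K" and len: "length X = n" "length Y = n" and W: "2 * n + 4 \<le> W" "4 * n * n + 4 \<le> W"
begin

definition summand :: "real \<Rightarrow> nat \<Rightarrow> nat \<Rightarrow> nat" where
  "summand \<delta> p q = (if \<delta> < corner p q then 2 ^ p * 2 ^ q else 0)"

lemma weight_summand: "weight \<delta> = (\<Sum>p<Suc l. \<Sum>q<Suc l. summand \<delta> p q)"
  unfolding weight_def summand_def lessThan_Suc_atMost ..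

text \<open>The word bound has to hold at every addition, not only for the final weight.\<close>

lemma partial_weight_le:
  assumes "p \<le> l" "q \<le> l"
  shows "(\<Sum>i<p. \<Sum>j<Suc l. summand \<delta> i j) + (\<Sum>j<Suc q. summand \<delta> p j) \<le> 4 * n * n"
proof -
  have "(\<Sum>j<Suc q. summand \<delta> p j) \<le> (\<Sum>j<Suc l. summand \<delta> p j)"
    using assms by (intro sum_mono2) auto
  moreover have "(\<Sum>i<Suc p. \<Sum>j<Suc l. summand \<delta> i j) \<le> (\<Sum>i<Suc l. \<Sum>j<Suc l. summand \<delta> i j)"
    using assms by (intro sum_mono2) auto
  ultimately show ?thesis using weight_le[of \<delta>] unfolding weight_summand sum.lessThan_Suc[of _ p] by linarith
qed

definition inputs :: "state \<Rightarrow> bool" where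
  "inputs s \<longleftrightarrow> ivar s 0 = n \<and> rarr s 4 = X \<and> rarr s 5 = Y"

lemma inputs_upd [simp]:
  "x \<noteq> 0 \<Longrightarrow> inputs (s\<lparr>ivar := (ivar s)(x := v)\<rparr>) = inputs s"
  "inputs (s\<lparr>rvar := f\<rparr>) = inputs s"
  by (simp_all add: inputs_def)

lemma n_pos: "1 \<le> n"
  using l(1) by (meson le_trans one_le_numeral one_le_power)

lemma wp_weigh:
  assumes "inputs s"
  shows "wp weigh (\<lambda>t s'. t \<le> 11 * Suc l ^ 2 \<and> ivar s' 10 = weight (rvar s 4)) s"
  unfolding weigh_def
proof (rule wp_Seq, rule wp_ISetVar, goal_cases)
  case 3
  let ?s = "s\<lparr>ivar := (ivar s)(10 := ival (INum 0) s)\<rparr>"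
  let ?term = "summand (rvar s 4)"
  show ?case
  proof (rule wp_doubling[where l = l and n = n and \<tau> = "6 * Suc l" and
      J = "\<lambda>p s'. ivar s' 10 = (\<Sum>i<p. \<Sum>j<Suc l. ?term i j)"], goal_cases)
    case (9 p s1)
    have s1: "inputs s1" "rvar s1 4 = rvar s 4"
      using 9(3) assms by (simp_all add: unchanged_def inputs_def)
    show ?case
    proof (rule wp_doubling[where l = l and n = n and \<tau> = 2 and
        J = "\<lambda>q s'. ivar s' 10 = (\<Sum>i<p. \<Sum>j<Suc l. ?term i j) + (\<Sum>j<q. ?term p j)"], goal_cases)
      case (9 q s2)
      have s2: "inputs s2" "rvar s2 4 = rvar s 4" "ivar s2 11 = 2 ^ p"
        using 9(3) s1 \<open>ivar s1 11 = _\<close> by (simp_all add: unchanged_def inputs_def)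
      have pn: "2 ^ p \<le> n" "2 ^ q \<le> n" using pow_le_n 9(1) \<open>p \<le> l\<close> by auto
      then have lt: "n - 2 ^ p < n" "n - 2 ^ q < n" using n_pos by auto
      have mult: "2 ^ p * 2 ^ q \<le> n * n" using pn by (rule mult_le_mono)
      have le: "ivar s2 10 + (if rvar s 4 < corner p q then 2 ^ p * 2 ^ q else 0) \<le> 4 * n * n"
        using partial_weight_le[OF \<open>p \<le> l\<close> 9(1), of "rvar s 4"] 9(2) by (simp add: summand_def)
      have nW: "n \<le> W" "2 ^ p \<le> W" "2 ^ q \<le> W" "2 ^ p * 2 ^ q \<le> W" "ivar s2 10 \<le> W"
        using pn W mult le by linarith+
      show ?case
        by (intro wp_Cond wp_ISetVar wp_Skip)
          (use 9 s2 lt nW le W K len in \<open>simp_all add: inputs_def corner_def summand_def\<close>)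
    next
      case (10 t s2)
      then show ?case using 9 by (simp add: unchanged_def)
    qed (use 9 s1 K l W in \<open>simp_all add: inputs_def\<close>)
  next
    case (10 t s1)
    then show ?case by (simp add: weight_summand power2_eq_square algebra_simps)
  qed (use assms K l W in \<open>simp_all add: inputs_def\<close>)
qed (use K in simp_all)

lemma wp_candidate:
  assumes "inputs s" "ivar s 2 \<le> W"
  shows "wp candidate (\<lambda>t s'. t \<le> 14 * Suc l ^ 2 \<and>
    rvar s' 1 = (if weight (rvar s 4) \<le> ivar s 2 div 4 \<and> rvar s 4 < rvar s 1 then rvar s 4 else rvar s 1)) s"
  unfolding candidate_def
proof (rule wp_Seq, rule wp_cut[OF wp_weigh[OF assms(1)]], goal_cases)
  case (1 t s1)
  have s1: "ivar s1 2 = ivar s 2" "rvar s1 4 = rvar s 4" "rvar s1 1 = rvar s 1"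
    using 1(1) by (simp_all add: unchanged_def)
  have "ivar s1 10 \<le> W" using 1(2) weight_le[of "rvar s 4"] W by simp
  moreover have "Suc (Suc t) \<le> 14 * Suc l ^ 2"
    using 1(2) one_le_power[of "Suc l" 2] by (elim conjE) linarith
  ultimately show ?case
    by (intro wp_Cond wp_RSetVar wp_Skip)
      (use 1(2) s1 assms K W in \<open>auto simp: not_less\<close>)
qed

lemma wp_find_threshold:
  assumes "inputs s" "ivar s 2 \<le> W"
  defines "M \<equiv> ivar s 2 div 4"
  shows "wp find_threshold (\<lambda>t s'. t \<le> 2000 * n \<and> 0 \<le> rvar s' 1 \<and>
    card {(i, j). i \<in> {1..n} \<and> j \<in> {1..n} \<and> rvar s' 1 < X ! (n - i) * Y ! (n - j)} \<le> M \<and>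
    (rvar s' 1 = 0 \<or> M < 4 * card {(i, j). i \<in> {1..n} \<and> j \<in> {1..n} \<and> rvar s' 1 \<le> X ! (n - i) * Y ! (n - j)})) s"
proof -
  \<comment> \<open>\<open>good\<close> collects the requirements of \<open>threshold\<close> that
    hold once the candidate 0 has been tried. Minimality among the corners is what the two loops
    add.\<close>
  define good where "good \<delta> \<longleftrightarrow> weight \<delta> \<le> M \<and> (\<delta> = 0 \<or> (\<exists>p\<le>l. \<exists>q\<le>l. \<delta> = corner p q)) \<and>
    (weight 0 \<le> M \<longrightarrow> \<delta> \<le> 0)" for \<delta>
  have top: "corner p q \<le> corner 0 0" if "p \<le> l" "q \<le> l" for p q
    unfolding corner_def using that pow_le_n by (intro product_mono) auto
  have weight_top: "weight (corner 0 0) = 0"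
    unfolding weight_def using top by (auto simp: not_less)
  show ?thesis
    unfolding find_threshold_def
  proof (intro wp_Seq wp_RSetVar, goal_cases)
    case 5
    show ?case
    proof (rule wp_cut[OF wp_candidate], goal_cases)
      case (3 t0 s0)
      have s0: "inputs s0" "ivar s0 2 = ivar s 2" using 3(1) assms by (simp_all add: unchanged_def inputs_def)
      have r: "rvar s0 1 = (if weight 0 \<le> M \<and> 0 < corner 0 0 then 0 else corner 0 0)"
        using 3(2) assms(1) by (simp add: inputs_def M_def corner_def)
      have "\<exists>p\<le>l. \<exists>q\<le>l. corner 0 0 = corner p q" by blast
      then have good0: "good (rvar s0 1)"
        unfolding r good_def using weight_top by (simp add: not_less)
      have t0: "t0 \<le> 14 * Suc l ^ 2" using 3(2) by (rule conjunct1)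
      show ?case
      proof (rule wp_doubling[where l = l and n = n and \<tau> = "19 * Suc l ^ 3" and
          J = "\<lambda>p s'. good (rvar s' 1) \<and> (\<forall>i<p. \<forall>j<Suc l. weight (corner i j) \<le> M \<longrightarrow> rvar s' 1 \<le> corner i j)"], goal_cases)
        case (9 p s1)
        have s1: "inputs s1" "ivar s1 2 = ivar s 2"
          using 9(3) s0 by (simp_all add: unchanged_def inputs_def)
        show ?case
        proof (rule wp_doubling[where l = l and n = n and \<tau> = "15 * Suc l ^ 2" and
            J = "\<lambda>q s'. good (rvar s' 1) \<and> (\<forall>i<p. \<forall>j<Suc l. weight (corner i j) \<le> M \<longrightarrow> rvar s' 1 \<le> corner i j) \<and>
               (\<forall>j<q. weight (corner p j) \<le> M \<longrightarrow> rvar s' 1 \<le> corner p j)"], goal_cases)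
          case (9 q s2)
          have s2: "inputs s2" "ivar s2 2 = ivar s 2" "ivar s2 13 = 2 ^ p"
            using 9(3) s1 \<open>ivar s1 13 = _\<close> by (simp_all add: unchanged_def inputs_def)
          have pn: "2 ^ p \<le> n" "2 ^ q \<le> n" using pow_le_n 9(1) \<open>p \<le> l\<close> by auto
          then have lt: "n - 2 ^ p < n" "n - 2 ^ q < n" using n_pos by auto
          have nW: "n \<le> W" "2 ^ p \<le> W" "2 ^ q \<le> W" using pn W by linarith+
          show ?case
          proof (intro wp_Seq wp_RSetVar, goal_cases)
            case 3
            show ?case
            proof (rule wp_cut[OF wp_candidate], goal_cases)
              case (3 t s3)
              have r: "rvar s3 1 = (if weight (corner p q) \<le> M \<and> corner p q < rvar s2 1
                  then corner p q else rvar s2 1)" and "t \<le> 14 * Suc l ^ 2"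
                using 3(2) 9(4) s2 by (simp_all add: M_def corner_def inputs_def)
              moreover have v14: "ivar s3 14 = 2 ^ q" using 3(1) 9(4) by (simp add: unchanged_def)
              moreover have "1 \<le> Suc l ^ 2" by simp
              ultimately have time: "1 + t \<le> 15 * Suc l ^ 2" by linarith
              have good: "good (rvar s3 1)" "rvar s3 1 \<le> rvar s2 1"
                "weight (corner p q) \<le> M \<Longrightarrow> rvar s3 1 \<le> corner p q"
                using r 9(1,2) \<open>p \<le> l\<close> unfolding good_def by (auto split: if_splits)
              then have "\<forall>i<p. \<forall>j<Suc l. weight (corner i j) \<le> M \<longrightarrow> rvar s3 1 \<le> corner i j"
                "\<forall>j<q. weight (corner p j) \<le> M \<longrightarrow> rvar s3 1 \<le> corner p j"
                using 9(2) order_trans[OF good(2)] by blast+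
              then show ?case
                using time good v14 by (simp add: less_Suc_eq)
            qed (use s2 assms in simp_all)
          qed (use 9(4) s2 lt nW K len in \<open>simp_all add: inputs_def\<close>)
        next
          case (10 t s2)
          have "2 + Suc l * (15 * Suc l ^ 2 + 2) \<le> 19 * Suc l ^ 3"
            by (simp add: power2_eq_square power3_eq_cube algebra_simps)
          then show ?case using 9 10 by (auto simp: unchanged_def less_Suc_eq)
        qed (use 9 s1 K l W in \<open>simp_all add: inputs_def\<close>)
      next
        case (10 t s1)
        have "2 + Suc l * (19 * Suc l ^ 3 + 2) \<le> 23 * Suc l ^ 4"
          by (simp add: power3_eq_cube power4_eq_xxxx algebra_simps)
        moreover have "Suc l ^ 2 \<le> Suc l ^ 4" by (intro power_increasing) auto
        \<comment> \<open>The costs add up to \<open>(14 + 23) * Suc l ^ 4\<close> and a constant,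
          and \<open>37 * 48 = 1776\<close> leaves room below 2000.\<close>
        moreover have "Suc l ^ 4 \<le> 48 * n" using log_power_le[of l] l(1) by simp
        ultimately have "1 + (1 + (t0 + t)) \<le> 2000 * n"
          using 10(3) t0 n_pos by linarith
        moreover have "\<And>p q. p \<le> l \<Longrightarrow> q \<le> l \<Longrightarrow> weight (corner p q) \<le> M \<Longrightarrow> rvar s1 1 \<le> corner p q"
          using 10(1) by (simp add: less_Suc_eq_le)
        ultimately show ?case
          using threshold[of "rvar s1 1" M] 10(1) unfolding good_def by simp
      qed (use s0 good0 K l W in \<open>simp_all add: inputs_def\<close>)
    qed (use assms in simp_all)
  qed (use assms K W n_pos len in \<open>simp_all add: inputs_def\<close>)
qed

end

section \<open>Sparse matrices\<close>

text \<open>The first \<open>m\<close> entries of three arrays represent the function \<open>f\<close>, in row order.\<close>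

definition table :: "nat \<Rightarrow> nat list \<Rightarrow> nat list \<Rightarrow> real list \<Rightarrow> nat \<Rightarrow> (nat \<times> nat \<Rightarrow> real) \<Rightarrow> bool" where
  "table n rs cs vs m f \<longleftrightarrow>
     m \<le> length rs \<and> m \<le> length cs \<and> m \<le> length vs \<and>
     (\<forall>e<m. rs ! e < n \<and> cs ! e < n \<and> f (rs ! e, cs ! e) = vs ! e) \<and>
     (\<forall>e e'. e < e' \<longrightarrow> e' < m \<longrightarrow> rs ! e \<le> rs ! e' \<and> (rs ! e, cs ! e) \<noteq> (rs ! e', cs ! e')) \<and>
     (\<forall>x. f x \<noteq> 0 \<longrightarrow> (\<exists>e<m. x = (rs ! e, cs ! e)))"

lemma tableD:
  assumes "table n rs cs vs m f"
  shows "e < m \<Longrightarrow> rs ! e < n" "e < m \<Longrightarrow> cs ! e < n" "e < m \<Longrightarrow> f (rs ! e, cs ! e) = vs ! e"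
    "e < e' \<Longrightarrow> e' < m \<Longrightarrow> rs ! e \<le> rs ! e'"
    "e < e' \<Longrightarrow> e' < m \<Longrightarrow> (rs ! e, cs ! e) \<noteq> (rs ! e', cs ! e')"
    "(\<And>e. e < m \<Longrightarrow> x \<noteq> (rs ! e, cs ! e)) \<Longrightarrow> f x = 0"
    "m \<le> length rs" "m \<le> length cs" "m \<le> length vs"
  using assms unfolding table_def by blast+

lemma table_empty: "table n rs cs vs 0 (\<lambda>x. 0)"
  by (simp add: table_def)

lemma table_append:
  assumes t: "table n rs cs vs m f" and m: "m < length rs" "m < length cs" "m < length vs"
    and rc: "r < n" "c < n" and new: "\<And>e. e < m \<Longrightarrow> rs ! e \<le> r \<and> (rs ! e, cs ! e) \<noteq> (r, c)"
  shows "table n (rs[m := r]) (cs[m := c]) (vs[m := v]) (Suc m) (f((r, c) := v))"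
proof -
  have 1: "rs[m := r] ! e < n \<and> cs[m := c] ! e < n \<and>
      (f((r, c) := v)) (rs[m := r] ! e, cs[m := c] ! e) = vs[m := v] ! e" if "e < Suc m" for e
  proof (cases "e = m")
    case False
    then have "e < m" using that by simp
    from tableD(1-3)[OF t this] new[OF this] show ?thesis
      using False by auto
  qed (use m rc in simp)
  have 2: "rs[m := r] ! e \<le> rs[m := r] ! e' \<and> (rs[m := r] ! e, cs[m := c] ! e) \<noteq> (rs[m := r] ! e', cs[m := c] ! e')"
    if "e < e'" "e' < Suc m" for e e'
  proof (cases "e' = m")
    case True
    then have "e < m" using that by simp
    from new[OF this] show ?thesis using True \<open>e < m\<close> m by simp
  next
    case False
    then have "e' < m" using that by simp
    from tableD(4,5)[OF t \<open>e < e'\<close> this] show ?thesis using that \<open>e' < m\<close> by simp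
  qed
  have 3: "\<exists>e<Suc m. x = (rs[m := r] ! e, cs[m := c] ! e)" if "(f((r, c) := v)) x \<noteq> 0" for x
  proof (cases "x = (r, c)")
    case True
    then show ?thesis using m by (intro exI[of _ m]) simp
  next
    case False
    then have "f x \<noteq> 0" using that by simp
    then obtain e where "e < m" "x = (rs ! e, cs ! e)" using tableD(6)[OF t, of x] by blast
    then show ?thesis by (intro exI[of _ e]) simp
  qed
  show ?thesis unfolding table_def using 1 2 3 m by simp
qed

lemma table_update:
  assumes t: "table n rs cs vs m f" and e: "e < m"
  shows "table n rs cs (vs[e := v]) m (f((rs ! e, cs ! e) := v))"
proof -
  have "(rs ! e', cs ! e') \<noteq> (rs ! e, cs ! e)" if "e' < m" "e' \<noteq> e" for e'
    using tableD(5)[OF t, of e' e] tableD(5)[OF t, of e e'] e that by (cases e e' rule: linorder_cases) auto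
  then have "(f((rs ! e, cs ! e) := v)) (rs ! e', cs ! e') = vs[e := v] ! e'" if "e' < m" for e'
    using tableD(1-3)[OF t that] tableD(9)[OF t] e that by (cases "e' = e") auto
  moreover have "\<exists>e<m. x = (rs ! e, cs ! e)" if "(f((rs ! e, cs ! e) := v)) x \<noteq> 0" for x
    using tableD(6)[OF t, of x] that e by (cases "x = (rs ! e, cs ! e)") auto
  ultimately show ?thesis unfolding table_def using tableD[OF t] by simp
qed

text \<open>While row \<open>r\<close> is being built from slot \<open>b\<close> on, \<open>mk ! c\<close> exceeds \<open>b\<close> iff column \<open>c\<close> already has
  an entry, and then it is the successor of its slot.\<close>

definition marks :: "nat \<Rightarrow> nat \<Rightarrow> nat \<Rightarrow> nat \<Rightarrow> nat list \<Rightarrow> nat list \<Rightarrow> nat list \<Rightarrow> bool" where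
  "marks n r b m rs cs mk \<longleftrightarrow> b \<le> m \<and> length mk = n \<and>
     (\<forall>e<b. rs ! e < r) \<and> (\<forall>e. b \<le> e \<longrightarrow> e < m \<longrightarrow> rs ! e = r \<and> mk ! (cs ! e) = Suc e) \<and>
     (\<forall>c<n. mk ! c \<le> m \<and> (b < mk ! c \<longrightarrow> cs ! (mk ! c - 1) = c))"

text \<open>A slot of row \<open>r\<close> with column \<open>c\<close> would have left a mark above
  \<open>b\<close>, so the position is new. By the third conclusion, adding \<open>v\<close> to the
  old value is the same as storing \<open>v\<close>.\<close>

lemma marks_append:
  assumes t: "table n rs cs vs m f" and mk: "marks n r b m rs cs mk"
    and m: "m < length rs" "m < length cs" "m < length vs" and rc: "r < n" "c < n"
    and new: "mk ! c \<le> b"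
  shows "table n (rs[m := r]) (cs[m := c]) (vs[m := v]) (Suc m) (f((r, c) := v))"
    and "marks n r b (Suc m) (rs[m := r]) (cs[m := c]) (mk[c := Suc m])"
    and "f (r, c) = 0"
proof -
  have row: "rs ! e \<le> r \<and> (rs ! e, cs ! e) \<noteq> (r, c)" if "e < m" for e
  proof (cases "e < b")
    case True
    then show ?thesis using mk by (auto simp: marks_def)
  next
    case False
    then have "rs ! e = r" "mk ! (cs ! e) = Suc e" using mk that by (auto simp: marks_def)
    then show ?thesis using new False by auto
  qed
  show "table n (rs[m := r]) (cs[m := c]) (vs[m := v]) (Suc m) (f((r, c) := v))"
    by (rule table_append[OF t m rc row])
  show "f (r, c) = 0" using tableD(6)[OF t, of "(r, c)"] row by metis
  have lmk: "length mk = n" "b \<le> m" using mk by (simp_all add: marks_def)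
  have 1: "rs[m := r] ! e = r \<and> mk[c := Suc m] ! (cs[m := c] ! e) = Suc e" if "b \<le> e" "e < Suc m" for e
  proof (cases "e = m")
    case True
    then show ?thesis using m rc lmk by simp
  next
    case False
    then have "rs ! e = r" "mk ! (cs ! e) = Suc e" "cs ! e \<noteq> c"
      using mk that new by (auto simp: marks_def)
    then show ?thesis using False by simp
  qed
  have 2: "mk[c := Suc m] ! d \<le> Suc m \<and> (b < mk[c := Suc m] ! d \<longrightarrow> cs[m := c] ! (mk[c := Suc m] ! d - 1) = d)"
    if "d < n" for d
  proof (cases "d = c")
    case True
    then show ?thesis using m rc lmk by simp
  next
    case False
    have "mk ! d \<le> m" "b < mk ! d \<longrightarrow> cs ! (mk ! d - 1) = d" using mk that by (auto simp: marks_def)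
    then show ?thesis using False by (auto simp: nth_list_update)
  qed
  have 3: "rs[m := r] ! e < r" if "e < b" for e using mk that lmk(2) by (simp add: marks_def)
  show "marks n r b (Suc m) (rs[m := r]) (cs[m := c]) (mk[c := Suc m])"
    unfolding marks_def using 1 2 3 lmk by simp
qed

lemma marks_update:
  assumes t: "table n rs cs vs m f" and mk: "marks n r b m rs cs mk" and c: "c < n" and old: "b < mk ! c"
  shows "table n rs cs (vs[mk ! c - 1 := v]) m (f((r, c) := v))"
    and "mk ! c - 1 < m" "vs ! (mk ! c - 1) = f (r, c)"
proof -
  let ?e = "mk ! c - 1"
  have e: "b \<le> ?e" "?e < m" "cs ! ?e = c" using mk c old by (auto simp: marks_def)
  then have r: "rs ! ?e = r" using mk by (simp add: marks_def)
  show "table n rs cs (vs[mk ! c - 1 := v]) m (f((r, c) := v))"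
    using table_update[OF t e(2), of v] unfolding e(3) r .
  show "?e < m" by (rule e(2))
  show "vs ! ?e = f (r, c)" using tableD(3)[OF t e(2)] e(3) r by simp
qed

text \<open>All marks are at most \<open>m\<close>, so raising \<open>b\<close> to \<open>m\<close>
  invalidates them at no cost. Clearing them would take time \<open>n\<close> per row.\<close>

lemma marks_next_row:
  assumes "marks n r b m rs cs mk"
  shows "marks n (Suc r) m m rs cs mk"
proof -
  have "rs ! e < Suc r" if "e < m" for e
    using assms that by (cases "e < b") (auto simp: marks_def intro: less_SucI)
  moreover have "mk ! c \<le> m" if "c < n" for c using assms that by (simp add: marks_def)
  ultimately show ?thesis using assms by (simp add: marks_def not_less[symmetric])
qed

section \<open>Adding an outer product to the summary\<close>

text \<open>Scalars 10 and 19 are the row and the column, real scalar 5 is the value, and scalar 17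
  is the first slot of the current row.\<close>

definition add_entry :: com where
  "add_entry =
     Cond (BILess (IVar 17) (IGet 6 (IVar 19)))
       (RSet 2 (ISub (IGet 6 (IVar 19)) (INum 1))
          (RAdd (RGet 2 (ISub (IGet 6 (IVar 19)) (INum 1))) (RVar 5)))
       (ISet 4 (IVar 4) (IVar 10) ;; ISet 5 (IVar 4) (IVar 19) ;; RSet 2 (IVar 4) (RVar 5) ;;
        ISetVar 4 (IAdd (IVar 4) (INum 1)) ;; ISet 6 (IVar 19) (IVar 4))"

text \<open>Scalar 16 walks once through the old summary, which is in row order. Scalar 18 scans the
  sorted row of \<open>B\<close> from its largest element down and stops at the first product not
  above the threshold. So a row costs a constant plus the number of entries handled.\<close>

definition combine :: com where
  "combine =
     INew 6 (IVar 0) ;; ISetVar 4 (INum 0) ;; ISetVar 16 (INum 0) ;;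
     for_upto 10 (IVar 0)
       (ISetVar 17 (IVar 4) ;;
        While (BAnd (BILess (IVar 16) (IVar 3)) (BILess (IGet 2 (IVar 16)) (IAdd (IVar 10) (INum 1))))
          (ISetVar 19 (IGet 3 (IVar 16)) ;; RSetVar 5 (RGet 1 (IVar 16)) ;; add_entry ;;
           ISetVar 16 (IAdd (IVar 16) (INum 1))) ;;
        ISetVar 18 (IVar 0) ;;
        While (BAnd (BILess (INum 0) (IVar 18))
            (BRLess (RVar 1) (RMul (RGet 3 (IVar 10)) (RGet 5 (ISub (IVar 18) (INum 1))))))
          (ISetVar 18 (ISub (IVar 18) (INum 1)) ;; ISetVar 19 (IGet 7 (IVar 18)) ;;
           RSetVar 5 (RSub (RMul (RGet 3 (IVar 10)) (RGet 5 (IVar 18))) (RVar 1)) ;; add_entry))"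

lemma targets_add_entry [simp]:
  "targets add_entry = {RArray 2, IArray 4, IArray 5, IArray 6, IScalar 4}"
  by (auto simp: add_entry_def)

lemma targets_combine [simp]:
  "targets combine = {RArray 2, IArray 4, IArray 5, IArray 6, ILength 6, IScalar 4, IScalar 10,
     IScalar 16, IScalar 17, IScalar 18, IScalar 19, RScalar 5}"
  by (auto simp: combine_def)

definition building :: "nat \<Rightarrow> nat \<Rightarrow> nat \<Rightarrow> (nat \<times> nat \<Rightarrow> real) \<Rightarrow> state \<Rightarrow> bool" where
  "building n r b f s \<longleftrightarrow> table n (iarr s 4) (iarr s 5) (rarr s 2) (ivar s 4) f \<and>
     marks n r b (ivar s 4) (iarr s 4) (iarr s 5) (iarr s 6)"

lemma building_upd [simp]:
  "h 4 = ivar s 4 \<Longrightarrow> building n r b f (s\<lparr>ivar := h\<rparr>) = building n r b f s"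
  "building n r b f (s\<lparr>rvar := g\<rparr>) = building n r b f s"
  by (simp_all add: building_def)

context machine
begin

lemma wp_add_entry:
  assumes K: "50 < K" and W: "N + 2 \<le> W" "n + 2 \<le> W"
    and b: "building n r b f s" "ivar s 17 = b" "ivar s 10 = r" "ivar s 19 = c" "r < n" "c < n"
    and len: "length (iarr s 4) = N" "length (iarr s 5) = N" "length (rarr s 2) = N" "ivar s 4 < N"
  shows "wp add_entry (\<lambda>t s'. t \<le> 6 \<and> ivar s' 4 \<le> Suc (ivar s 4) \<and>
    building n r b (f((r, c) := f (r, c) + rvar s 5)) s') s"
proof -
  have t: "table n (iarr s 4) (iarr s 5) (rarr s 2) (ivar s 4) f"
    and mk: "marks n r b (ivar s 4) (iarr s 4) (iarr s 5) (iarr s 6)"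
    using b by (simp_all add: building_def)
  have lmk: "length (iarr s 6) = n" "iarr s 6 ! c \<le> ivar s 4" "b \<le> ivar s 4"
    using mk b by (simp_all add: marks_def)
  show ?thesis
  proof (cases "b < iarr s 6 ! c")
    case True
    note u = marks_update[OF t mk \<open>c < n\<close> True]
    show ?thesis unfolding add_entry_def
      by (intro wp_Cond wp_RSet wp_Seq wp_ISet wp_ISetVar)
        (use True u(1)[of "f (r, c) + rvar s 5"] u(2,3) mk b len lmk W K in \<open>simp_all add: building_def\<close>)
  next
    case False
    then have new: "iarr s 6 ! c \<le> b" by simp
    note a = marks_append[OF t mk _ _ _ \<open>r < n\<close> \<open>c < n\<close> new]
    show ?thesis unfolding add_entry_def
      by (intro wp_Cond wp_RSet wp_Seq wp_ISet wp_ISetVar)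
        (use False a(1)[of "rvar s 5"] a(2,3) b len lmk W K in \<open>simp_all add: building_def\<close>)
  qed
qed

end

text \<open>Turns a loop test that stays false once it has failed into a comparison with a fixed
  number of iterations, as \<open>wp_While_index\<close> demands.\<close>

lemma initial_segment:
  assumes down: "\<And>e e'. e < e' \<Longrightarrow> e' < m \<Longrightarrow> P e' \<Longrightarrow> P e" and e: "e < m"
  shows "P e \<longleftrightarrow> e < card {e. e < m \<and> P e}"
proof
  assume "P e"
  then have "{..e} \<subseteq> {e. e < m \<and> P e}" using down[OF _ e] e by (auto simp: le_less)
  from card_mono[OF _ this] show "e < card {e. e < m \<and> P e}" by simp
next
  assume lt: "e < card {e. e < m \<and> P e}"
  show "P e"
  proof (rule ccontr)
    assume "\<not> P e"
    then have "e' < e" if "e' < m" "P e'" for e'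
      using down[of e e'] that by (cases e' e rule: linorder_cases) auto
    then have "{e. e < m \<and> P e} \<subseteq> {..<e}" by auto
    from card_mono[OF _ this] show False using lt by simp
  qed
qed

text \<open>The assumption \<open>cap\<close> counts old and new entries separately even where they
  share a position, so the new summary cannot overflow.\<close>

locale combine_input = machine W K L for W K L :: nat +
  fixes n N cnt :: nat and tr tc PY :: "nat list" and tv xs Y :: "real list"
    and tf :: "nat \<times> nat \<Rightarrow> real" and \<delta> :: real
  assumes K: "50 < K" and W: "N + 2 \<le> W" "n + 2 \<le> W" and L: "n \<le> L"
    and T: "table n tr tc tv cnt tf"
    and xs: "length xs = n" "\<And>i. i < n \<Longrightarrow> 0 \<le> xs ! i"
    and Y: "length Y = n" "sorted Y" and PY: "length PY = n" "set PY = {..<n}"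
    and cap: "cnt + (\<Sum>r<n. card {u. u < n \<and> \<delta> < xs ! r * Y ! (n - Suc u)}) \<le> N"
begin

definition inputs :: "state \<Rightarrow> bool" where
  "inputs s \<longleftrightarrow> ivar s 0 = n \<and> ivar s 3 = cnt \<and> iarr s 2 = tr \<and> iarr s 3 = tc \<and> iarr s 7 = PY \<and>
     rarr s 1 = tv \<and> rarr s 3 = xs \<and> rarr s 5 = Y \<and> rvar s 1 = \<delta> \<and>
     length (iarr s 4) = N \<and> length (iarr s 5) = N \<and> length (rarr s 2) = N"

definition pushes :: "nat \<Rightarrow> nat" where
  "pushes r = card {u. u < n \<and> \<delta> < xs ! r * Y ! (n - Suc u)}"

definition start :: "nat \<Rightarrow> nat" where
  "start r = card {e. e < cnt \<and> tr ! e < r}"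

text \<open>The pushing loop descends through the sorted row; \<open>j\<close> is the position it
  has reached, and the terms from \<open>j\<close> on have been added.\<close>

definition increment :: "nat \<Rightarrow> nat \<Rightarrow> nat \<Rightarrow> real" where
  "increment j r c = (\<Sum>i\<in>{j..<n}. if PY ! i = c \<and> \<delta> < xs ! r * Y ! i then xs ! r * Y ! i - \<delta> else 0)"

text \<open>The new summary in the middle of row \<open>r\<close>: earlier rows are complete,
  \<open>h\<close> is the current one, later rows are empty.\<close>

definition built :: "nat \<Rightarrow> (nat \<Rightarrow> real) \<Rightarrow> nat \<times> nat \<Rightarrow> real" where
  "built r h = (\<lambda>(i, c). if i < r then tf (i, c) + increment 0 i c else if i = r then h c else 0)"

lemma built_upd: "(built r h)((r, c) := v) = built r (h(c := v))"
  by (auto simp: built_def fun_eq_iff)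

lemma built_nth [simp]: "built r h (r, c) = h c"
  by (simp add: built_def)

lemma built_Suc: "built (Suc r) (\<lambda>c. 0) = built r (\<lambda>c. tf (r, c) + increment 0 r c)"
  by (auto simp: built_def fun_eq_iff less_Suc_eq)

lemma start_iff: "e < cnt \<Longrightarrow> tr ! e < r \<longleftrightarrow> e < start r"
  unfolding start_def using tableD(4)[OF T] by (intro initial_segment) (auto intro: le_less_trans)

lemma start_le: "start r \<le> cnt"
  unfolding start_def using card_mono[of "{..<cnt}" "{e. e < cnt \<and> tr ! e < r}"] by auto

lemma start_mono: "start r \<le> start (Suc r)"
  unfolding start_def by (intro card_mono) auto

lemma pushes_iff: "r < n \<Longrightarrow> u < n \<Longrightarrow> \<delta> < xs ! r * Y ! (n - Suc u) \<longleftrightarrow> u < pushes r"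
  unfolding pushes_def
proof (rule initial_segment)
  fix e e' assume r: "r < n" and e: "e < e'" "e' < n" and gt: "\<delta> < xs ! r * Y ! (n - Suc e')"
  have "Y ! (n - Suc e') \<le> Y ! (n - Suc e)" using Y e by (intro sorted_nth_mono) auto
  then have "xs ! r * Y ! (n - Suc e') \<le> xs ! r * Y ! (n - Suc e)" using xs(2)[OF r] by (rule mult_left_mono)
  then show "\<delta> < xs ! r * Y ! (n - Suc e)" using gt by linarith
qed

lemma pushes_le: "pushes r \<le> n"
  unfolding pushes_def using card_mono[of "{..<n}" "{u. u < n \<and> \<delta> < xs ! r * Y ! (n - Suc u)}"] by auto

definition copied :: "nat \<Rightarrow> nat \<Rightarrow> nat \<Rightarrow> real" where
  "copied e r c = (if \<exists>e'<e. tr ! e' = r \<and> tc ! e' = c then tf (r, c) else 0)"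

lemma copied_start: "copied (start r) r = (\<lambda>c. 0)"
proof -
  have "\<not> (e < start r \<and> tr ! e = r \<and> tc ! e = c)" for e c
    using start_iff[of e r] start_le[of r] by auto
  then show ?thesis unfolding copied_def by (simp add: fun_eq_iff) metis
qed

text \<open>The positions in the old summary are distinct, so this column is still 0 and adding
  amounts to copying.\<close>

lemma copied_Suc:
  assumes "e < cnt" "tr ! e = r"
  shows "(copied e r)(tc ! e := copied e r (tc ! e) + tv ! e) = copied (Suc e) r"
proof -
  have "copied e r (tc ! e) = 0"
    using tableD(5)[OF T _ assms(1)] assms(2) unfolding copied_def by auto
  then show ?thesis
    using tableD(3)[OF T assms(1)] assms(2) by (auto simp: copied_def fun_eq_iff less_Suc_eq)
qed

lemma copied_end: "copied (start (Suc r)) r c = tf (r, c)"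
proof (cases "\<exists>e<cnt. tr ! e = r \<and> tc ! e = c")
  case True
  then obtain e where e: "e < cnt" "tr ! e = r" "tc ! e = c" by blast
  then have "e < start (Suc r)" using start_iff[of e "Suc r"] by simp
  then show ?thesis using e unfolding copied_def by auto
next
  case False
  then have "tf (r, c) = 0" using tableD(6)[OF T, of "(r, c)"] by fastforce
  then show ?thesis by (simp add: copied_def)
qed

lemma increment_step:
  assumes "j < n" "\<delta> < xs ! r * Y ! j"
  shows "(\<lambda>c. a c + increment (Suc j) r c)(PY ! j := a (PY ! j) + increment (Suc j) r (PY ! j) + (xs ! r * Y ! j - \<delta>)) =
    (\<lambda>c. a c + increment j r c)"
  using assms by (auto simp: fun_eq_iff increment_def sum.atLeast_Suc_lessThan)

text \<open>The positions that the descending loop never visits have products not above the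
  threshold and contribute nothing.\<close>

lemma increment_all:
  assumes "r < n"
  shows "increment (n - pushes r) r c = increment 0 r c"
proof -
  have "\<not> \<delta> < xs ! r * Y ! i" if "i < n - pushes r" for i
    using pushes_iff[OF assms, of "n - Suc i"] that by (simp add: Suc_diff_Suc)
  then show ?thesis unfolding increment_def
    by (intro sum.mono_neutral_left) auto
qed

lemma increment_n [simp]: "increment n r c = 0"
  by (simp add: increment_def)

lemma wp_copy_row:
  assumes r: "r < n" and s: "inputs s" "ivar s 10 = r" "ivar s 17 = b" "ivar s 16 = start r"
    and b: "building n r b (built r (\<lambda>c. 0)) s" and m: "ivar s 4 \<le> start r + p" "cnt + p \<le> N"
  shows "wp (While (BAnd (BILess (IVar 16) (IVar 3)) (BILess (IGet 2 (IVar 16)) (IAdd (IVar 10) (INum 1))))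
          (ISetVar 19 (IGet 3 (IVar 16)) ;; RSetVar 5 (RGet 1 (IVar 16)) ;; add_entry ;;
           ISetVar 16 (IAdd (IVar 16) (INum 1))))
    (\<lambda>t s'. t \<le> 1 + 10 * (start (Suc r) - start r) \<and> building n r b (built r (\<lambda>c. tf (r, c))) s' \<and>
       ivar s' 16 = start (Suc r) \<and> ivar s' 4 \<le> start (Suc r) + p) s"
proof (rule wp_While_index[where M = "start (Suc r) - start r" and \<tau> = "\<lambda>_. 9" and
    J = "\<lambda>u s'. building n r b (built r (copied (start r + u) r)) s' \<and> ivar s' 16 = start r + u \<and>
      ivar s' 4 \<le> start r + u + p"], goal_cases)
  case 1
  then show ?case using s b m by (simp add: copied_start)
next
  case (2 u s')
  have s': "ivar s' 3 = cnt" "ivar s' 10 = r" "iarr s' 2 = tr"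
    using 2(3) s by (simp_all add: unchanged_def inputs_def)
  have le: "start r + u \<le> cnt" using 2(1) start_le[of "Suc r"] start_mono[of r] by linarith
  have len: "cnt \<le> length tr" using tableD(7)[OF T] .
  have trn: "start r + u < cnt \<Longrightarrow> tr ! (start r + u) < n" using tableD(1)[OF T] .
  have iff: "start r + u < cnt \<and> tr ! (start r + u) < Suc r \<longleftrightarrow> u < start (Suc r) - start r"
    using start_iff[of "start r + u" "Suc r"] start_le[of "Suc r"] by auto
  have W': "start r + u \<le> W" "cnt \<le> W" "Suc r \<le> W" using le cap W r by linarith+
  have trW: "start r + u < cnt \<Longrightarrow> tr ! (start r + u) \<le> W" using trn W by simp
  show ?case using s' le len trW iff 2(2) W' by simp
next
  case (3 u s')
  let ?e = "start r + u"
  have e: "?e < cnt" "tr ! ?e < Suc r" "\<not> tr ! ?e < r"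
    using 3(1) start_le[of "Suc r"] start_iff[of ?e "Suc r"] start_iff[of ?e r] by auto
  have s': "inputs s'" "ivar s' 10 = r" "ivar s' 17 = b"
    using 3(3) s by (simp_all add: unchanged_def inputs_def)
  have len: "?e < length tc" "?e < length tv" "tc ! ?e < n" "tr ! ?e = r"
    using tableD(2,8,9)[OF T] e by auto
  have W': "?e + 2 \<le> W" "tc ! ?e \<le> W" using e W cap len by linarith+
  show ?case
  proof (intro wp_Seq wp_ISetVar wp_RSetVar, goal_cases)
    case 5
    show ?case
    proof (rule wp_cut[OF wp_add_entry[OF K W, where r = r and b = b and c = "tc ! ?e" and f = "built r (copied ?e r)"]], goal_cases)
      case (11 t s'')
      have "ivar s'' 16 = ?e" using 11(1) 3(2) by (simp add: unchanged_def)
      moreover have "building n r b (built r (copied (Suc ?e) r)) s''"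
        using 11(2) s' 3(2) copied_Suc[OF e(1) len(4)] by (simp add: inputs_def built_upd)
      ultimately show ?case
        by (intro wp_ISetVar) (use 11(2) 3(2) K W' in simp_all)
    qed (use 3(2) s' len r m(2) e in \<open>simp_all add: inputs_def\<close>)
  qed (use 3(2) s' len W' K in \<open>simp_all add: inputs_def\<close>)
next
  case (4 t s')
  have "start r + (start (Suc r) - start r) = start (Suc r)" using start_mono[of r] by simp
  moreover have "copied (start (Suc r)) r = (\<lambda>c. tf (r, c))" by (simp add: fun_eq_iff copied_end)
  ultimately show ?case using 4 by simp
qed

lemma wp_push_row:
  assumes r: "r < n" and s: "inputs s" "ivar s 10 = r" "ivar s 17 = b" "ivar s 18 = n"
    and b: "building n r b (built r (\<lambda>c. tf (r, c))) s" and m: "ivar s 4 \<le> q" "q + pushes r \<le> N"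
  shows "wp (While (BAnd (BILess (INum 0) (IVar 18))
            (BRLess (RVar 1) (RMul (RGet 3 (IVar 10)) (RGet 5 (ISub (IVar 18) (INum 1))))))
          (ISetVar 18 (ISub (IVar 18) (INum 1)) ;; ISetVar 19 (IGet 7 (IVar 18)) ;;
           RSetVar 5 (RSub (RMul (RGet 3 (IVar 10)) (RGet 5 (IVar 18))) (RVar 1)) ;; add_entry))
    (\<lambda>t s'. t \<le> 1 + 10 * pushes r \<and> building n r b (built (Suc r) (\<lambda>c. 0)) s' \<and>
       ivar s' 4 \<le> q + pushes r) s"
proof (rule wp_While_index[where M = "pushes r" and \<tau> = "\<lambda>_. 9" and
    J = "\<lambda>u s'. building n r b (built r (\<lambda>c. tf (r, c) + increment (n - u) r c)) s' \<and> ivar s' 18 = n - u \<and>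
      ivar s' 4 \<le> q + u"], goal_cases)
  case 1
  then show ?case using s b m by simp
next
  case (2 u s')
  have s': "inputs s'" "ivar s' 10 = r"
    using 2(3) s by (simp_all add: unchanged_def inputs_def)
  have "u \<le> n" using 2(1) pushes_le[of r] by simp
  moreover have "0 < n - u \<and> \<delta> < xs ! r * Y ! (n - Suc u) \<longleftrightarrow> u < pushes r"
    using pushes_iff[OF r, of u] pushes_le[of r] by auto
  ultimately show ?case using s' 2(2) W r xs(1) Y(1) by (auto simp: inputs_def)
next
  case (3 u s')
  let ?j = "n - Suc u"
  have u: "u < n" "Suc ?j = n - u" using 3(1) pushes_le[of r] by auto
  then have gt: "\<delta> < xs ! r * Y ! ?j" using pushes_iff[OF r u(1)] 3(1) by simp
  have s': "inputs s'" "ivar s' 10 = r" "ivar s' 17 = b"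
    using 3(3) s by (simp_all add: unchanged_def inputs_def)
  have j: "?j < n" "PY ! ?j < n" using r PY nth_mem[of ?j PY] by auto
  show ?case
  proof (intro wp_Seq wp_ISetVar wp_RSetVar, goal_cases)
    case 7
    show ?case
    proof (rule wp_cut[OF wp_add_entry[OF K W, where r = r and b = b and c = "PY ! ?j" and
          f = "built r (\<lambda>c. tf (r, c) + increment (n - u) r c)"]], goal_cases)
      case (11 t s'')
      have "ivar s'' 18 = ?j" using 11(1) 3(2) by (simp add: unchanged_def)
      moreover have "building n r b (built r (\<lambda>c. tf (r, c) + increment ?j r c)) s''"
        using 11(2) s' 3(2) increment_step[OF j(1) gt, of "\<lambda>c. tf (r, c)"] u(2)
        by (simp add: inputs_def built_upd add.assoc)
      ultimately show ?case using 11(2) 3(2) by simp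
    qed (use 3(1,2) s' j r m(2) in \<open>simp_all add: inputs_def\<close>)
  qed (use 3(2) s' j W K r xs(1) Y(1) PY(1) in \<open>simp_all add: inputs_def\<close>)
next
  case (4 t s')
  then show ?case by (simp add: built_Suc increment_all[OF r, abs_def] increment_all[OF r])
qed

lemma sum_natural_diff:
  fixes f :: "nat \<Rightarrow> nat"
  assumes "\<And>r. f r \<le> f (Suc r)"
  shows "(\<Sum>r<m. f (Suc r) - f r) = f m - f 0"
proof (induction m)
  case (Suc m)
  have "f 0 \<le> f m" using assms by (rule lift_Suc_mono_le) simp
  then show ?case using Suc assms[of m] by simp
qed simp

lemma wp_combine:
  assumes s: "inputs s"
  shows "wp combine (\<lambda>t s'. t \<le> 10 * n + 10 * N + 10 \<and> ivar s' 4 \<le> N \<and>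
    table n (iarr s' 4) (iarr s' 5) (rarr s' 2) (ivar s' 4)
      (\<lambda>(i, c). if i < n then tf (i, c) + increment 0 i c else 0)) s"
  unfolding combine_def
proof (intro wp_Seq wp_INew wp_ISetVar, goal_cases)
  case 8
  show ?case
  proof (rule wp_for_upto[where M = n and \<tau> = "\<lambda>r. 4 + 10 * (start (Suc r) - start r) + 10 * pushes r" and
      J = "\<lambda>r s'. building n r (ivar s' 4) (built r (\<lambda>c. 0)) s' \<and> ivar s' 16 = start r \<and>
        ivar s' 4 \<le> start r + (\<Sum>i<r. pushes i)"], goal_cases)
    case (3 s')
    have "building n 0 0 (built 0 (\<lambda>c. 0)) s'"
      using 3 s table_empty by (simp add: building_def marks_def inputs_def built_def table_def)
    then show ?case using 3 by (simp add: start_def)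
  next
    case (4 r s')
    then show ?case using s W by (simp add: unchanged_def inputs_def)
  next
    case (5 r s')
    have s': "inputs s'" using 5(3) s by (simp add: unchanged_def inputs_def)
    have "(\<Sum>i<Suc r. pushes i) \<le> (\<Sum>i<n. pushes i)"
      using 5(1) by (intro sum_mono2) auto
    then have cap': "cnt + (\<Sum>i<r. pushes i) + pushes r \<le> N"
      using cap by (simp add: pushes_def)
    have sr: "start r \<le> cnt" "start (Suc r) \<le> cnt" by (rule start_le)+
    show ?case
    proof (rule wp_Seq, rule wp_ISetVar, goal_cases)
      case 3
      show ?case
      proof (rule wp_Seq, rule wp_cut[OF wp_copy_row[OF 5(1), where b = "ivar s' 4" and p = "\<Sum>i<r. pushes i"]], goal_cases)
        case (8 t1 s1)
        note t1 = 8(2)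
        have s1: "inputs s1" "ivar s1 10 = r" "ivar s1 17 = ivar s' 4"
          using 8(1) s' 5(4) by (simp_all add: unchanged_def inputs_def)
        show ?case
        proof (rule wp_Seq, rule wp_ISetVar, goal_cases)
          case 3
          show ?case
          proof (rule wp_cut[OF wp_push_row[OF 5(1), where b = "ivar s' 4" and q = "start (Suc r) + (\<Sum>i<r. pushes i)"]], goal_cases)
            case (8 t2 s2)
            have "ivar s2 10 = r" "ivar s2 16 = start (Suc r)" using 8(1) s1(2) t1 by (simp_all add: unchanged_def)
            moreover have "building n (Suc r) (ivar s2 4) (built (Suc r) (\<lambda>c. 0)) s2"
              using 8(2) marks_next_row[of n r "ivar s' 4" "ivar s2 4" "iarr s2 4" "iarr s2 5" "iarr s2 6"]
              by (simp add: building_def)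
            ultimately show ?case using 8(2) t1 by simp
          qed (use s1 8 cap' sr in \<open>simp_all add: inputs_def\<close>)
        qed (use s1 W K in \<open>simp_all add: inputs_def\<close>)
      qed (use s' 5 cap' in \<open>simp_all add: inputs_def\<close>)
    qed (use s' 5 cap' sr W K in \<open>simp_all add: inputs_def\<close>)
  next
    case (6 t s')
    \<comment> \<open>Over all rows each old entry is copied once, so the copying costs telescope to
      at most \<open>cnt\<close>.\<close>
    have tele: "(\<Sum>r<m. start (Suc r) - start r) = start m - start 0" for m
      using start_mono by (intro sum_natural_diff)
    have "(\<Sum>r<n. 4 + 10 * (start (Suc r) - start r) + 10 * pushes r + 2) =
        6 * n + 10 * (\<Sum>r<n. start (Suc r) - start r) + 10 * (\<Sum>r<n. pushes r)"
      by (simp add: sum.distrib sum_distrib_left)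
    moreover have "(\<Sum>r<n. start (Suc r) - start r) \<le> cnt" using start_le[of n] unfolding tele by simp
    moreover have cap': "cnt + (\<Sum>r<n. pushes r) \<le> N" using cap by (simp add: pushes_def)
    ultimately have "1 + n + (1 + (1 + t)) \<le> 10 * n + 10 * N + 10" using 6(4) by linarith
    moreover have "ivar s' 4 \<le> N" using 6(1) cap' start_le[of n] by linarith
    moreover have "built n (\<lambda>c. 0) = (\<lambda>(i, c). if i < n then tf (i, c) + increment 0 i c else 0)"
      by (auto simp: built_def fun_eq_iff)
    ultimately show ?case using 6(1) s by (simp add: building_def inputs_def)
  qed (use K W in simp_all)
qed (use s W L K in \<open>simp_all add: inputs_def\<close>)

end

section \<open>Pruning the summary\<close>

text \<open>The selection needs exactly \<open>4 ^ a\<close> values, so the list is padded with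
  zeros. The final scan keeps the order of the entries and hence the row order.\<close>

definition prune :: com where
  "prune =
     for_upto 10 (IVar 2) (Cond (BILess (IVar 10) (IVar 4))
       (RSet 6 (IVar 10) (RGet 2 (IVar 10))) (RSet 6 (IVar 10) (RNat (INum 0)))) ;;
     select ;; ISetVar 3 (INum 0) ;;
     for_upto 10 (IVar 4) (Cond (BRLess (RVar 2) (RGet 2 (IVar 10)))
       (ISet 2 (IVar 3) (IGet 4 (IVar 10)) ;; ISet 3 (IVar 3) (IGet 5 (IVar 10)) ;;
        RSet 1 (IVar 3) (RSub (RGet 2 (IVar 10)) (RVar 2)) ;; ISetVar 3 (IAdd (IVar 3) (INum 1)))
       Skip)"

lemma targets_select [simp]:
  "targets select = {RArray 6, RArray 7, IScalar 8, IScalar 9, IScalar 10, IScalar 11, IScalar 12,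
     IScalar 13, IScalar 14, IScalar 15, RScalar 2}"
  by (auto simp: select_def)

lemma targets_prune [simp]:
  "targets prune = {IArray 2, IArray 3, RArray 1, RArray 6, RArray 7, IScalar 3, IScalar 8, IScalar 9,
     IScalar 10, IScalar 11, IScalar 12, IScalar 13, IScalar 14, IScalar 15, RScalar 2}"
  by (auto simp: prune_def)

definition kept :: "(nat \<times> nat \<Rightarrow> real) \<Rightarrow> nat list \<Rightarrow> nat list \<Rightarrow> real \<Rightarrow> nat \<Rightarrow> nat \<times> nat \<Rightarrow> real" where
  "kept f rs cs \<delta> i x = (if \<exists>e<i. x = (rs ! e, cs ! e) then max 0 (f x - \<delta>) else 0)"

lemma kept_Suc:
  assumes "table n rs cs vs m f" "i < m"
  shows "\<delta> < vs ! i \<Longrightarrow> (kept f rs cs \<delta> i)((rs ! i, cs ! i) := vs ! i - \<delta>) = kept f rs cs \<delta> (Suc i)"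
    and "\<not> \<delta> < vs ! i \<Longrightarrow> kept f rs cs \<delta> i = kept f rs cs \<delta> (Suc i)"
  using tableD(3)[OF assms] by (auto simp: kept_def fun_eq_iff less_Suc_eq)

lemma kept_all:
  assumes "table n rs cs vs m f" "0 \<le> \<delta>"
  shows "kept f rs cs \<delta> m = (\<lambda>x. max 0 (f x - \<delta>))"
proof
  fix x
  show "kept f rs cs \<delta> m x = max 0 (f x - \<delta>)"
    using tableD(6)[OF assms(1), of x] assms(2) by (cases "\<exists>e<m. x = (rs ! e, cs ! e)") (auto simp: kept_def)
qed

lemma card_Suc_filter:
  "card {e. e < Suc i \<and> P e} = card {e. e < i \<and> P e} + (if P i then 1 else 0)"
proof -
  have "{e. e < Suc i \<and> P e} = (if P i then insert i {e. e < i \<and> P e} else {e. e < i \<and> P e})"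
    by (auto simp: less_Suc_eq)
  then show ?thesis by simp
qed

context machine
begin

lemma wp_prune:
  fixes s :: state and N n m a :: nat
  defines "rs \<equiv> iarr s 4" and "cs \<equiv> iarr s 5" and "vs \<equiv> rarr s 2"
  assumes K: "50 < K" and W: "2 * N + 2 < W" "n \<le> W" and N: "N = 4 ^ a" "2 \<le> a"
    and s: "ivar s 2 = N" "ivar s 4 = m" "m \<le> N"
    and t: "table n rs cs vs m f" and f: "\<And>x. 0 \<le> f x"
    and len: "length rs = N" "length cs = N" "length vs = N" "length (iarr s 2) = N"
      "length (iarr s 3) = N" "length (rarr s 1) = N" "length (rarr s 6) = N" "length (rarr s 7) = N"
  shows "wp prune (\<lambda>t s'. t \<le> 120 * N + 20 \<and> 0 \<le> rvar s' 2 \<and> 4 * ivar s' 3 \<le> 3 * N \<and>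
    table n (iarr s' 2) (iarr s' 3) (rarr s' 1) (ivar s' 3) (\<lambda>x. max 0 (f x - rvar s' 2)) \<and>
    (rvar s' 2 = 0 \<or> N \<le> 4 * card {x \<in> {..<n} \<times> {..<n}. rvar s' 2 \<le> f x})) s"
  unfolding prune_def
proof (rule wp_Seq, rule wp_for_upto[where M = N and \<tau> = "\<lambda>_. 2" and
      J = "\<lambda>i s'. \<forall>e<i. rarr s' 6 ! e = (if e < m then vs ! e else 0)"], goal_cases)
  case (3 s')
  then show ?case by simp
next
  case (4 i s')
  then show ?case using s W by (simp add: unchanged_def)
next
  case (5 i s')
  have s': "ivar s' 4 = m" "rarr s' 2 = vs" "length (rarr s' 6) = N"
    using 5(3) s len by (simp_all add: unchanged_def vs_def)
  then show ?case
    by (intro wp_Cond wp_RSet) (use 5 s W len in \<open>auto simp: less_Suc_eq\<close>)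
next
  case (6 t1 s1)
  let ?zs = "rarr s1 6"
  have s1: "ivar s1 2 = N" "ivar s1 4 = m" "iarr s1 4 = rs" "iarr s1 5 = cs" "rarr s1 2 = vs"
    "length (iarr s1 2) = N" "length (iarr s1 3) = N" "length (rarr s1 1) = N"
    "length ?zs = N" "length (rarr s1 7) = N"
    using 6(2) s len by (simp_all add: unchanged_def rs_def cs_def vs_def)
  have vs_nonneg: "0 \<le> vs ! e" if "e < m" for e using f tableD(3)[OF t that] by metis
  have zs: "?zs ! e = (if e < m then vs ! e else 0)" if "e < N" for e using 6(1) that by simp
  show ?case
  proof (rule wp_Seq, rule wp_cut[OF wp_select[where a = a]], goal_cases)
    case (7 t2 s2)
    define \<delta> where "\<delta> = rvar s2 2"
    have s2: "ivar s2 2 = N" "ivar s2 4 = m" "iarr s2 4 = rs" "iarr s2 5 = cs" "rarr s2 2 = vs"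
      "length (iarr s2 2) = N" "length (iarr s2 3) = N" "length (rarr s2 1) = N"
      using 7(1) s1 by (simp_all add: unchanged_def)
    have gt: "4 * card {e. e < N \<and> \<delta> < ?zs ! e} \<le> 3 * N"
      and ge: "N \<le> 4 * card {e. e < N \<and> \<delta> \<le> ?zs ! e}" and t2: "t2 \<le> 100 * N"
      using 7(2) s1(9) N by (simp_all add: length_filter_conv_card \<delta>_def)
    have N0: "0 < N" using N by simp
    \<comment> \<open>A negative threshold would be exceeded by all \<open>N\<close> values, padding
      included, but at most three quarters of them exceed it.\<close>
    have \<delta>: "0 \<le> \<delta>"
    proof (rule ccontr)
      assume "\<not> 0 \<le> \<delta>"
      then have "\<delta> < ?zs ! e" if "e < N" for e
        using zs[OF that] vs_nonneg[of e] by (cases "e < m") auto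
      then have "{e. e < N \<and> \<delta> < ?zs ! e} = {..<N}" by auto
      then show False using gt N0 by simp
    qed
    have "{e. e < m \<and> \<delta> < vs ! e} \<subseteq> {e. e < N \<and> \<delta> < ?zs ! e}" using zs s(3) by auto
    from card_mono[OF _ this] have kept_le: "4 * card {e. e < m \<and> \<delta> < vs ! e} \<le> 3 * N" using gt by simp
    have ge': "\<delta> = 0 \<or> N \<le> 4 * card {x \<in> {..<n} \<times> {..<n}. \<delta> \<le> f x}"
    proof (cases "\<delta> = 0")
      case False
      let ?E = "{e. e < N \<and> \<delta> \<le> ?zs ! e}"
      \<comment> \<open>A positive threshold excludes the padding, so only genuine entries are
        counted.\<close>
      have E: "e < m \<and> \<delta> \<le> vs ! e" if "e \<in> ?E" for e
        using that zs[of e] \<delta> False by (auto split: if_splits)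
      have "card ?E \<le> card {x \<in> {..<n} \<times> {..<n}. \<delta> \<le> f x}"
      proof (rule card_inj_on_le)
        show "inj_on (\<lambda>e. (rs ! e, cs ! e)) ?E"
        proof (rule inj_onI)
          fix e e' assume "e \<in> ?E" "e' \<in> ?E" "(rs ! e, cs ! e) = (rs ! e', cs ! e')"
          then show "e = e'" using E tableD(5)[OF t, of e e'] tableD(5)[OF t, of e' e]
            by (cases e e' rule: linorder_cases) simp_all
        qed
        show "(\<lambda>e. (rs ! e, cs ! e)) ` ?E \<subseteq> {x \<in> {..<n} \<times> {..<n}. \<delta> \<le> f x}"
        proof (rule image_subsetI)
          fix e assume "e \<in> ?E"
          then show "(rs ! e, cs ! e) \<in> {x \<in> {..<n} \<times> {..<n}. \<delta> \<le> f x}"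
            using E[of e] tableD(1-3)[OF t, of e] by simp
        qed
      qed simp
      then show ?thesis using ge by simp
    qed simp
    show ?case
    proof (rule wp_Seq, rule wp_ISetVar, goal_cases)
      case 3
      show ?case
      proof (rule wp_for_upto[where M = m and \<tau> = "\<lambda>_. 5" and
          J = "\<lambda>i s'. ivar s' 3 = card {e. e < i \<and> \<delta> < vs ! e} \<and>
            table n (iarr s' 2) (iarr s' 3) (rarr s' 1) (ivar s' 3) (kept f rs cs \<delta> i) \<and>
            (\<forall>e'<ivar s' 3. \<exists>e<i. (iarr s' 2 ! e', iarr s' 3 ! e') = (rs ! e, cs ! e))"], goal_cases)
        case (3 s3)
        have "kept f rs cs \<delta> 0 = (\<lambda>x. 0)" by (simp add: kept_def fun_eq_iff)
        then show ?case using 3 table_empty by simp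
      next
        case (4 i s3)
        then show ?case using s2 W s by (simp add: unchanged_def)
      next
        case (5 i s3)
        have s3: "iarr s3 4 = rs" "iarr s3 5 = cs" "rarr s3 2 = vs" "rvar s3 2 = \<delta>"
          "length (iarr s3 2) = N" "length (iarr s3 3) = N" "length (rarr s3 1) = N"
          using 5(3) s2 by (simp_all add: unchanged_def \<delta>_def)
        define j where "j = ivar s3 3"
        have "card {e. e < i \<and> \<delta> < vs ! e} \<le> card {..<i}" by (intro card_mono) auto
        then have j: "j \<le> i" using 5(2) by (simp add: j_def)
        have iN: "i < N" "j < N" using 5(1) s(3) j by simp_all
        have i: "rs ! i < n" "cs ! i < n" using tableD(1,2)[OF t 5(1)] .
        note inv = 5(2)[folded j_def]
        have jc2: "j = card {e. e < i \<and> \<delta> < vs ! e}"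
          using inv by (rule conjunct1)
        have tab: "table n (iarr s3 2) (iarr s3 3) (rarr s3 1) j (kept f rs cs \<delta> i)"
          using inv[THEN conjunct2] by (rule conjunct1)
        have old: "\<forall>e'<j. \<exists>e<i. (iarr s3 2 ! e', iarr s3 3 ! e') = (rs ! e, cs ! e)"
          using inv[THEN conjunct2] by (rule conjunct2)
        have jc: "ivar s3 3 = j" "j = card {e. e < i \<and> \<delta> < vs ! e}"
          using jc2 by (simp_all add: j_def)
        have WW: "i \<le> W" "Suc j \<le> W" "rs ! i \<le> W" "cs ! i \<le> W" using iN i W by linarith+
        show ?case
        proof (cases "\<delta> < vs ! i")
          case True
          \<comment> \<open>Every entry kept so far comes from an earlier slot of \<open>rs\<close>
            and \<open>cs\<close>, which gives both the row order and distinctness.\<close>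
          have new: "iarr s3 2 ! e' \<le> rs ! i \<and> (iarr s3 2 ! e', iarr s3 3 ! e') \<noteq> (rs ! i, cs ! i)" if lt: "e' < j" for e'
          proof -
            obtain e where "e < i" "(iarr s3 2 ! e', iarr s3 3 ! e') = (rs ! e, cs ! e)" using old lt by blast
            then show ?thesis using tableD(4,5)[OF t _ 5(1), of e] by simp
          qed
          have tab': "table n ((iarr s3 2)[j := rs ! i]) ((iarr s3 3)[j := cs ! i]) ((rarr s3 1)[j := vs ! i - \<delta>])
              (Suc j) (kept f rs cs \<delta> (Suc i))"
            unfolding kept_Suc(1)[OF t 5(1) True, symmetric]
            by (rule table_append[OF tab]) (use s3 iN i new in simp_all)
          have old': "\<forall>e'<Suc j. \<exists>e<Suc i. ((iarr s3 2)[j := rs ! i] ! e', (iarr s3 3)[j := cs ! i] ! e') = (rs ! e, cs ! e)"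
          proof (intro allI impI)
            fix e' assume e': "e' < Suc j"
            show "\<exists>e<Suc i. ((iarr s3 2)[j := rs ! i] ! e', (iarr s3 3)[j := cs ! i] ! e') = (rs ! e, cs ! e)"
            proof (cases "e' = j")
              case True
              then show ?thesis using s3 iN by (intro exI[of _ i]) simp
            next
              case False
              then have "e' < j" using e' by simp
              then obtain e where "e < i" "(iarr s3 2 ! e', iarr s3 3 ! e') = (rs ! e, cs ! e)" using old by blast
              then show ?thesis using False by (intro exI[of _ e]) simp
            qed
          qed
          have jc': "Suc j = card {e. e < Suc i \<and> \<delta> < vs ! e}"
            unfolding card_Suc_filter jc(2)[symmetric] using True by simp
          show ?thesis
            by (intro wp_Cond wp_Seq wp_ISet wp_RSet wp_ISetVar wp_Skip)
              (use True 5(4) s3 jc(1) jc' iN WW tab' old' len K in simp_all)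
        next
          case False
          have tab': "table n (iarr s3 2) (iarr s3 3) (rarr s3 1) j (kept f rs cs \<delta> (Suc i))"
            using tab kept_Suc(2)[OF t 5(1) False] by simp
          have jc': "j = card {e. e < Suc i \<and> \<delta> < vs ! e}"
            unfolding card_Suc_filter jc(2)[symmetric] using False by simp
          have old': "\<forall>e'<j. \<exists>e<Suc i. (iarr s3 2 ! e', iarr s3 3 ! e') = (rs ! e, cs ! e)"
            using old less_SucI by blast
          show ?thesis
            by (intro wp_Cond wp_Skip)
              (use False 5(4) s3 jc(1) jc' iN WW tab' old' len in simp_all)
        qed
      next
        case (6 t3 s3)
        have "rvar s3 2 = \<delta>" using 6(2) by (simp add: unchanged_def \<delta>_def)
        moreover have "t1 + (t2 + (1 + t3)) \<le> 120 * N + 20"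
          using 6(4) \<open>t1 \<le> _\<close> t2 s(3) by simp
        moreover have "table n (iarr s3 2) (iarr s3 3) (rarr s3 1) (ivar s3 3) (\<lambda>x. max 0 (f x - \<delta>))"
          using 6(1)[THEN conjunct2, THEN conjunct1] unfolding kept_all[OF t \<delta>] .
        moreover have "4 * ivar s3 3 \<le> 3 * N" using kept_le 6(1)[THEN conjunct1] by simp
        ultimately show ?case using \<delta> ge' by simp
      qed (use s W K in simp_all)
    qed (use K in simp_all)
  qed (use s1 K W N in simp_all)
qed (use K W in simp_all)

end

section \<open>Error budget\<close>

text \<open>\<open>f\<close> underestimates \<open>P\<close> with error at most \<open>D\<close>, and the total error pays \<open>b\<close> times for \<open>D\<close>.\<close>

definition approx :: "nat \<Rightarrow> real \<Rightarrow> (nat \<times> nat \<Rightarrow> real) \<Rightarrow> (nat \<times> nat \<Rightarrow> real) \<Rightarrow> real \<Rightarrow> bool" where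
  "approx n b P f D \<longleftrightarrow> 0 \<le> D \<and>
     (\<forall>x \<in> {..<n} \<times> {..<n}. 0 \<le> f x \<and> f x \<le> P x \<and> P x - f x \<le> D) \<and>
     b * D \<le> (\<Sum>x \<in> {..<n} \<times> {..<n}. P x - f x)"

lemma approxI:
  assumes "0 \<le> D" "\<And>x. x \<in> {..<n} \<times> {..<n} \<Longrightarrow> 0 \<le> f x \<and> f x \<le> P x \<and> P x - f x \<le> D"
    "b * D \<le> (\<Sum>x \<in> {..<n} \<times> {..<n}. P x - f x)"
  shows "approx n b P f D"
  using assms unfolding approx_def by blast

lemma approxD:
  assumes "approx n b P f D"
  shows "0 \<le> D" "b * D \<le> (\<Sum>x \<in> {..<n} \<times> {..<n}. P x - f x)"
    "x \<in> {..<n} \<times> {..<n} \<Longrightarrow> 0 \<le> f x" "x \<in> {..<n} \<times> {..<n} \<Longrightarrow> f x \<le> P x"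
    "x \<in> {..<n} \<times> {..<n} \<Longrightarrow> P x - f x \<le> D"
  using assms unfolding approx_def by blast+

lemma approx_refl: "(\<And>x. x \<in> {..<n} \<times> {..<n} \<Longrightarrow> 0 \<le> P x) \<Longrightarrow> approx n b P P 0"
  by (rule approxI) simp_all

text \<open>Both summands pay with the same factor \<open>b\<close>, so errors and budgets add
  up.\<close>

lemma approx_add:
  assumes "approx n b P f D" "approx n b Q g E"
  shows "approx n b (\<lambda>x. P x + Q x) (\<lambda>x. f x + g x) (D + E)"
proof -
  have "(\<Sum>x \<in> {..<n} \<times> {..<n}. P x + Q x - (f x + g x)) =
      (\<Sum>x \<in> {..<n} \<times> {..<n}. P x - f x) + (\<Sum>x \<in> {..<n} \<times> {..<n}. Q x - g x)"
    unfolding sum.distrib[symmetric] by (simp add: algebra_simps)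
  moreover have "0 \<le> f x + g x \<and> f x + g x \<le> P x + Q x \<and> P x + Q x - (f x + g x) \<le> D + E"
    if "x \<in> {..<n} \<times> {..<n}" for x
  proof -
    show ?thesis using approxD(3-5)[OF assms(1) that] approxD(3-5)[OF assms(2) that] by linarith
  qed
  moreover have "0 \<le> D + E" using approxD(1)[OF assms(1)] approxD(1)[OF assms(2)] by simp
  moreover have "b * (D + E) \<le> (\<Sum>x \<in> {..<n} \<times> {..<n}. P x - f x) + (\<Sum>x \<in> {..<n} \<times> {..<n}. Q x - g x)"
    unfolding distrib_left using approxD(2)[OF assms(1)] approxD(2)[OF assms(2)] by (rule add_mono)
  ultimately show ?thesis by (intro approxI) simp_all
qed

text \<open>Each entry that reaches \<open>\<delta>\<close> drops by exactly
  \<open>\<delta>\<close>, and no entry rises. The case \<open>\<delta> = 0\<close> covers a search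
  that ends at 0, where nothing has to be paid.\<close>

lemma approx_reduce:
  assumes f: "approx n b P f D" and \<delta>: "0 \<le> \<delta>"
    and many: "\<delta> = 0 \<or> b \<le> real (card {x \<in> {..<n} \<times> {..<n}. \<delta> \<le> f x})"
  shows "approx n b P (\<lambda>x. max 0 (f x - \<delta>)) (D + \<delta>)"
proof -
  let ?S = "{..<n} \<times> {..<n}"
  let ?H = "{x \<in> ?S. \<delta> \<le> f x}"
  have x: "0 \<le> f x" "f x \<le> P x" "P x - f x \<le> D" if "x \<in> ?S" for x
    using approxD(3-5)[OF f that] .
  have "b * \<delta> \<le> (\<Sum>x\<in>?H. \<delta>)" using many \<delta> by (auto intro: mult_right_mono)
  also have "\<dots> \<le> (\<Sum>x\<in>?H. f x - max 0 (f x - \<delta>))" using \<delta> by (intro sum_mono) auto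
  also have "\<dots> \<le> (\<Sum>x\<in>?S. f x - max 0 (f x - \<delta>))"
    using x \<delta> by (intro sum_mono2) auto
  finally have "b * \<delta> \<le> (\<Sum>x\<in>?S. f x - max 0 (f x - \<delta>))" .
  moreover have "(\<Sum>x\<in>?S. P x - max 0 (f x - \<delta>)) =
      (\<Sum>x\<in>?S. P x - f x) + (\<Sum>x\<in>?S. f x - max 0 (f x - \<delta>))"
    unfolding sum.distrib[symmetric] by simp
  moreover have "0 \<le> max 0 (f x - \<delta>) \<and> max 0 (f x - \<delta>) \<le> P x \<and> P x - max 0 (f x - \<delta>) \<le> D + \<delta>"
    if "x \<in> ?S" for x using x[OF that] \<delta> by auto
  moreover have "0 \<le> D + \<delta>" using approxD(1)[OF f] \<delta> by simp
  moreover have "b * (D + \<delta>) = b * D + b * \<delta>" by (rule distrib_left)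
  ultimately show ?thesis using approxD(2)[OF f] by (intro approxI) simp_all
qed

lemma approx_cong:
  assumes "\<And>x. x \<in> {..<n} \<times> {..<n} \<Longrightarrow> P x = P' x \<and> f x = f' x"
  shows "approx n b P f D = approx n b P' f' D"
proof -
  have "(\<Sum>x \<in> {..<n} \<times> {..<n}. P x - f x) = (\<Sum>x \<in> {..<n} \<times> {..<n}. P' x - f' x)"
    using assms by (intro sum.cong) auto
  then show ?thesis using assms unfolding approx_def by (metis (no_types, lifting))
qed

section \<open>Reindexing along the sorting permutations\<close>

lemma card_bij:
  assumes "bij_betw h S T"
  shows "card {z \<in> S. R (h z)} = card {w \<in> T. R w}"
proof -
  have "h ` S = T" "inj_on h S" using assms by (simp_all add: bij_betw_def)
  then have "h ` {z \<in> S. R (h z)} = {w \<in> T. R w}" by blast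
  moreover have "inj_on h {z \<in> S. R (h z)}" using \<open>inj_on h S\<close> by (rule inj_on_subset) blast
  ultimately show ?thesis using card_image[of h "{z \<in> S. R (h z)}"] by simp
qed

lemma perm_bij:
  assumes "length p = n" "set p = {..<n}"
  shows "distinct p" "bij_betw (\<lambda>i. p ! i) {..<n} {..<n}"
    "bij_betw (\<lambda>i. p ! (n - Suc i)) {..<n} {..<n}" "bij_betw (\<lambda>i. p ! (n - i)) {1..n} {..<n}"
proof -
  show d: "distinct p" using assms by (metis card_distinct card_lessThan)
  show b: "bij_betw (\<lambda>i. p ! i) {..<n} {..<n}" using bij_betw_nth[OF d] assms by simp
  have "bij_betw (\<lambda>i. n - Suc i) {..<n} {..<n}"
    by (rule bij_betw_byWitness[where f' = "\<lambda>i. n - Suc i"]) auto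
  from bij_betw_trans[OF this b] show "bij_betw (\<lambda>i. p ! (n - Suc i)) {..<n} {..<n}"
    by (simp add: comp_def)
  have "bij_betw (\<lambda>i. n - i) {1..n} {..<n}"
    by (rule bij_betw_byWitness[where f' = "\<lambda>i. n - i"]) auto
  from bij_betw_trans[OF this b] show "bij_betw (\<lambda>i. p ! (n - i)) {1..n} {..<n}"
    by (simp add: comp_def)
qed

text \<open>Transfers counts from ranks, where the threshold is found, to matrix positions, where
  the error budget is kept.\<close>

lemma card_sorted_pairs:
  assumes "length p = n" "set p = {..<n}" "length q = n" "set q = {..<n}"
    and "X = map (\<lambda>i. xs ! i) p" "Y = map (\<lambda>i. ys ! i) q"
  shows "card {(i, j). i \<in> {1..n} \<and> j \<in> {1..n} \<and> R (X ! (n - i)) (Y ! (n - j))} =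
    card {x \<in> {..<n} \<times> {..<n}. R (xs ! fst x) (ys ! snd x)}"
proof -
  let ?h = "map_prod (\<lambda>i. p ! (n - i)) (\<lambda>j. q ! (n - j))"
  have h: "bij_betw ?h ({1..n} \<times> {1..n}) ({..<n} \<times> {..<n})"
    by (intro bij_betw_map_prod perm_bij(4) assms)
  have nth: "X ! (n - i) = xs ! (p ! (n - i))" "Y ! (n - i) = ys ! (q ! (n - i))" if "i \<in> {1..n}" for i
    using that by (simp_all add: assms(1,3,5,6))
  have "{(i, j). i \<in> {1..n} \<and> j \<in> {1..n} \<and> R (X ! (n - i)) (Y ! (n - j))} =
      {z \<in> {1..n} \<times> {1..n}. R (X ! (n - fst z)) (Y ! (n - snd z))}"
    by auto
  also have "\<dots> = {z \<in> {1..n} \<times> {1..n}. R (xs ! fst (?h z)) (ys ! snd (?h z))}"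
    by (rule Collect_cong) (auto simp: nth)
  finally show ?thesis using card_bij[OF h, of "\<lambda>x. R (xs ! fst x) (ys ! snd x)"] by simp
qed

text \<open>Relates the entries pushed row by row to the number of positions above the threshold,
  for the capacity bound.\<close>

lemma sum_card_rows:
  assumes "length q = n" "set q = {..<n}" and "Y = map (\<lambda>i. ys ! i) q"
  shows "(\<Sum>r<n. card {u. u < n \<and> R (xs ! r) (Y ! (n - Suc u))}) =
    card {x \<in> {..<n} \<times> {..<n}. R (xs ! fst x) (ys ! snd x)}"
proof -
  have "card {u. u < n \<and> R (xs ! r) (Y ! (n - Suc u))} = card {c \<in> {..<n}. R (xs ! r) (ys ! c)}" for r
  proof -
    have "{u. u < n \<and> R (xs ! r) (Y ! (n - Suc u))} = {u \<in> {..<n}. R (xs ! r) (ys ! (q ! (n - Suc u)))}"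
      by (rule Collect_cong) (auto simp: assms(1,3))
    then show ?thesis using card_bij[OF perm_bij(3)[OF assms(1,2)], of "\<lambda>c. R (xs ! r) (ys ! c)"] by simp
  qed
  then have "(\<Sum>r<n. card {u. u < n \<and> R (xs ! r) (Y ! (n - Suc u))}) =
      card (SIGMA r:{..<n}. {c \<in> {..<n}. R (xs ! r) (ys ! c)})"
    by (subst card_SigmaI) auto
  also have "(SIGMA r:{..<n}. {c \<in> {..<n}. R (xs ! r) (ys ! c)}) =
      {x \<in> {..<n} \<times> {..<n}. R (xs ! fst x) (ys ! snd x)}"
    by auto
  finally show ?thesis .
qed

text \<open>The sorting permutation meets column \<open>c\<close> exactly once, so only one term of
  the sum can be nonzero.\<close>

lemma (in combine_input) increment_eq:
  assumes "Y = map (\<lambda>i. ys ! i) PY" "c < n"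
  shows "increment 0 r c = max 0 (xs ! r * ys ! c - \<delta>)"
proof -
  have d: "distinct PY" by (rule perm_bij(1)[OF PY])
  obtain j where j: "j < n" "PY ! j = c" using assms(2) PY by (metis in_set_conv_nth lessThan_iff)
  have iff: "PY ! i = c \<longleftrightarrow> i = j" if "i < n" for i
    using that j d PY(1) by (auto simp: nth_eq_iff_index_eq)
  have "increment 0 r c = (\<Sum>i\<in>{0..<n}. if i = j then (if \<delta> < xs ! r * ys ! c then xs ! r * ys ! c - \<delta> else 0) else 0)"
    unfolding increment_def using iff assms(1) PY(1) j by (intro sum.cong) auto
  also have "\<dots> = max 0 (xs ! r * ys ! c - \<delta>)" using j by simp
  finally show ?thesis .
qed

lemma (in combine_input) increment_nonneg: "0 \<le> increment j r c"
  unfolding increment_def by (intro sum_nonneg) auto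

section \<open>The algorithm\<close>

definition step :: "com \<Rightarrow> nat \<Rightarrow> com" where
  "step S K' = load_sorted S K' True 3 4 8 ;; load_sorted S K' False 8 5 7 ;;
     find_threshold ;; combine ;; prune"

lemma unchanged_load_sorted:
  assumes "unchanged (load_sorted S K' a u d p) s s'" "x < 50"
  shows "x \<noteq> 6 \<Longrightarrow> ivar s' x = ivar s x" "x \<noteq> 3 \<Longrightarrow> rvar s' x = rvar s x"
    "x \<noteq> p \<Longrightarrow> iarr s' x = iarr s x" "x \<noteq> u \<Longrightarrow> x \<noteq> d \<Longrightarrow> rarr s' x = rarr s x"
proof -
  note t = targets_erase[of 50 K'] targets_shift[of 50 S]
  have nin: "IScalar x \<notin> targets (erase 50 K')" "IScalar x \<notin> targets (shift 50 S)"
    "RScalar x \<notin> targets (erase 50 K')" "RScalar x \<notin> targets (shift 50 S)"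
    "IArray x \<notin> targets (erase 50 K')" "IArray x \<notin> targets (shift 50 S)"
    "RArray x \<notin> targets (erase 50 K')" "RArray x \<notin> targets (shift 50 S)"
    using t \<open>x < 50\<close> by auto
  have "x \<noteq> 6 \<Longrightarrow> IScalar x \<notin> targets (load_sorted S K' a u d p)"
    "x \<noteq> 3 \<Longrightarrow> RScalar x \<notin> targets (load_sorted S K' a u d p)"
    "x \<noteq> p \<Longrightarrow> IArray x \<notin> targets (load_sorted S K' a u d p)"
    "x \<noteq> u \<Longrightarrow> x \<noteq> d \<Longrightarrow> RArray x \<notin> targets (load_sorted S K' a u d p)"
    using nin \<open>x < 50\<close> by (simp_all add: load_sorted_def)
  then show "x \<noteq> 6 \<Longrightarrow> ivar s' x = ivar s x" "x \<noteq> 3 \<Longrightarrow> rvar s' x = rvar s x"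
    "x \<noteq> p \<Longrightarrow> iarr s' x = iarr s x" "x \<noteq> u \<Longrightarrow> x \<noteq> d \<Longrightarrow> rarr s' x = rarr s x"
    using assms(1) unfolding unchanged_def by simp_all
qed

locale product_machine = machine W K L for W K L :: nat +
  fixes S :: com and Sort :: "nat \<Rightarrow> nat" and e K' n N a :: nat and A B :: "real mat"
  assumes S: "sorts S Sort e" and K: "\<forall>x\<in>targets S. target_names x + 50 < K" "K = K' + 50" "0 < K'"
    and W: "(n + 2) ^ e \<le> W" "4 * n * n + 4 \<le> W" "2 * n + 4 \<le> W" "2 * N + 4 \<le> W"
    and L: "e * (n + 1) \<le> L" "n \<le> L" "N \<le> L"
    and N: "N = 4 ^ a" "2 \<le> a" and n: "1 \<le> n"
    and A: "A \<in> carrier_mat n n" "\<And>i j. i < n \<Longrightarrow> j < n \<Longrightarrow> 0 \<le> A $$ (i, j)"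
    and B: "B \<in> carrier_mat n n" "\<And>i j. i < n \<Longrightarrow> j < n \<Longrightarrow> 0 \<le> B $$ (i, j)"
begin

definition partial_product :: "nat \<Rightarrow> nat \<times> nat \<Rightarrow> real" where
  "partial_product i x = (\<Sum>l<i. A $$ (fst x, l) * B $$ (l, snd x))"

definition sizes :: "state \<Rightarrow> bool" where
  "sizes s \<longleftrightarrow> ivar s 0 = n \<and> ivar s 2 = N \<and>
     length (iarr s 2) = N \<and> length (iarr s 3) = N \<and> length (iarr s 4) = N \<and> length (iarr s 5) = N \<and>
     length (rarr s 1) = N \<and> length (rarr s 2) = N \<and> length (rarr s 6) = N \<and> length (rarr s 7) = N"

text \<open>A quarter of the capacity stays free for the next outer product. The bound
  \<open>D\<close> accumulates the thresholds used so far.\<close>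

definition invariant :: "nat \<Rightarrow> state \<Rightarrow> bool" where
  "invariant i s \<longleftrightarrow> sizes s \<and>
     tape True s = concat (map list_of_vec (drop i (cols A))) \<and>
     tape False s = concat (map list_of_vec (drop i (rows B))) \<and>
     4 * ivar s 3 \<le> 3 * N \<and>
     (\<exists>f D. table n (iarr s 2) (iarr s 3) (rarr s 1) (ivar s 3) f \<and> (\<forall>x. 0 \<le> f x) \<and>
        approx n (real N / 16) (partial_product i) f D)"

lemma wp_step:
  assumes inv: "invariant i s" and i: "i < n"
  shows "wp (step S K') (\<lambda>t s'. invariant (Suc i) s' \<and>
    t \<le> 2 * Sort n + 2100 * n + 130 * N + 40 * K' + 100) s"
proof -
  define xs ys where "xs = list_of_vec (col A i)" and "ys = list_of_vec (row B i)"
  have dims: "dim_row A = n" "dim_col A = n" "dim_row B = n" "dim_col B = n" using A(1) B(1) by auto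
  have lens: "length xs = n" "length ys = n" using dims by (simp_all add: xs_def ys_def)
  have xs_nth: "xs ! r = A $$ (r, i)" if "r < n" for r
    using that i dims by (simp add: xs_def list_of_vec_index)
  have ys_nth: "ys ! c = B $$ (i, c)" if "c < n" for c
    using that i dims by (simp add: ys_def list_of_vec_index)
  have dropA: "drop i (cols A) = col A i # drop (Suc i) (cols A)"
    using i dims by (simp add: Cons_nth_drop_Suc[symmetric])
  have dropB: "drop i (rows B) = row B i # drop (Suc i) (rows B)"
    using i dims by (simp add: Cons_nth_drop_Suc[symmetric])
  from inv have sz: "sizes s"
    and tA: "tape True s = xs @ concat (map list_of_vec (drop (Suc i) (cols A)))"
    and tB: "tape False s = ys @ concat (map list_of_vec (drop (Suc i) (rows B)))"
    and cnt: "4 * ivar s 3 \<le> 3 * N"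
    unfolding invariant_def dropA dropB xs_def ys_def by simp_all
  from inv obtain f D where tab: "table n (iarr s 2) (iarr s 3) (rarr s 1) (ivar s 3) f"
    and f: "\<And>x. 0 \<le> f x" and app: "approx n (real N / 16) (partial_product i) f D"
    unfolding invariant_def by blast
  show ?thesis unfolding step_def
  proof (rule wp_Seq_cut[OF wp_load_sorted[OF S K _ _ _ _ _ tA]], goal_cases)
    case (10 t1 s1)
    note load1 = unchanged_load_sorted[OF 10(1)]
    have sz1: "sizes s1" using sz load1 by (simp add: sizes_def)
    have tB1: "tape False s1 = ys @ concat (map list_of_vec (drop (Suc i) (rows B)))"
      using 10(2) tB by simp
    define X PX where "X = rarr s1 4" and "PX = iarr s1 8"
    have X: "X = sort xs" "length PX = n" "set PX = {..<n}" "X = map (\<lambda>i. xs ! i) PX" "rarr s1 3 = xs"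
      using 10(2) unfolding X_def PX_def lens by blast+
    have tA1: "tape True s1 = concat (map list_of_vec (drop (Suc i) (cols A)))" and time1: "t1 \<le> Sort n + 20 * (K' + n + 1)"
      using 10(2) lens by simp_all
    have tab1: "table n (iarr s1 2) (iarr s1 3) (rarr s1 1) (ivar s1 3) f" "ivar s1 3 = ivar s 3"
      using tab load1 by simp_all
    show ?case
    proof (rule wp_Seq_cut[OF wp_load_sorted[OF S K _ _ _ _ _ tB1]], goal_cases)
      case (10 t2 s2)
      note load2 = unchanged_load_sorted[OF 10(1)]
      have sz2: "sizes s2" using sz1 load2 by (simp add: sizes_def)
      define Y PY where "Y = rarr s2 5" and "PY = iarr s2 7"
      have Y: "Y = sort ys" "length PY = n" "set PY = {..<n}" "Y = map (\<lambda>i. ys ! i) PY"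
        using 10(2) unfolding Y_def PY_def lens by blast+
      have X2: "rarr s2 4 = X" "rarr s2 3 = xs" using load2 X by (simp_all add: X_def)
      have tA2: "tape True s2 = concat (map list_of_vec (drop (Suc i) (cols A)))"
        and tB2: "tape False s2 = concat (map list_of_vec (drop (Suc i) (rows B)))"
        and time2: "t2 \<le> Sort n + 20 * (K' + n + 1)"
        using 10(2) lens tA1 by simp_all
      have tab2: "table n (iarr s2 2) (iarr s2 3) (rarr s2 1) (ivar s2 3) f" "ivar s2 3 = ivar s 3"
        using tab1 load2 by simp_all
      have G_nonneg: "0 \<le> xs ! r" "0 \<le> ys ! r" if "r < n" for r
        using that i A(2) B(2) xs_nth ys_nth by simp_all
      have len2: "length X = n" "length Y = n" using X(1) Y(1) lens by simp_all
      have nonneg: "0 \<le> X ! j" "0 \<le> Y ! j" if "j < n" for j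
      proof -
        have "PX ! j < n" "PY ! j < n"
          using that X(2,3) Y(2,3) nth_mem[of j PX] nth_mem[of j PY] by auto
        then show "0 \<le> X ! j" "0 \<le> Y ! j"
          unfolding X(4) Y(4) using that X(2) Y(2) G_nonneg by simp_all
      qed
      obtain l where l: "2 ^ l \<le> n" "n < 2 ^ Suc l" using ex_power_ivl1[of 2 n] n by auto
      interpret mp: machine_product W K L X Y n l
      proof
        fix i j :: nat assume "1 \<le> i" "i \<le> j" "j \<le> n"
        then show "X ! (n - j) \<le> X ! (n - i)" "Y ! (n - j) \<le> Y ! (n - i)"
          using X(1) Y(1) len2 by (auto intro!: sorted_nth_mono)
      next
        fix i :: nat assume "1 \<le> i" "i \<le> n"
        then show "0 \<le> X ! (n - i)" "0 \<le> Y ! (n - i)" using nonneg[of "n - i"] by auto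
      qed (use l K W len2 in auto)
      have in2: "mp.inputs s2" unfolding mp.inputs_def using sz2 X2 by (simp add: sizes_def Y_def)
      define G where "G x = xs ! fst x * ys ! snd x" for x :: "nat \<times> nat"
      show ?case
      proof (rule wp_Seq_cut[OF mp.wp_find_threshold[OF in2]], goal_cases)
        case 1 then show ?case using sz2 W by (simp add: sizes_def)
      next
        case (2 t3 s3)
        define \<delta> where "\<delta> = rvar s3 1"
        \<comment> \<open>Divisibility by 4 makes the quarters exact: the free room is
          \<open>N div 4\<close>, and the guarantee of \<open>find_threshold\<close> becomes
          \<open>N / 16\<close>.\<close>
        have N4: "N = 4 * (N div 4)" using N by (cases a) simp_all
        have \<delta>: "0 \<le> \<delta>" and time3: "t3 \<le> 2000 * n"
          and few: "card {x \<in> {..<n} \<times> {..<n}. \<delta> < G x} \<le> N div 4"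
          and many: "\<delta> = 0 \<or> N div 4 < 4 * card {x \<in> {..<n} \<times> {..<n}. \<delta> \<le> G x}"
          using 2(2) sz2 card_sorted_pairs[OF X(2,3) Y(2,3) X(4) Y(4), of "\<lambda>u v. \<delta> < u * v"]
            card_sorted_pairs[OF X(2,3) Y(2,3) X(4) Y(4), of "\<lambda>u v. \<delta> \<le> u * v"]
          by (simp_all add: \<delta>_def sizes_def G_def)
        have sz3: "sizes s3" "rvar s3 1 = \<delta>" using 2(1) sz2 by (simp_all add: sizes_def unchanged_def \<delta>_def)
        have s3: "ivar s3 3 = ivar s2 3" "iarr s3 2 = iarr s2 2" "iarr s3 3 = iarr s2 3" "iarr s3 7 = PY"
          "rarr s3 1 = rarr s2 1" "rarr s3 3 = xs" "rarr s3 5 = Y" "tapeA s3 = tapeA s2" "tapeB s3 = tapeB s2"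
          using 2(1) X2 by (simp_all add: unchanged_def Y_def PY_def)
        interpret ci: combine_input W K L n N "ivar s2 3" "iarr s2 2" "iarr s2 3" PY "rarr s2 1" xs Y f \<delta>
        proof
          show "ivar s2 3 + (\<Sum>r<n. card {u. u < n \<and> \<delta> < xs ! r * Y ! (n - Suc u)}) \<le> N"
            using sum_card_rows[OF Y(2,3,4), of "\<lambda>u v. \<delta> < u * v"] few cnt tab2(2) N4
            by (simp add: G_def)
        qed (use K W L tab2(1) lens len2 G_nonneg Y in auto)
        have in3: "ci.inputs s3" unfolding ci.inputs_def using sz3 s3 by (simp add: sizes_def)
        define F where "F = (\<lambda>(r, c). if r < n then f (r, c) + ci.increment 0 r c else 0)"
        have F_nonneg: "0 \<le> F x" for x
          using f ci.increment_nonneg by (auto simp: F_def split: prod.splits)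
        have F: "F x = f x + max 0 (G x - \<delta>)" if "x \<in> {..<n} \<times> {..<n}" for x
          using that ci.increment_eq[OF Y(4)] by (auto simp: F_def G_def)
        show ?case
        proof (rule wp_Seq_cut[OF ci.wp_combine[OF in3]], goal_cases)
          case (1 t4 s4)
          have sz4: "sizes s4" "tapeA s4 = tapeA s2" "tapeB s4 = tapeB s2"
            using 1(1) sz3 s3 by (simp_all add: sizes_def unchanged_def)
          have time4: "t4 \<le> 10 * n + 10 * N + 10" and oc: "ivar s4 4 \<le> N"
            and tab4: "table n (iarr s4 4) (iarr s4 5) (rarr s4 2) (ivar s4 4) F"
            using 1(2) by (simp_all add: F_def)
          show ?case
          proof (rule wp_cut[OF wp_prune[OF _ _ _ N _ refl oc tab4 F_nonneg]], goal_cases)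
            case (13 t5 s5)
            define \<delta>' where "\<delta>' = rvar s5 2"
            \<comment> \<open>First reduction: the outer product starts without error, and more than
              \<open>N / 16\<close> of its entries reach \<open>\<delta>\<close>.\<close>
            have "approx n (real N / 16) G (\<lambda>x. max 0 (G x - \<delta>)) (0 + \<delta>)"
            proof (rule approx_reduce[OF approx_refl \<delta>])
              show "0 \<le> G x" if "x \<in> {..<n} \<times> {..<n}" for x
                using that G_nonneg by (auto simp: G_def)
              have "N \<le> 16 * card {x \<in> {..<n} \<times> {..<n}. \<delta> \<le> G x}" if "\<delta> \<noteq> 0"
                using many N4 that by linarith
              then show "\<delta> = 0 \<or> real N / 16 \<le> real (card {x \<in> {..<n} \<times> {..<n}. \<delta> \<le> G x})"
                by (cases "\<delta> = 0") simp_all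
            qed
            from approx_add[OF app this]
            have "approx n (real N / 16) (partial_product (Suc i)) F (D + (0 + \<delta>))"
              by (rule approx_cong[THEN iffD1, rotated])
                (auto simp: F partial_product_def G_def xs_nth ys_nth)
            \<comment> \<open>Second reduction: even \<open>N / 4\<close> entries reach
              \<open>\<delta>'\<close>, but the factor common to both reductions is
              \<open>N / 16\<close>.\<close>
            then have app5: "approx n (real N / 16) (partial_product (Suc i)) (\<lambda>x. max 0 (F x - \<delta>')) (D + (0 + \<delta>) + \<delta>')"
            proof (rule approx_reduce)
              show "0 \<le> \<delta>'" using 13(2) by (simp add: \<delta>'_def)
              have "N \<le> 16 * card {x \<in> {..<n} \<times> {..<n}. \<delta>' \<le> F x}" if "\<delta>' \<noteq> 0"
                using 13(2) that unfolding \<delta>'_def by (elim conjE) linarith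
              then show "\<delta>' = 0 \<or> real N / 16 \<le> real (card {x \<in> {..<n} \<times> {..<n}. \<delta>' \<le> F x})"
                by (cases "\<delta>' = 0") simp_all
            qed
            have sz5: "sizes s5" "tapeA s5 = tapeA s2" "tapeB s5 = tapeB s2"
              using 13(1) sz4 by (simp_all add: sizes_def unchanged_def)
            have tab5: "table n (iarr s5 2) (iarr s5 3) (rarr s5 1) (ivar s5 3) (\<lambda>x. max 0 (F x - \<delta>'))"
              and cnt5: "4 * ivar s5 3 \<le> 3 * N" and time5: "t5 \<le> 120 * N + 20"
              using 13(2) by (simp_all add: \<delta>'_def)
            have "invariant (Suc i) s5"
              unfolding invariant_def
            proof (intro conjI exI)
              show "tape True s5 = concat (map list_of_vec (drop (Suc i) (cols A)))"
                using tA2 sz5 by (simp add: tape_def)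
              show "tape False s5 = concat (map list_of_vec (drop (Suc i) (rows B)))"
                using tB2 sz5 by (simp add: tape_def)
            qed (use sz5 cnt5 tab5 app5 in auto)
            moreover have "t1 + (t2 + (t3 + (t4 + t5))) \<le> 2 * Sort n + 2100 * n + 130 * N + 40 * K' + 100"
              using add_mono[OF time1 add_mono[OF time2 add_mono[OF time3 add_mono[OF time4 time5]]]]
              by simp
            ultimately show ?case by simp
          qed (use sz4 K W in \<open>simp_all add: sizes_def\<close>)
        qed
      qed
    qed (use sz1 S K W L lens in \<open>simp_all add: sizes_def\<close>)
  qed (use sz S K W L lens in \<open>simp_all add: sizes_def\<close>)
qed

end

text \<open>The loop test is \<open>N / 16 < k + k / \<epsilon>\<close> multiplied by
  \<open>16 * \<epsilon>\<close>, which avoids divisions. Starting from 16 ensures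
  \<open>2 \<le> a\<close> for the selection.\<close>

definition choose_capacity :: com where
  "choose_capacity = ISetVar 2 (INum 16) ;;
     While (BRLess (RMul (RNat (IVar 2)) (RVar 0))
        (RMul (RNat (IMul (INum 16) (IVar 1))) (RAdd (RVar 0) (RNat (INum 1)))))
       (ISetVar 2 (IMul (INum 4) (IVar 2)))"

definition allocate :: com where
  "allocate = INew 2 (IVar 2) ;; INew 3 (IVar 2) ;; INew 4 (IVar 2) ;; INew 5 (IVar 2) ;;
     RNew 1 (IVar 2) ;; RNew 2 (IVar 2) ;; RNew 6 (IVar 2) ;; RNew 7 (IVar 2)"

text \<open>The working arrays have the fixed length \<open>N\<close> with stale data behind the
  entries, whereas the output format reads whole arrays.\<close>

definition emit :: com where
  "emit = INew 0 (IVar 3) ;; INew 1 (IVar 3) ;; RNew 0 (IVar 3) ;;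
     for_upto 10 (IVar 3) (ISet 0 (IVar 10) (IGet 2 (IVar 10)) ;; ISet 1 (IVar 10) (IGet 3 (IVar 10)) ;;
       RSet 0 (IVar 10) (RGet 1 (IVar 10)))"

definition multiply :: "com \<Rightarrow> nat \<Rightarrow> com" where
  "multiply S K' = choose_capacity ;; allocate ;; for_upto 20 (IVar 0) (step S K') ;; emit"

text \<open>Unless \<open>a = 2\<close>, the previous power of 4 was too small; with
  \<open>\<epsilon> < 1\<close> this gives the factor \<open>4 * 16 * 2 = 128\<close>. For
  \<open>a = 2\<close> it is enough that \<open>k / \<epsilon>\<close> is at least 1.\<close>

lemma capacity_exists:
  fixes \<epsilon> :: real and k :: nat
  assumes "0 < \<epsilon>" "\<epsilon> < 1" "1 \<le> k"
  obtains a where "2 \<le> a" "16 * real k * (\<epsilon> + 1) \<le> 4 ^ a * \<epsilon>"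
    "\<And>i. 2 \<le> i \<Longrightarrow> i < a \<Longrightarrow> 4 ^ i * \<epsilon> < 16 * real k * (\<epsilon> + 1)" "4 ^ a \<le> 128 * (real k / \<epsilon>)"
proof -
  let ?P = "\<lambda>a. 2 \<le> a \<and> 16 * real k * (\<epsilon> + 1) \<le> 4 ^ a * \<epsilon>"
  obtain m where m: "16 * real k * (\<epsilon> + 1) / \<epsilon> < 4 ^ m" using real_arch_pow[of 4] by auto
  have "(4::real) ^ m \<le> 4 ^ (m + 2)" by (rule power_increasing) auto
  then have "16 * real k * (\<epsilon> + 1) / \<epsilon> < 4 ^ (m + 2)" using m by linarith
  then have ex: "?P (m + 2)" using assms by (simp add: pos_divide_less_eq)
  define a where "a = (LEAST a. ?P a)"
  have a: "?P a" unfolding a_def by (rule LeastI[of ?P, OF ex])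
  have min: "4 ^ i * \<epsilon> < 16 * real k * (\<epsilon> + 1)" if "2 \<le> i" "i < a" for i
    using not_less_Least[of i ?P] that unfolding a_def by auto
  have "1 \<le> real k / \<epsilon>" using assms by (simp add: le_divide_eq)
  moreover have "4 ^ a \<le> 128 * (real k / \<epsilon>)" if "a \<noteq> 2"
  proof -
    obtain i where i: "a = Suc i" "2 \<le> i" using a \<open>a \<noteq> 2\<close> by (cases a) auto
    have "4 ^ i * \<epsilon> < 16 * real k * (\<epsilon> + 1)" using min i by simp
    also have "\<dots> \<le> 16 * real k * 2" using assms by (intro mult_left_mono) auto
    finally have "4 ^ i * \<epsilon> < 32 * real k" by simp
    moreover have "4 ^ a * \<epsilon> = 4 * (4 ^ i * \<epsilon>)" unfolding i(1) by simp
    ultimately have "4 ^ a * \<epsilon> \<le> 128 * real k" by linarith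
    then show ?thesis using assms by (simp add: pos_le_divide_eq)
  qed
  ultimately have "4 ^ a \<le> 128 * (real k / \<epsilon>)" by (cases "a = 2") auto
  then show thesis using that a min by blast
qed

lemma table_map_of:
  assumes t: "table n rs cs vs m f" and len: "length rs = m" "length cs = m" "length vs = m"
  shows "distinct (zip rs cs)" "set (zip rs cs) \<subseteq> {..<n} \<times> {..<n}"
    "(case map_of (zip (zip rs cs) vs) x of None \<Rightarrow> 0 | Some v \<Rightarrow> v) = f x"
proof -
  show d: "distinct (zip rs cs)"
    unfolding distinct_conv_nth
  proof (intro allI impI)
    fix i j assume "i < length (zip rs cs)" "j < length (zip rs cs)" "i \<noteq> j"
    then show "zip rs cs ! i \<noteq> zip rs cs ! j"
      using tableD(5)[OF t, of i j] tableD(5)[OF t, of j i] len by (cases i j rule: linorder_cases) auto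
  qed
  show "set (zip rs cs) \<subseteq> {..<n} \<times> {..<n}"
    using tableD(1,2)[OF t] len by (auto simp: set_zip)
  show "(case map_of (zip (zip rs cs) vs) x of None \<Rightarrow> 0 | Some v \<Rightarrow> v) = f x"
  proof (cases "\<exists>e<m. x = (rs ! e, cs ! e)")
    case True
    then obtain e where e: "e < m" "x = (rs ! e, cs ! e)" by blast
    have "map_of (zip (zip rs cs) vs) (zip rs cs ! e) = Some (vs ! e)"
      by (rule map_of_zip_nth) (use d e len in auto)
    then show ?thesis using e len tableD(3)[OF t, of e] by simp
  next
    case False
    then have "x \<notin> set (zip rs cs)" using len by (auto simp: set_zip)
    then have "map_of (zip (zip rs cs) vs) x = None" using len by (simp add: map_of_zip_is_None)
    then show ?thesis using tableD(6)[OF t, of x] False by auto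
  qed
qed

context product_machine
begin

lemma wp_choose_capacity:
  assumes s: "rvar s 0 = \<epsilon>" "ivar s 1 = k" and W': "16 * k \<le> W" "16 \<le> W"
    and N': "16 * real k * (\<epsilon> + 1) \<le> 4 ^ a * \<epsilon>"
      "\<And>i. 2 \<le> i \<Longrightarrow> i < a \<Longrightarrow> 4 ^ i * \<epsilon> < 16 * real k * (\<epsilon> + 1)"
  shows "wp choose_capacity (\<lambda>t s'. t \<le> 2 + 2 * N \<and> ivar s' 2 = N) s"
  unfolding choose_capacity_def
proof (rule wp_Seq, rule wp_ISetVar, goal_cases)
  case 3
  show ?case
  proof (rule wp_While_index[where M = "a - 2" and J = "\<lambda>i s'. ivar s' 2 = 4 ^ (i + 2)" and \<tau> = "\<lambda>_. 1"], goal_cases)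
    case (2 i s')
    have "i + 2 \<le> a" using 2(1) N by simp
    then have "(4::nat) ^ (i + 2) \<le> N" unfolding N(1) by (rule power_increasing) simp
    moreover have "4 ^ (i + 2) * \<epsilon> < 16 * real k * (\<epsilon> + 1) \<longleftrightarrow> i < a - 2"
    proof (cases "i < a - 2")
      case True
      then show ?thesis using N'(2)[of "i + 2"] by simp
    next
      case False
      then have "i + 2 = a" using \<open>i + 2 \<le> a\<close> by simp
      then show ?thesis using N'(1) False by (simp only:) simp
    qed
    ultimately show ?case using 2(2,3) s W W' by (simp add: unchanged_def)
  next
    case (3 i s')
    have "Suc i + 2 \<le> a" using 3(1) by simp
    then have "(4::nat) ^ (Suc i + 2) \<le> N" unfolding N(1) by (rule power_increasing) simp
    then show ?case using 3 W W' K by (intro wp_ISetVar) simp_all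
  next
    case (4 t s')
    have "a < 4 ^ a" by (rule less_le_trans[OF less_exp]) (simp add: power_mono)
    then have "a < N" using N by simp
    moreover have "a - 2 + 2 = a" using N by simp
    then have "ivar s' 2 = N" using 4(1) unfolding N(1) by (simp only:)
    moreover have "t \<le> 1 + (a - 2) * 2" using 4(3) by simp
    ultimately show ?case by simp
  qed simp
qed (use W' K in simp_all)

lemma wp_emit:
  assumes t: "table n (iarr s 2) (iarr s 3) (rarr s 1) (ivar s 3) f" and m: "ivar s 3 \<le> N"
  shows "wp emit (\<lambda>t s'. t \<le> 10 + 10 * N \<and>
     table n (iarr s' 0) (iarr s' 1) (rarr s' 0) (ivar s 3) f \<and> length (iarr s' 0) = ivar s 3 \<and>
     length (iarr s' 1) = ivar s 3 \<and> length (rarr s' 0) = ivar s 3) s"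
proof -
  define m where "m = ivar s 3"
  have mN: "m \<le> N" using m by (simp add: m_def)
  show ?thesis unfolding emit_def
  proof (intro wp_Seq wp_INew wp_RNew, goal_cases)
    case 10
    show ?case
    proof (rule wp_for_upto[where M = m and \<tau> = "\<lambda>_. 3" and
        J = "\<lambda>i s'. iarr s' 0 = take i (iarr s 2) @ replicate (m - i) 0 \<and>
          iarr s' 1 = take i (iarr s 3) @ replicate (m - i) 0 \<and>
          rarr s' 0 = take i (rarr s 1) @ replicate (m - i) 0"], goal_cases)
      case (3 s')
      then show ?case by (simp add: m_def)
    next
      case (4 i s')
      then show ?case using mN W by (simp add: unchanged_def m_def)
    next
      case (5 i s')
      have len: "i < length (iarr s 2)" "i < length (iarr s 3)" "i < length (rarr s 1)"
        using 5(1) tableD(7-9)[OF t] by (simp_all add: m_def)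
      have val: "iarr s 2 ! i \<le> W" "iarr s 3 ! i \<le> W" "i \<le> W"
        using tableD(1,2)[OF t, of i] 5(1) W mN by (simp_all add: m_def)
      have s': "iarr s' 2 = iarr s 2" "iarr s' 3 = iarr s 3" "rarr s' 1 = rarr s 1"
        using 5(3) by (simp_all add: unchanged_def)
      show ?case
        by (intro wp_Seq wp_ISet wp_RSet)
          (use 5 s' len val fill_update[OF len(3) 5(1), of 0] fill_update[OF len(1) 5(1), of 0] fill_update[OF len(2) 5(1), of 0] in simp_all)
    next
      case (6 t' s')
      have len: "m \<le> length (iarr s 2)" "m \<le> length (iarr s 3)" "m \<le> length (rarr s 1)"
        using tableD(7-9)[OF t] by (simp_all add: m_def)
      have "table n (take m (iarr s 2)) (take m (iarr s 3)) (take m (rarr s 1)) m f"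
        using t len unfolding table_def m_def[symmetric] by (simp cong: conj_cong)
      then show ?case using 6 len mN by (simp add: m_def[symmetric])
    qed (use W mN K in simp_all)
  qed (use W mN L K in \<open>simp_all add: m_def\<close>)
qed

lemma wp_multiply:
  fixes \<epsilon> :: real
  assumes W': "16 * k \<le> W" and N': "16 * real k * (\<epsilon> + 1) \<le> 4 ^ a * \<epsilon>"
      "\<And>i. 2 \<le> i \<Longrightarrow> i < a \<Longrightarrow> 4 ^ i * \<epsilon> < 16 * real k * (\<epsilon> + 1)"
  shows "wp (multiply S K') (\<lambda>t s'.
     t \<le> n * (2 * Sort n + 2100 * n + 130 * N + 40 * K' + 102) + 30 * N + 30 \<and>
     (\<exists>m f D. table n (iarr s' 0) (iarr s' 1) (rarr s' 0) m f \<and> length (iarr s' 0) = m \<and>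
       length (iarr s' 1) = m \<and> length (rarr s' 0) = m \<and> approx n (real N / 16) (partial_product n) f D))
     (matrix_input n k \<epsilon> A B)"
proof -
  let ?s = "matrix_input n k \<epsilon> A B"
  have s: "rvar ?s 0 = \<epsilon>" "ivar ?s 0 = n" "ivar ?s 1 = k" "ivar ?s 3 = 0"
    "tape True ?s = concat (map list_of_vec (cols A))" "tape False ?s = concat (map list_of_vec (rows B))"
    by (simp_all add: matrix_input_def blank_state_def tape_def)
  have N16: "16 \<le> N" using power_increasing[OF N(2), of "4::nat"] unfolding N(1) by simp
  show ?thesis unfolding multiply_def
  proof (rule wp_Seq_cut[OF wp_choose_capacity[OF s(1,3) W' _ N']], goal_cases)
    case 1 then show ?case using N16 W by simp
  next
    case (4 t1 s1)
    have s1: "ivar s1 0 = n" "ivar s1 2 = N" "ivar s1 3 = 0" "tape b s1 = tape b ?s" for b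
      using 4 s by (simp_all add: unchanged_def choose_capacity_def tape_def)
    have alloc: "wp allocate (\<lambda>t s2. t \<le> 8 + 8 * N \<and> ivar s2 3 = 0 \<and> sizes s2 \<and>
        (\<forall>b. tape b s2 = tape b ?s)) s1"
      unfolding allocate_def
      by (intro wp_Seq wp_INew wp_RNew) (use s1 W L K in \<open>simp_all add: sizes_def\<close>)
    show ?case
    proof (rule wp_Seq_cut[OF alloc], goal_cases)
      case (1 t2 s2)
      have inv0: "invariant 0 (s2\<lparr>ivar := (ivar s2)(20 := 0)\<rparr>)"
        unfolding invariant_def
      proof (intro conjI exI)
        show "approx n (real N / 16) (partial_product 0) (\<lambda>x. 0) 0"
          using approx_refl[of n "\<lambda>x. 0"] by (simp add: partial_product_def[abs_def])
      qed (use 1(2) s table_empty in \<open>simp_all add: sizes_def\<close>)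
      have loop: "wp (for_upto 20 (IVar 0) (step S K')) (\<lambda>t s'.
          t \<le> 2 + n * (2 * Sort n + 2100 * n + 130 * N + 40 * K' + 102) \<and> invariant n s') s2"
      proof (rule wp_for_upto[where M = n and \<tau> = "\<lambda>_. 2 * Sort n + 2100 * n + 130 * N + 40 * K' + 100" and
            J = invariant], goal_cases)
        case (3 s')
        then show ?case using inv0 by simp
      next
        case (4 i s')
        then show ?case using W by (simp add: invariant_def sizes_def)
      next
        case (5 i s')
        show ?case
        proof (rule wp_cut[OF wp_step[OF 5(2,1)]], goal_cases)
          case (1 t s'')
          have "IScalar 20 \<notin> targets (step S K')"
            using targets_erase[of 50 K'] targets_shift[of 50 S]
            by (auto simp: step_def load_sorted_def)
          then have "ivar s'' 20 = i" using 1(1) 5(4) by (simp add: unchanged_def)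
          moreover have "invariant (Suc i) (s''\<lparr>ivar := (ivar s'')(20 := Suc i)\<rparr>)"
            using 1(2) by (simp add: invariant_def sizes_def)
          ultimately show ?case using 1(2) by simp
        qed
      next
        case (6 t s')
        then show ?case by (simp add: algebra_simps)
      qed (use W K in simp_all)
      show ?case
      proof (rule wp_Seq_cut[OF loop], goal_cases)
        case (1 t3 s3)
        note t3 = 1(2)[THEN conjunct1]
        from 1(2)[THEN conjunct2] obtain f D where
          tab: "table n (iarr s3 2) (iarr s3 3) (rarr s3 1) (ivar s3 3) f"
          and app: "approx n (real N / 16) (partial_product n) f D" and cnt: "4 * ivar s3 3 \<le> 3 * N"
          unfolding invariant_def by blast
        have "ivar s3 3 \<le> N" using cnt by simp
        show ?case
        proof (rule wp_cut[OF wp_emit[OF tab \<open>ivar s3 3 \<le> N\<close>]], goal_cases)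
          case (1 t4 s4)
          have "t1 \<le> 2 + 2 * N" "t2 \<le> 8 + 8 * N" "t4 \<le> 10 + 10 * N"
            using 4(2) \<open>t2 \<le> _ \<and> _\<close> 1(2) by simp_all
          then have "t1 + (t2 + (t3 + t4)) \<le>
              n * (2 * Sort n + 2100 * n + 130 * N + 40 * K' + 102) + 30 * N + 30"
            using t3 by linarith
          then show ?case using 1(2) app by blast
        qed
      qed
    qed
  qed simp_all
qed

end

section \<open>From the error budget to the norm bounds\<close>

lemma (in product_machine) partial_n:
  assumes "x \<in> {..<n} \<times> {..<n}"
  shows "partial_product n x = (A * B) $$ x"
proof -
  obtain i j where x: "x = (i, j)" "i < n" "j < n" using assms by auto
  then show ?thesis
    using A(1) B(1) by (simp add: partial_product_def scalar_prod_def atLeast0LessThan)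
qed

lemma (in product_machine) approx_norm:
  fixes \<epsilon> :: real and k p :: nat
  assumes app: "approx n (real N / 16) (partial_product n) f D"
    and \<epsilon>: "0 < \<epsilon>" and k: "1 \<le> k" and p: "1 \<le> p" and N': "16 * real k * (\<epsilon> + 1) \<le> 4 ^ a * \<epsilon>"
  shows "entrywise_norm p (A * B - mat n n f)
    \<le> (1 + \<epsilon>) powr (1 / real p) * (\<epsilon> / real k) powr (1 - 1 / real p) * residual_norm k (A * B)"
proof -
  let ?E = "A * B - mat n n f" and ?R = "residual_norm k (A * B)"
  let ?e = "\<lambda>x. (A * B) $$ x - f x"
  have pos: "positions (A * B) = {..<n} \<times> {..<n}" "positions ?E = {..<n} \<times> {..<n}"
    using A(1) B(1) by (auto simp: positions_def)
  have E: "?E $$ x = ?e x" if "x \<in> {..<n} \<times> {..<n}" for x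
    using that A(1) B(1) by auto
  have e: "0 \<le> (A * B) $$ x" "0 \<le> ?e x \<and> ?e x \<le> (A * B) $$ x \<and> ?e x \<le> D" if "x \<in> {..<n} \<times> {..<n}" for x
    using approxD(3-5)[OF app that] unfolding partial_n[OF that] by linarith+
  have "(\<Sum>x \<in> {..<n} \<times> {..<n}. partial_product n x - f x) = (\<Sum>x \<in> positions (A * B). ?e x)"
    unfolding pos by (intro sum.cong refl) (simp add: partial_n)
  then have budget: "real N / 16 * D \<le> (\<Sum>x \<in> positions (A * B). ?e x)"
    using approxD(2)[OF app] by simp
  \<comment> \<open>Dividing the exit condition of \<open>choose_capacity\<close> by
    \<open>16 * \<epsilon>\<close> gives the bound on \<open>b\<close> that
    \<open>residual_error\<close> needs.\<close>
  have "(real k + real k / \<epsilon>) * (16 * \<epsilon>) = 16 * real k * (\<epsilon> + 1)" using \<epsilon> by (simp add: field_simps)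
  also have "\<dots> \<le> (real N / 16) * (16 * \<epsilon>)" using N' N(1) by simp
  finally have b: "real k + real k / \<epsilon> \<le> real N / 16" using \<epsilon> by simp
  have D: "D \<le> \<epsilon> / real k * ?R" and sum: "(\<Sum>x \<in> positions (A * B). ?e x) \<le> (1 + \<epsilon>) * ?R"
    using residual_error[of "A * B" ?e, OF _ _ budget b k \<epsilon> approxD(1)[OF app]] e unfolding pos by blast+
  have "0 \<le> (\<Sum>x \<in> positions (A * B). ?e x)" using e unfolding pos by (intro sum_nonneg) blast
  then have "0 \<le> (1 + \<epsilon>) * ?R" using sum by linarith
  then have R: "0 \<le> ?R" using \<epsilon> by (simp add: zero_le_mult_iff)
  show ?thesis
  proof (rule entrywise_norm_bound[OF p])
    fix x assume x: "x \<in> positions ?E"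
    then have "\<bar>?E $$ x\<bar> = ?e x" using E e unfolding pos by simp
    also have "\<dots> \<le> D" using e x unfolding pos by blast
    finally show "\<bar>?E $$ x\<bar> \<le> \<epsilon> / real k * ?R" using D by linarith
  next
    have "(\<Sum>x\<in>positions ?E. \<bar>?E $$ x\<bar>) = (\<Sum>x \<in> positions (A * B). ?e x)"
      unfolding pos by (intro sum.cong refl) (use E e in simp)
    then show "(\<Sum>x\<in>positions ?E. \<bar>?E $$ x\<bar>) \<le> (1 + \<epsilon>) * ?R" using sum by simp
  qed (use \<epsilon> k R in auto)
qed

text \<open>As \<open>2 \<le> z\<close>, constant factors are absorbed by powers of
  \<open>z\<close>: \<open>512 = 2 ^ 9\<close> for the linear bounds and
  \<open>8 \<le> 2 ^ 8\<close> for the quadratic one, so ten extra factors suffice.\<close>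

lemma word_bound:
  fixes n k e N z :: nat
  assumes "n + 2 \<le> z" "k \<le> z" "N \<le> 128 * z"
  shows "(n + 2) ^ e \<le> z ^ (e + 10)" "4 * n * n + 4 \<le> z ^ (e + 10)" "2 * n + 4 \<le> z ^ (e + 10)"
    "2 * N + 4 \<le> z ^ (e + 10)" "16 * k \<le> z ^ (e + 10)"
proof -
  have z: "2 \<le> z" using assms by simp
  have "(n + 2) ^ e \<le> z ^ e" using assms(1) by (rule power_mono) simp
  also have "\<dots> \<le> z ^ (e + 10)" using z by (intro power_increasing) auto
  finally show "(n + 2) ^ e \<le> z ^ (e + 10)" .
  have 1: "512 * z \<le> z ^ (e + 10)"
  proof -
    have "512 * z \<le> z ^ 9 * z" using power_mono[OF z, of 9] by (intro mult_le_mono1) simp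
    also have "\<dots> = z ^ 10" by (simp add: power_numeral_reduce)
    also have "\<dots> \<le> z ^ (e + 10)" using z by (intro power_increasing) auto
    finally show ?thesis .
  qed
  show "2 * n + 4 \<le> z ^ (e + 10)" "2 * N + 4 \<le> z ^ (e + 10)" "16 * k \<le> z ^ (e + 10)"
    using 1 assms z by linarith+
  have zz: "4 \<le> z * z" using mult_le_mono[OF z z] by simp
  have "4 * n * n + 4 \<le> 4 * (z * z) + 4" using mult_le_mono[of n z n z] assms(1) by simp
  also have "\<dots> \<le> 8 * (z * z)" using zz by linarith
  also have "\<dots> \<le> z ^ 8 * (z * z)" using power_mono[OF z, of 8] by (intro mult_le_mono1) simp
  also have "\<dots> = z ^ 10" by (simp add: power_numeral_reduce)
  also have "\<dots> \<le> z ^ (e + 10)" using z by (intro power_increasing) auto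
  finally show "4 * n * n + 4 \<le> z ^ (e + 10)" .
qed

text \<open>Here \<open>s\<close> stands for the sorting time and \<open>q\<close> for
  \<open>k / \<epsilon>\<close>. The assumption \<open>n \<le> s\<close> absorbs the terms quadratic
  in \<open>n\<close>, and \<open>1 \<le> n\<close> those linear in \<open>N\<close>.\<close>

lemma cost_bounds:
  fixes q :: real and n N s e K K' :: nat
  assumes "1 \<le> n" "n \<le> s" "real N \<le> 128 * q" "0 \<le> q"
    and t: "t \<le> n * (2 * s + 2100 * n + 130 * N + 40 * K' + 102) + 30 * N + 30"
    and m: "m \<le> 2 * K * (e * (n + 1) + n + N)"
    and c: "c = 21000 + 40 * real K' + 2 * real K * (2 * real e + 129)"
  shows "real t \<le> c * (real n * real s + real n * q)" "real m \<le> c * (real n + q)"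
proof -
  let ?ns = "real n * real s" and ?nq = "real n * q"
  have n: "1 \<le> real n" "real n \<le> real s" using assms by simp_all
  have a: "real n * real n \<le> ?ns" using n by (intro mult_left_mono) auto
  have b: "1 \<le> ?ns" using mult_mono[of 1 "real n" 1 "real s"] n by simp
  have d: "real n \<le> ?ns" using mult_left_mono[of 1 "real s" "real n"] n by simp
  have f: "real N \<le> 128 * ?nq" "real n * real N \<le> 128 * ?nq"
  proof -
    have "real N \<le> real n * real N" using n(1) by (simp add: mult_le_cancel_right1)
    moreover have "real n * real N \<le> real n * (128 * q)" using assms(3) by (intro mult_left_mono) auto
    ultimately show "real N \<le> 128 * ?nq" "real n * real N \<le> 128 * ?nq" by simp_all
  qed
  have nonneg: "0 \<le> ?ns" "0 \<le> ?nq" using assms by simp_all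
  have K'd: "40 * real K' * real n \<le> 40 * real K' * ?ns" using d by (intro mult_left_mono) auto
  have "real t \<le> real (n * (2 * s + 2100 * n + 130 * N + 40 * K' + 102) + 30 * N + 30)"
    using t by (rule of_nat_mono)
  also have "\<dots> = 2 * ?ns + 2100 * (real n * real n) + 130 * (real n * real N) + 40 * real K' * real n
      + 102 * real n + 30 * real N + 30"
    by (simp add: algebra_simps)
  \<comment> \<open>The constants are \<open>2234 = 2 + 2100 + 102 + 30\<close> and
    \<open>20480 = 128 * (130 + 30)\<close>; 21000 exceeds both.\<close>
  also have "\<dots> \<le> (2234 + 40 * real K') * ?ns + 20480 * ?nq"
    using a b d f K'd by (simp add: distrib_right)
  also have "\<dots> \<le> c * ?ns + c * ?nq"
    using nonneg by (intro add_mono mult_right_mono) (simp_all add: c)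
  finally show "real t \<le> c * (?ns + ?nq)" by (simp add: distrib_left)
  have "real (e * (n + 1) + n + N) \<le> (2 * real e + 1) * real n + 128 * q"
    using mult_left_mono[OF n(1), of "real e"] assms(3) by (simp add: algebra_simps)
  also have "\<dots> \<le> (2 * real e + 129) * real n + (2 * real e + 129) * q"
    using assms by (intro add_mono mult_right_mono) auto
  finally have mm: "real (e * (n + 1) + n + N) \<le> (2 * real e + 129) * (real n + q)" by (simp add: distrib_left)
  have "real m \<le> real (2 * K * (e * (n + 1) + n + N))" using m by (rule of_nat_mono)
  also have "\<dots> = 2 * real K * real (e * (n + 1) + n + N)" by simp
  also have "\<dots> \<le> 2 * real K * ((2 * real e + 129) * (real n + q))" using mm by (rule mult_left_mono) simp
  also have "\<dots> = (2 * real K * (2 * real e + 129)) * (real n + q)" by (simp only: mult.assoc)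
  also have "\<dots> \<le> c * (real n + q)" using assms by (intro mult_right_mono) (simp_all add: c)
  finally show "real m \<le> c * (real n + q)" .
qed

theorem theorem1:
  fixes S :: com and Sort :: "nat \<Rightarrow> nat"
  assumes "linear_space_sorter S Sort"
  shows "\<exists>(P :: com) (c :: real) (d :: nat).
    \<forall>(\<epsilon> :: real) (k :: nat) (n :: nat) (A :: real mat) (B :: real mat).
      0 < \<epsilon> \<and> \<epsilon> < 1 \<and> k \<ge> 1 \<and> n \<ge> 1 \<and>
      A \<in> carrier_mat n n \<and> B \<in> carrier_mat n n \<and>
      (\<forall>i<n. \<forall>j<n. A $$ (i, j) \<ge> 0 \<and> B $$ (i, j) \<ge> 0) \<longrightarrow>
      (\<exists>t m s C'.
        exec ((n + nat \<lceil>real k / \<epsilon>\<rceil> + 2) ^ d) P (matrix_input n k \<epsilon> A B) t m s \<and>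
        returns_matrix n s C' \<and>
        real t \<le> c * (real n * real (Sort n) + real n * real k / \<epsilon>) \<and>
        real m \<le> c * (real n + real k / \<epsilon>) \<and>
        (\<forall>p\<ge>1. entrywise_norm p (A * B - C')
           \<le> (1 + \<epsilon>) powr (1 / real p) * (\<epsilon> / real k) powr (1 - 1 / real p)
              * residual_norm k (A * B)))"
proof -
  from assms[unfolded linear_space_sorter_sorts] obtain e where S: "sorts S Sort e" ..
  \<comment> \<open>\<open>K'\<close> exceeds every name used by \<open>S\<close>, so the program
    depends on the sorter alone and not on the input.\<close>
  define K' where "K' = Suc (Max (insert 0 (target_names ` targets S)))"
  have K': "target_names x < K'" if "x \<in> targets S" for x
  proof -
    have "finite (insert 0 (target_names ` targets S))" using finite_targets by simp
    moreover have "target_names x \<in> insert 0 (target_names ` targets S)" using that by simp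
    ultimately show ?thesis unfolding K'_def by (intro le_imp_less_Suc Max_ge)
  qed
  define c where "c = 21000 + 40 * real K' + 2 * real (K' + 50) * (2 * real e + 129)"
  show ?thesis
  proof (rule exI[of _ "multiply S K'"], rule exI[of _ c], rule exI[of _ "e + 10"],
      intro allI impI, elim conjE)
    fix \<epsilon> :: real and k n :: nat and A B :: "real mat"
    assume \<epsilon>: "0 < \<epsilon>" "\<epsilon> < 1" and k: "1 \<le> k" and n: "1 \<le> n"
      and A: "A \<in> carrier_mat n n" and B: "B \<in> carrier_mat n n"
      and nonneg: "\<forall>i<n. \<forall>j<n. 0 \<le> A $$ (i, j) \<and> 0 \<le> B $$ (i, j)"
    define z where "z = n + nat \<lceil>real k / \<epsilon>\<rceil> + 2"
    have q: "real k / \<epsilon> \<le> real (nat \<lceil>real k / \<epsilon>\<rceil>)" "real k \<le> real k / \<epsilon>" "0 \<le> real k / \<epsilon>"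
      using \<epsilon> by (simp_all add: le_divide_eq real_nat_ceiling_ge mult_left_le)
    obtain a where a: "2 \<le> a" "16 * real k * (\<epsilon> + 1) \<le> 4 ^ a * \<epsilon>"
      "\<And>i. 2 \<le> i \<Longrightarrow> i < a \<Longrightarrow> 4 ^ i * \<epsilon> < 16 * real k * (\<epsilon> + 1)" "4 ^ a \<le> 128 * (real k / \<epsilon>)"
      by (rule capacity_exists[OF \<epsilon> k]) (rule that)
    define N where "N = (4::nat) ^ a"
    have Nq: "real N \<le> 128 * (real k / \<epsilon>)" using a(4) by (simp add: N_def)
    have zr: "real z = real n + real (nat \<lceil>real k / \<epsilon>\<rceil>) + 2"
      unfolding z_def of_nat_add by (simp only: of_nat_numeral)
    have "real N \<le> 128 * real z" using Nq q(1) zr by linarith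
    then have Nz3: "N \<le> 128 * z" by (metis of_nat_le_iff of_nat_mult of_nat_numeral)
    have "real k \<le> real z" using q zr by linarith
    then have Nz2: "k \<le> z" by (simp only: of_nat_le_iff)
    have "n + 2 \<le> z" by (simp add: z_def)
    note Nz = this Nz2 Nz3
    \<comment> \<open>Room for the peak space of the sorter, for vectors of length \<open>n\<close>
      and for the summary arrays.\<close>
    define L where "L = e * (n + 1) + n + N"
    interpret product_machine "z ^ (e + 10)" "K' + 50" L S Sort e K' n N a A B
      by unfold_locales
        (use S K' word_bound[OF Nz, of e] A B nonneg n a(1) in \<open>auto simp: K'_def L_def N_def\<close>)
    have wf: "wf_state (K' + 50) L (matrix_input n k \<epsilon> A B)"
      by (auto simp: wf_state_def matrix_input_def blank_state_def)
    have "wp (multiply S K') (\<lambda>t s'.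
       t \<le> n * (2 * Sort n + 2100 * n + 130 * N + 40 * K' + 102) + 30 * N + 30 \<and>
       (\<exists>m f D. table n (iarr s' 0) (iarr s' 1) (rarr s' 0) m f \<and> length (iarr s' 0) = m \<and>
         length (iarr s' 1) = m \<and> length (rarr s' 0) = m \<and> approx n (real N / 16) (partial_product n) f D))
       (matrix_input n k \<epsilon> A B)"
      by (rule wp_multiply[OF word_bound(5)[OF Nz] a(2,3)])
    then obtain t m s h f D where
      ex: "exec (z ^ (e + 10)) (multiply S K') (matrix_input n k \<epsilon> A B) t m s"
      and m: "m \<le> 2 * (K' + 50) * L"
      and t: "t \<le> n * (2 * Sort n + 2100 * n + 130 * N + 40 * K' + 102) + 30 * N + 30"
      and tab: "table n (iarr s 0) (iarr s 1) (rarr s 0) h f"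
      and len: "length (iarr s 0) = h" "length (iarr s 1) = h" "length (rarr s 0) = h"
      and app: "approx n (real N / 16) (partial_product n) f D"
      unfolding wp_def using wf by (elim impE exE conjE)
    note cost = cost_bounds[OF n sorter_time[OF S] Nq q(3) t m[unfolded L_def] c_def]
    have "returns_matrix n s (mat n n f)"
      unfolding returns_matrix_def Let_def using table_map_of[OF tab len] len by simp
    moreover have "real t \<le> c * (real n * real (Sort n) + real n * real k / \<epsilon>)"
      using cost(1) by simp
    moreover have "\<forall>p\<ge>1. entrywise_norm p (A * B - mat n n f)
           \<le> (1 + \<epsilon>) powr (1 / real p) * (\<epsilon> / real k) powr (1 - 1 / real p) * residual_norm k (A * B)"
      using approx_norm[OF app \<epsilon>(1) k _ a(2)] by simp
    ultimately show "\<exists>t m s C'.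
        exec ((n + nat \<lceil>real k / \<epsilon>\<rceil> + 2) ^ (e + 10)) (multiply S K') (matrix_input n k \<epsilon> A B) t m s \<and>
        returns_matrix n s C' \<and>
        real t \<le> c * (real n * real (Sort n) + real n * real k / \<epsilon>) \<and>
        real m \<le> c * (real n + real k / \<epsilon>) \<and>
        (\<forall>p\<ge>1. entrywise_norm p (A * B - C')
           \<le> (1 + \<epsilon>) powr (1 / real p) * (\<epsilon> / real k) powr (1 - 1 / real p)
              * residual_norm k (A * B))"
      using ex cost(2) unfolding z_def by (intro exI conjI)
  qed
qed

end
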